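(* Let $1<p\le q<\infty$. If $$0<\alpha,\quad 0<\sigma,\quad 0<\rho,\quad \rho(2n+1)<2n\sigma,\quad \alpha p'<2(n+1),\quad q\rho<2n,$$ and $$-\frac{\alpha}{2(n+1)}+\frac1{p'}+\frac{\rho}{2n}-\frac1q=0,$$ then there exists a constant $C$ such that for all $f\in\mathcal{S}(\mathbb{H}^n)$, $$\left(\int_{\Omega\times\mathbb{C}^n}|\tilde f(a,w)|^q\,u_{\sigma,\rho}(a,w)^q\,dw\,d\nu_2(a)\right)^{1/q}\le C\left(\int_{\mathbb{H}^n}|f(z,t)|^p\,v_\alpha(z,t)^p\,dz\,dt\right)^{1/p},$$ where $v_\alpha(z,t)=(|z|^4+16t^2)^{\alpha/4}$ on $\mathbb{H}^n$, and, on $\Omega\times\mathbb{C}^n$, $u_{\sigma,\rho}(a,w)=((2k+n)|\lambda|)^{-\sigma}|w|^{-\rho}$ for $a=(\lambda,(2k+n)|\lambda|)$ with $|\lambda|>1$ and $w\ne0$, and $u_{\sigma,\rho}(a,w)=0$ otherwise.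
   Context: The Heisenberg group $\mathbb{H}^n=\mathbb{C}^n\times\mathbb{R}$ ($n\ge1$) has group law $(z,t)(w,s)=(z+w,\,t+s+\frac12\operatorname{Im}(z\cdot\bar w))$, with Lebesgue (Haar) measure $dz\,dt$; $\mathcal{S}(\mathbb{H}^n)$ is the Schwartz space on $\mathbb{C}^n\times\mathbb{R}$. For $\delta>-1$, $k\in\{0,1,2,\dots\}$, the Laguerre polynomial is $L_k^\delta(t)=\frac{t^{-\delta}e^t}{k!}\left(\frac{d}{dt}\right)^k(e^{-t}t^{k+\delta})$. For $\lambda\in\mathbb{R}^*=\mathbb{R}\setminus\{0\}$ put $\varphi^{n-1}_{k,\lambda}(z)=L^{n-1}_k(\frac12|\lambda||z|^2)e^{-\frac14|\lambda||z|^2}$ and $e^{n-1}_{k,\lambda}(z,t)=e^{i\lambda t}\varphi^{n-1}_{k,\lambda}(z)$. The Heisenberg fan $\Omega$ is the union of the rays $R_k=\{(\lambda,(2k+n)|\lambda|):\lambda\in\mathbb{R}^*\}$, $k=0,1,2,\dots$, and $R_\infty=\{(0,\tau):\tau\ge0\}$. The Strichartz Fourier transform of $f$ is the function on $\Omega\times\mathbb{C}^n$ given by $\widehat f(a,w)=\int_{\mathbb{H}^n}f(z,t)\,e_a((z,t)^{-1}(w,0))\,dz\,dt$ for $a=(\lambda,(2k+n)|\lambda|)\in R_k$, where $e_a=e^{n-1}_{k,\lambda}$, and $\widehat f(0,\tau,w)=(n-1)!\,2^{n-1}\int_{\mathbb{H}^n}f(z,t)\frac{J_{n-1}(\sqrt\tau|w-z|)}{(\sqrt\tau|w-z|)^{n-1}}\,dz\,dt$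 on $R_\infty$ ($J_{n-1}$ the Bessel function). The normalized transform is $\tilde f(a,w)=\frac{k!(n-1)!}{(k+n-1)!}\widehat f(a,w)$ for $a\in R_k$ and $\tilde f(0,\tau,w)=\widehat f(0,\tau,w)$. The measure $\nu_2$ on $\Omega$ is defined by $$\int_\Omega\phi(a)\,d\nu_2(a)=(2\pi)^{-2n-1}\int_{-\infty}^\infty\left(\sum_{k=0}^\infty\left(\frac{(k+n-1)!}{k!(n-1)!}\right)^2\phi(\lambda,(2k+n)|\lambda|)\right)|\lambda|^{2n}\,d\lambda.$$ $p'$ is the Hölder conjugate of $p$. *)

theory Defs
  imports "HOL-Analysis.Analysis"
begin

text \<open>Iterated partial derivatives along a list of directions; the last list entry is applied
  first.\<close>

fun iter_partial ::
  "'a::euclidean_space list \<Rightarrow> ('a \<Rightarrow> 'b::real_normed_vector) \<Rightarrow> 'a \<Rightarrow> 'b" where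
  "iter_partial [] f = f"
| "iter_partial (b # bs) f = (\<lambda>x. frechet_derivative (iter_partial bs f) (at x) b)"

text \<open>Total differentiability of every iterated partial derivative amounts to smoothness.\<close>

definition schwartz :: "('a::euclidean_space \<Rightarrow> 'b::real_normed_vector) set" where
  "schwartz = {f. \<forall>bs \<in> lists Basis.
     (\<forall>x. iter_partial bs f differentiable (at x)) \<and>
     (\<forall>N. \<exists>B. \<forall>x. (1 + norm x) ^ N * norm (iter_partial bs f x) \<le> B)}"

definition hmult :: "(complex^'n) \<times> real \<Rightarrow> (complex^'n) \<times> real \<Rightarrow> (complex^'n) \<times> real" where
  "hmult x y = (fst x + fst y,
     snd x + snd y + 1/2 * Im (\<Sum>i\<in>UNIV. fst x $ i * cnj (fst y $ i)))"

definition hinv :: "(complex^'n) \<times> real \<Rightarrow> (complex^'n) \<times> real" where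
  "hinv x = (- fst x, - snd x)"

lemma hmult_assoc: "hmult (hmult x y) z = hmult x (hmult y z)"
  by (simp add: hmult_def algebra_simps sum.distrib)

lemma hmult_inv: "hmult x (hinv x) = (0, 0)" "hmult (hinv x) x = (0, 0)"
  by (simp_all add: hmult_def hinv_def sum_negf)

text \<open>The Rodrigues formula only makes sense for positive arguments (note that
  \<open>0 powr a = 0\<close>), so the polynomial is characterised by its values there.\<close>

definition laguerre :: "real \<Rightarrow> nat \<Rightarrow> real poly" where
  "laguerre \<delta> k = (THE P. \<forall>t>0. poly P t =
     t powr (-\<delta>) * exp t / fact k *
       (deriv ^^ k) (\<lambda>s. exp (-s) * s powr (real k + \<delta>)) t)"

lemma rodrigues_poly:
  "\<exists>P :: real poly. \<forall>t>0. (deriv ^^ j) (\<lambda>s. exp (-s) * s powr a) t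
     = exp (-t) * t powr (a - real j) * poly P t"
proof (induction j)
  case 0
  show ?case by (intro exI[of _ 1]) auto
next
  case (Suc j)
  then obtain P :: "real poly" where P: "\<forall>t>0. (deriv ^^ j) (\<lambda>s. exp (-s) * s powr a) t
     = exp (-t) * t powr (a - real j) * poly P t" by blast
  define Q where "Q = smult (a - real j) P + pCons 0 (pderiv P - P)"
  have "(deriv ^^ Suc j) (\<lambda>s. exp (-s) * s powr a) t
     = exp (-t) * t powr (a - real (Suc j)) * poly Q t" if t: "t > 0" for t
  proof -
    have D: "((\<lambda>t. exp (-t) * t powr (a - real j) * poly P t) has_real_derivative
        exp (-t) * t powr (a - real (Suc j)) * poly Q t) (at t)"
    proof -
      have e: "t powr (a - real j) = t * t powr (a - real (Suc j))"
        using t powr_mult_base[of t "a - real (Suc j)"] by (simp add: algebra_simps)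
      have e': "t powr (a - real j - 1) = t powr (a - real (Suc j))"
        by (simp add: algebra_simps)
      show ?thesis
        unfolding Q_def
        by (rule derivative_eq_intros refl poly_DERIV t
              | (simp add: e e' algebra_simps))+
    qed
    have "((deriv ^^ j) (\<lambda>s. exp (-s) * s powr a) has_real_derivative
        exp (-t) * t powr (a - real (Suc j)) * poly Q t) (at t)"
      by (rule has_field_derivative_transform_within_open[OF D, of "{0<..}"]) (use P t in auto)
    then show ?thesis
      by (simp add: DERIV_imp_deriv)
  qed
  then show ?case by blast
qed

lemma laguerre_rodrigues:
  assumes "t > 0"
  shows "poly (laguerre \<delta> k) t = t powr (-\<delta>) * exp t / fact k *
       (deriv ^^ k) (\<lambda>s. exp (-s) * s powr (real k + \<delta>)) t"
proof -
  let ?R = "\<lambda>t. t powr (-\<delta>) * exp t / fact k *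
       (deriv ^^ k) (\<lambda>s. exp (-s) * s powr (real k + \<delta>)) t"
  obtain P :: "real poly" where P: "\<forall>t>0. (deriv ^^ k) (\<lambda>s. exp (-s) * s powr (real k + \<delta>)) t
     = exp (-t) * t powr (real k + \<delta> - real k) * poly P t"
    using rodrigues_poly by blast
  have ex: "\<forall>t>0. poly (smult (1 / fact k) P) t = ?R t"
  proof (intro allI impI)
    fix t :: real assume t: "t > 0"
    have "t powr (-\<delta>) * t powr \<delta> = 1" "exp t * exp (-t) = 1"
      using t by (simp_all add: powr_add[symmetric] exp_minus)
    then have "(t powr (-\<delta>) * t powr \<delta>) * (exp t * exp (-t)) * poly P t / fact k = poly P t / fact k"
      by simp
    then show "poly (smult (1 / fact k) P) t = ?R t"
      using P t by (simp add: mult_ac)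
  qed
  have "Q = Q'" if "\<forall>t>0. poly Q t = ?R t" "\<forall>t>0. poly Q' t = ?R t" for Q Q'
  proof (rule ccontr)
    assume "Q \<noteq> Q'"
    then have "finite {t. poly (Q - Q') t = 0}"
      by (intro poly_roots_finite) simp
    moreover have "{0<..} \<subseteq> {t. poly (Q - Q') t = 0}"
      using that by auto
    ultimately show False
      using infinite_Ioi finite_subset by blast
  qed
  then have "\<exists>!P. \<forall>t>0. poly P t = ?R t"
    using ex by blast
  from theI'[OF this] show ?thesis
    using assms unfolding laguerre_def by blast
qed

definition bessel_J :: "nat \<Rightarrow> real \<Rightarrow> real" where
  "bessel_J m x = (\<Sum>j. (-1) ^ j / (fact j * fact (j + m)) * (x / 2) ^ (2 * j + m))"

text \<open>The continuous extension of \<open>J\<^sub>m(x) / x\<^sup>m\<close> to \<open>x = 0\<close>, needed for the point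
  \<open>\<tau> = 0\<close> of the limiting ray.\<close>

definition bessel_quot :: "nat \<Rightarrow> real \<Rightarrow> real" where
  "bessel_quot m x = (if x = 0 then 1 / (2 ^ m * fact m) else bessel_J m x / x ^ m)"

definition lag_phi :: "nat \<Rightarrow> real \<Rightarrow> complex^'n \<Rightarrow> real" where
  "lag_phi k l z = poly (laguerre (real CARD('n) - 1) k) (1/2 * \<bar>l\<bar> * (norm z)\<^sup>2)
     * exp (- (1/4) * \<bar>l\<bar> * (norm z)\<^sup>2)"

definition e_fun :: "nat \<Rightarrow> real \<Rightarrow> (complex^'n) \<times> real \<Rightarrow> complex" where
  "e_fun k l x = exp (\<i> * complex_of_real (l * snd x)) * complex_of_real (lag_phi k l (fst x))"

definition fan_ray :: "nat \<Rightarrow> nat \<Rightarrow> (real \<times> real) set" where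
  "fan_ray n k = {(l, (2 * real k + real n) * \<bar>l\<bar>) | l. l \<noteq> 0}"

definition fan_ray_inf :: "(real \<times> real) set" where
  "fan_ray_inf = {(0, \<tau>) | \<tau>. \<tau> \<ge> 0}"

definition heisenberg_fan :: "nat \<Rightarrow> (real \<times> real) set" where
  "heisenberg_fan n = (\<Union>k. fan_ray n k) \<union> fan_ray_inf"

definition fan_index :: "nat \<Rightarrow> real \<times> real \<Rightarrow> nat" where
  "fan_index n a = (THE k. a \<in> fan_ray n k)"

lemma fan_index_ray: "a \<in> fan_ray n k \<Longrightarrow> fan_index n a = k"
  unfolding fan_index_def by (rule the_equality) (auto simp: fan_ray_def)

definition fan_weight :: "nat \<Rightarrow> nat \<Rightarrow> real" where
  "fan_weight n k = fact (k + n - 1) / (fact k * fact (n - 1))"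

text \<open>\<open>\<nu>\<^sub>2\<close> as the image of a weighted measure on pairs \<open>(k, \<lambda>)\<close>. The null set
  \<open>\<lambda> = 0\<close> is sent to the origin, which belongs to the limiting ray. The defining integral
  formula is lemma \<open>nn_integral_nu2\<close>.\<close>

definition nu2 :: "nat \<Rightarrow> (real \<times> real) measure" where
  "nu2 n = distr
     (density (count_space UNIV \<Otimes>\<^sub>M lborel)
        (\<lambda>(k, l). ennreal (1 / (2 * pi) ^ (2 * n + 1) * ((fan_weight n k)\<^sup>2 * \<bar>l\<bar> ^ (2 * n)))))
     (restrict_space borel (heisenberg_fan n))
     (\<lambda>(k, l). (l, (2 * real k + real n) * \<bar>l\<bar>))"

lemma space_nu2: "space (nu2 n) = heisenberg_fan n"
  and sets_nu2: "sets (nu2 n) = sets (restrict_space borel (heisenberg_fan n))"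
  by (simp_all add: nu2_def space_restrict_space)

lemma nn_integral_nu2:
  fixes \<phi> :: "real \<times> real \<Rightarrow> ennreal"
  assumes [measurable]: "\<phi> \<in> borel_measurable (nu2 n)"
  shows "(\<integral>\<^sup>+ a. \<phi> a \<partial>nu2 n) = ennreal (1 / (2 * pi) ^ (2 * n + 1)) *
    (\<integral>\<^sup>+ l. (\<Sum>k. ennreal ((fact (k + n - 1) / (fact k * fact (n - 1)))\<^sup>2) *
        \<phi> (l, (2 * real k + real n) * \<bar>l\<bar>)) * ennreal (\<bar>l\<bar> ^ (2 * n)) \<partial>lborel)"
proof -
  let ?N = "count_space (UNIV :: nat set) \<Otimes>\<^sub>M (lborel :: real measure)"
  let ?g = "\<lambda>(k::nat, l). (l, (2 * real k + real n) * \<bar>l\<bar>)"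
  let ?w = "\<lambda>(k, l). ennreal (1 / (2 * pi) ^ (2 * n + 1) * ((fan_weight n k)\<^sup>2 * \<bar>l\<bar> ^ (2 * n)))"
  have g0: "?g \<in> ?N \<rightarrow>\<^sub>M borel"
    by (intro measurable_pair_measure_countable1) simp_all
  have g: "?g \<in> ?N \<rightarrow>\<^sub>M restrict_space borel (heisenberg_fan n)"
  proof (rule measurable_restrict_space2[OF _ g0])
    show "?g \<in> space ?N \<rightarrow> heisenberg_fan n"
      by (auto simp: heisenberg_fan_def fan_ray_def fan_ray_inf_def)
  qed
  have w [measurable]: "?w \<in> borel_measurable ?N"
    by (intro measurable_pair_measure_countable1) simp_all
  have \<phi>: "\<phi> \<in> borel_measurable (restrict_space borel (heisenberg_fan n))"
    using assms by (simp add: nu2_def)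
  have \<phi>g [measurable]: "(\<lambda>x. \<phi> (?g x)) \<in> borel_measurable ?N"
    using measurable_compose[OF g \<phi>] .
  have \<phi>gk [measurable]: "(\<lambda>l. \<phi> (l, (2 * real k + real n) * \<bar>l\<bar>)) \<in> borel_measurable lborel" for k
    using measurable_compose[OF measurable_Pair1'[of k] \<phi>g] by simp
  interpret P: pair_sigma_finite "count_space (UNIV :: nat set)" "lborel :: real measure"
    by (intro pair_sigma_finite.intro sigma_finite_measure_count_space lborel.sigma_finite_measure_axioms)
  have "(\<integral>\<^sup>+ a. \<phi> a \<partial>nu2 n) = (\<integral>\<^sup>+ x. ?w x * \<phi> (?g x) \<partial>?N)"
    unfolding nu2_def
    using g \<phi> by (subst nn_integral_distr) (simp_all add: nn_integral_density)
  also have "\<dots> = (\<integral>\<^sup>+ l. \<integral>\<^sup>+ k. ?w (k, l) * \<phi> (?g (k, l)) \<partial>count_space UNIV \<partial>lborel)"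
    by (rule P.nn_integral_snd[symmetric]) measurable
  also have "\<dots> = (\<integral>\<^sup>+ l. ennreal (1 / (2 * pi) ^ (2 * n + 1)) *
      ((\<Sum>k. ennreal ((fact (k + n - 1) / (fact k * fact (n - 1)))\<^sup>2) *
        \<phi> (l, (2 * real k + real n) * \<bar>l\<bar>)) * ennreal (\<bar>l\<bar> ^ (2 * n))) \<partial>lborel)"
  proof (rule nn_integral_cong)
    fix l :: real
    define c where "c = 1 / (2 * pi) ^ (2 * n + 1)"
    define d where "d k = ((fact (k + n - 1) / (fact k * fact (n - 1)))\<^sup>2 :: real)" for k
    define b where "b = \<bar>l\<bar> ^ (2 * n)"
    have c: "c \<ge> 0" and d: "\<And>k. d k \<ge> 0" and b: "b \<ge> 0"
      by (simp_all add: c_def d_def b_def)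
    have "(\<integral>\<^sup>+ k. ?w (k, l) * \<phi> (?g (k, l)) \<partial>count_space UNIV)
      = (\<Sum>k. ennreal (c * (d k * b)) * \<phi> (l, (2 * real k + real n) * \<bar>l\<bar>))"
      by (simp add: nn_integral_count_space_nat fan_weight_def c_def d_def b_def)
    also have "\<dots> = (\<Sum>k. (ennreal c * ennreal b) *
        (ennreal (d k) * \<phi> (l, (2 * real k + real n) * \<bar>l\<bar>)))"
      using c d b by (simp only: ennreal_mult mult_nonneg_nonneg) (simp only: mult_ac)
    also have "\<dots> = ennreal c *
        ((\<Sum>k. ennreal (d k) * \<phi> (l, (2 * real k + real n) * \<bar>l\<bar>)) * ennreal b)"
      by (simp only: ennreal_suminf_cmult) (simp only: mult_ac)
    finally show "(\<integral>\<^sup>+ k. ?w (k, l) * \<phi> (?g (k, l)) \<partial>count_space UNIV) =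
      ennreal (1 / (2 * pi) ^ (2 * n + 1)) *
      ((\<Sum>k. ennreal ((fact (k + n - 1) / (fact k * fact (n - 1)))\<^sup>2) *
        \<phi> (l, (2 * real k + real n) * \<bar>l\<bar>)) * ennreal (\<bar>l\<bar> ^ (2 * n)))"
      unfolding c_def d_def b_def .
  qed
  also have "\<dots> = ennreal (1 / (2 * pi) ^ (2 * n + 1)) *
    (\<integral>\<^sup>+ l. (\<Sum>k. ennreal ((fact (k + n - 1) / (fact k * fact (n - 1)))\<^sup>2) *
        \<phi> (l, (2 * real k + real n) * \<bar>l\<bar>)) * ennreal (\<bar>l\<bar> ^ (2 * n)) \<partial>lborel)"
    by (rule nn_integral_cmult) measurable
  finally show ?thesis .
qed

text \<open>The transforms are meant as functions on \<open>heisenberg_fan CARD('n) \<times> UNIV\<close>; values at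
  other points are irrelevant. On the fan, \<open>fst a \<noteq> 0\<close> says that \<open>a\<close> lies on the ray with index
  \<open>fan_index CARD('n) a\<close>, and \<open>fst a = 0\<close> that it lies on the limiting ray.\<close>

definition strichartz ::
  "((complex^'n) \<times> real \<Rightarrow> complex) \<Rightarrow> real \<times> real \<Rightarrow> complex^'n \<Rightarrow> complex" where
  "strichartz f a w =
     (if fst a \<noteq> 0 then
        (LINT x|lborel. f x * e_fun (fan_index CARD('n) a) (fst a) (hmult (hinv x) (w, 0)))
      else
        fact (CARD('n) - 1) * 2 ^ (CARD('n) - 1) *
        (LINT x|lborel. f x * complex_of_real
           (bessel_quot (CARD('n) - 1) (sqrt (snd a) * norm (w - fst x)))))"

definition strichartz_normalized ::
  "((complex^'n) \<times> real \<Rightarrow> complex) \<Rightarrow> real \<times> real \<Rightarrow> complex^'n \<Rightarrow> complex" where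
  "strichartz_normalized f a w =
     (if fst a \<noteq> 0 then
        (let k = fan_index CARD('n) a in
           fact k * fact (CARD('n) - 1) / fact (k + CARD('n) - 1) * strichartz f a w)
      else strichartz f a w)"

definition v_weight :: "real \<Rightarrow> (complex^'n) \<times> real \<Rightarrow> real" where
  "v_weight \<alpha> x = (norm (fst x) ^ 4 + 16 * (snd x)\<^sup>2) powr (\<alpha> / 4)"

text \<open>For \<open>a = (\<lambda>, (2k + n)\<bar>\<lambda>\<bar>)\<close> on the fan, \<open>fst a = \<lambda>\<close> and \<open>snd a = (2k + n)\<bar>\<lambda>\<bar>\<close>.\<close>

definition u_weight :: "real \<Rightarrow> real \<Rightarrow> real \<times> real \<Rightarrow> complex^'n \<Rightarrow> real" where
  "u_weight \<sigma> \<rho> a w =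
     (if \<bar>fst a\<bar> > 1 \<and> w \<noteq> 0 then snd a powr (-\<sigma>) * norm w powr (-\<rho>) else 0)"

end

theory Submission
  imports Defs "HOL-Probability.Probability"
begin

text \<open>
  The normalised transform satisfies two endpoint bounds: its sup norm is at most
  \<open>\<parallel>f\<parallel>\<^sub>1\<close>, and its \<open>L\<^sup>2\<close> norm for \<open>\<nu>\<^sub>2 \<otimes> dw\<close> is at most \<open>\<parallel>f\<parallel>\<^sub>2\<close>.  Both rest on the relation
  \<open>\<phi>\<^sub>j \<times>\<^sub>\<lambda> \<phi>\<^sub>k = \<delta>\<^sub>j\<^sub>k (2\<pi>/\<bar>\<lambda>\<bar>)\<^sup>n \<phi>\<^sub>k\<close> for the twisted convolution: it makes the Laguerre kernels mutually
  orthogonal projections (whence Bessel's inequality in \<open>z\<close>, to be combined with Plancherel in \<open>t\<close>), and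
  its case \<open>j = k\<close> gives \<open>\<bar>\<phi>\<^sub>k(w)\<bar> \<le> \<phi>\<^sub>k(0)\<close> by Cauchy-Schwarz.  The relation is obtained by
  comparing coefficients: the generating function of the \<open>\<phi>\<^sub>k\<close> is a Gaussian, and the twisted convolution of
  two such Gaussians is a Gaussian integral.

  Let \<open>Q = 2n + 2\<close>.  The function \<open>v\<^sub>\<alpha>\<^sup>-\<^sup>1\<close> lies in weak \<open>L\<^sup>Q\<^sup>/\<^sup>\<alpha>\<close> and \<open>u\<close> in weak
  \<open>L\<^sup>2\<^sup>n\<^sup>/\<^sup>\<rho>\<close>, the latter because \<open>\<rho>(2n + 1) < 2n\<sigma>\<close>.  With \<open>\<theta> = 1/p + \<alpha>/Q\<close> the hypotheses force
  \<open>1/2 < \<theta> < 1\<close>.  On the dyadic shells of \<open>u\<close> one splits \<open>f\<close> at the matching level of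
  \<open>v\<^sub>\<alpha>\<close>, applies the \<open>L\<^sup>1\<close> bound to one part and a Hausdorff-Young bound with exponent \<open>1/e\<close> for some
  \<open>e < \<theta>\<close> to the other, and sums geometric series over the shells.
\<close>

subsection \<open>Laguerre polynomials\<close>

text \<open>Write k and h for the powers of 1/v and u that lie in weak L^1, A for \<alpha>/Q and S
  for \<rho>/(2n). The balance condition then reads 1/q = 1 - \<theta> + S. On the shell h ~ 2^j the
  function f is cut at k = 2^(-j), because at this level the powers of 2^j cancel in both
  contributions. The obstacle is summation over j: Hoelder's inequality with the whole norm of f
  would give the same bound on every shell. Hence half of the gap between \<theta> and 1, or between
  e and \<theta>, is spent on an extra power of k. Each shell then sees only a term c_j of a
  sequence whose sum is controlled by the p-th power of the weighted norm. The estimate produces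
  c_j^(q/p), and p \<le> q makes that summable. The exponent e has to exceed 1/2 for
  Hausdorff-Young, 1/p for Hoelder's inequality against the weighted norm, and 1 - 1/q so that the
  dual exponent 1/(1-e) is larger than q. All three bounds lie below \<theta>. All steps take place
  on integrable functions, where cutting preserves integrability and the transform is an absolutely
  convergent integral, so no extension by density occurs.\<close>

definition falling :: "real \<Rightarrow> nat \<Rightarrow> real" where
  "falling a m = (\<Prod>l<m. a - real l)"

lemma falling_Suc: "falling a (Suc m) = falling a m * (a - real m)"
  by (simp add: falling_def)

lemma falling_nat:
  assumes "m \<le> N" shows "falling (real N) m = fact N / fact (N - m)"
  using assms
proof (induction m)
  case 0
  show ?case by (simp add: falling_def)
next
  case (Suc m)
  have "fact (N - m) = real (N - m) * fact (N - Suc m)"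
    using Suc.prems by (subst fact_reduce) (auto simp: Suc_diff_Suc)
  then show ?case using Suc by (simp add: falling_Suc of_nat_diff)
qed

text \<open>Leibniz rule for the \<open>j\<close>-th derivative of exp(-s) s^a: \<open>i\<close>
  derivatives fall on the exponential and give the sign, the others fall on the power. The factor
  exp(-t) t^(a-j) is taken out, so that t^i is what remains.\<close>

definition rodrigues_coeff :: "real \<Rightarrow> nat \<Rightarrow> nat \<Rightarrow> real" where
  "rodrigues_coeff a j i = (-1) ^ i * real (j choose i) * falling a (j - i)"

lemma rodrigues_coeff_Suc:
  "rodrigues_coeff a (Suc j) i = (a - real j + real i) * rodrigues_coeff a j i
     - (if i = 0 then 0 else rodrigues_coeff a j (i - 1))"
proof (cases i)
  case 0
  then show ?thesis by (simp add: rodrigues_coeff_def falling_Suc)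
next
  case (Suc m)
  show ?thesis
  proof (cases "i \<le> j")
    case True
    then have e: "j - m = Suc (j - Suc m)" using Suc by simp
    have "real (j - Suc m) = real j - real (Suc m)" using True Suc by (simp add: of_nat_diff)
    then show ?thesis
      unfolding rodrigues_coeff_def Suc by (simp add: falling_Suc e algebra_simps)
  next
    case False
    then consider "m = j" | "m > j" using Suc by linarith
    then show ?thesis
      by cases (auto simp: rodrigues_coeff_def Suc falling_def binomial_eq_0)
  qed
qed

lemma rodrigues_explicit:
  assumes "t > 0"
  shows "(deriv ^^ j) (\<lambda>s. exp (-s) * s powr a) t
     = exp (-t) * t powr (a - real j) * (\<Sum>i\<le>j. rodrigues_coeff a j i * t ^ i)"
proof -
  define P where "P j = (\<Sum>i\<le>j. monom (rodrigues_coeff a j i) i)" for j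
  have cP: "coeff (P j) i = rodrigues_coeff a j i" for j i
    by (auto simp: P_def coeff_sum sum.delta rodrigues_coeff_def binomial_eq_0)
  \<comment> \<open>The polynomial left over when exp(-t) t^(a-j) times \<open>P j\<close> is
    differentiated and t^(a-j-1) is taken out.\<close>
  have PS: "P (Suc j) = smult (a - real j) (P j) + pCons 0 (pderiv (P j) - P j)" for j
    by (rule poly_eqI)
      (auto simp: cP rodrigues_coeff_Suc coeff_pCons coeff_pderiv algebra_simps split: nat.splits)
  have "\<forall>t>0. (deriv ^^ j) (\<lambda>s. exp (-s) * s powr a) t
     = exp (-t) * t powr (a - real j) * poly (P j) t"
  proof (induction j)
    case 0
    show ?case by (simp add: P_def rodrigues_coeff_def falling_def)
  next
    case (Suc j)
    have "(deriv ^^ Suc j) (\<lambda>s. exp (-s) * s powr a) t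
     = exp (-t) * t powr (a - real (Suc j)) * poly (P (Suc j)) t" if t: "t > 0" for t
    proof -
      have e: "t powr (a - real j) = t * t powr (a - real (Suc j))"
        using t powr_mult_base[of t "a - real (Suc j)"] by (simp add: algebra_simps)
      have e': "t powr (a - real j - 1) = t powr (a - real (Suc j))"
        by (simp add: algebra_simps)
      have D: "((\<lambda>t. exp (-t) * t powr (a - real j) * poly (P j) t) has_real_derivative
        exp (-t) * t powr (a - real (Suc j)) * poly (P (Suc j)) t) (at t)"
        unfolding PS
        by (rule derivative_eq_intros refl poly_DERIV t
              | (simp add: e e' algebra_simps))+
      have "((deriv ^^ j) (\<lambda>s. exp (-s) * s powr a) has_real_derivative
        exp (-t) * t powr (a - real (Suc j)) * poly (P (Suc j)) t) (at t)"
        by (rule has_field_derivative_transform_within_open[OF D, of "{0<..}"]) (use Suc t in auto)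
      then show ?thesis
        by (simp add: DERIV_imp_deriv)
    qed
    then show ?case by blast
  qed
  then show ?thesis using assms by (simp add: P_def poly_sum poly_monom)
qed

lemma laguerre_explicit:
  assumes n: "n \<ge> (1::nat)"
  shows "poly (laguerre (real n - 1) k) t =
    (\<Sum>i\<le>k. real ((k + n - 1) choose (k - i)) * (- t) ^ i / fact i)"
proof -
  define P where "P = (\<Sum>i\<le>k. monom (real ((k + n - 1) choose (k - i)) * (-1) ^ i / fact i) i)"
  have P: "poly P t = (\<Sum>i\<le>k. real ((k + n - 1) choose (k - i)) * (- t) ^ i / fact i)" for t
    by (simp add: P_def poly_sum poly_monom power_minus[of t] mult_ac)
  have c: "rodrigues_coeff (real (k + n - 1)) k i / fact k
     = real ((k + n - 1) choose (k - i)) * (-1) ^ i / fact i" if "i \<le> k" for i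
  proof -
    have f: "falling (real (k + n - 1)) (k - i) = fact (k + n - 1) / fact (k + n - 1 - (k - i))"
      using n by (intro falling_nat) simp
    have b: "real ((k + n - 1) choose (k - i)) = fact (k + n - 1) / (fact (k - i) * fact (k + n - 1 - (k - i)))"
      using n by (intro binomial_fact) simp
    have b': "real (k choose i) = fact k / (fact i * fact (k - i))"
      using that by (rule binomial_fact)
    show ?thesis unfolding rodrigues_coeff_def f b b' by (simp add: mult_ac)
  qed
  have "poly (laguerre (real n - 1) k) t = poly P t" if "t > 0" for t
  proof -
    have r: "real k + (real n - 1) = real (k + n - 1)" using n by (simp add: of_nat_diff)
    have d: "real (k + n - 1) - real k = real n - 1" using r by simp
    have "poly (laguerre (real n - 1) k) t = t powr (-(real n - 1)) * exp t / fact k *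
       (exp (-t) * t powr (real n - 1) * (\<Sum>i\<le>k. rodrigues_coeff (real (k + n - 1)) k i * t ^ i))"
      unfolding laguerre_rodrigues[OF that] r rodrigues_explicit[OF that] d by simp
    also have "\<dots> = (t powr (-(real n - 1)) * t powr (real n - 1)) * (exp t * exp (-t)) *
       (\<Sum>i\<le>k. rodrigues_coeff (real (k + n - 1)) k i * t ^ i) / fact k"
      by simp
    also have "\<dots> = (\<Sum>i\<le>k. rodrigues_coeff (real (k + n - 1)) k i * t ^ i) / fact k"
      using that by (simp add: powr_add[symmetric] exp_minus)
    also have "\<dots> = (\<Sum>i\<le>k. rodrigues_coeff (real (k + n - 1)) k i / fact k * t ^ i)"
      by (simp add: sum_divide_distrib)
    also have "\<dots> = (\<Sum>i\<le>k. real ((k + n - 1) choose (k - i)) * (-1) ^ i / fact i * t ^ i)"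
      by (intro sum.cong refl arg_cong2[where f="(*)"] c) simp
    also have "\<dots> = poly P t"
      by (simp add: P_def poly_sum poly_monom)
    finally show ?thesis .
  qed
  \<comment> \<open>The Rodrigues formula determines the values at t > 0 only. A polynomial that
    vanishes on a half-line is zero, which gives every real t, including the negative arguments used
    for majorants below.\<close>
  then have "{0<..} \<subseteq> {t. poly (laguerre (real n - 1) k - P) t = 0}" by auto
  then have "laguerre (real n - 1) k - P = 0"
    using poly_roots_finite infinite_Ioi finite_subset by blast
  then show ?thesis using P by simp
qed

text \<open>Newton's binomial series with exponent -(N+1): negating the upper index makes the
  coefficient an ordinary binomial one and absorbs the signs.\<close>

lemma negative_binomial_sums:
  assumes "\<bar>r::real\<bar> < 1"
  shows "(\<lambda>m. real ((m + N) choose N) * r ^ m) sums (1 / (1 - r) ^ Suc N)"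
proof -
  have "(\<lambda>m. ((- real (Suc N)) gchoose m) * (- r) ^ m) sums (1 + - r) powr (- real (Suc N))"
    by (rule gen_binomial_real) (use assms in auto)
  moreover have "((- real (Suc N)) gchoose m) * (- r) ^ m = real ((m + N) choose N) * r ^ m" for m
  proof -
    have "((- real (Suc N)) gchoose m) = (-1) ^ m * (real (m + N) gchoose m)"
      by (subst gbinomial_minus) (simp add: algebra_simps)
    also have "(real (m + N) gchoose m) = real ((m + N) choose N)"
      by (metis binomial_gbinomial add_diff_cancel_right' binomial_symmetric le_add1 add.commute)
    finally show ?thesis by (simp add: power_minus[of r])
  qed
  moreover have "(1 + - r) powr (- real (Suc N)) = 1 / (1 - r) ^ Suc N"
    using assms by (simp only: powr_minus_divide powr_realpow) (simp add: powr_realpow del: of_nat_Suc power_Suc)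
  ultimately show ?thesis by simp
qed

text \<open>Inserting the explicit coefficients and writing k = i + m gives the double series
  \<open>g\<close>. Summed over m it is a negative binomial series, and the results form an
  exponential series in i; summed over the diagonals i + m = k it returns the Laguerre polynomials.
  The majorant for the other two claims is the same series at -|t|, where all coefficients are
  nonnegative.\<close>

lemma laguerre_generating:
  assumes n: "n \<ge> (1::nat)" and r: "\<bar>r\<bar> < 1"
  shows "(\<lambda>k. r ^ k * poly (laguerre (real n - 1) k) t) sums (exp (- (r * t / (1 - r))) / (1 - r) ^ n)"
    and "summable (\<lambda>k. \<bar>r\<bar> ^ k * \<bar>poly (laguerre (real n - 1) k) t\<bar>)"
    and "t \<ge> 0 \<Longrightarrow> (\<Sum>k. \<bar>r\<bar> ^ k * \<bar>poly (laguerre (real n - 1) k) t\<bar>)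
           \<le> exp (\<bar>r\<bar> * t / (1 - \<bar>r\<bar>)) / (1 - \<bar>r\<bar>) ^ n"
proof -
  define g where "g r t i m = real ((m + i + n - 1) choose (i + n - 1)) * r ^ m * ((- (r * t)) ^ i / fact i)"
    for r t :: real and i m :: nat
  have row: "(\<lambda>m. g r t i m) sums ((1 / (1 - r) ^ n) * ((- (r * t) / (1 - r)) ^ i /\<^sub>R fact i))"
    if "\<bar>r\<bar> < 1" for r t i
  proof -
    have "(\<lambda>m. real ((m + (i + n - 1)) choose (i + n - 1)) * r ^ m * ((- (r * t)) ^ i / fact i))
       sums (1 / (1 - r) ^ Suc (i + n - 1) * ((- (r * t)) ^ i / fact i))"
      by (intro sums_mult2 negative_binomial_sums that)
    moreover have "m + (i + n - 1) = m + i + n - 1" for m using n by simp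
    moreover have "1 / (1 - r) ^ Suc (i + n - 1) * ((- (r * t)) ^ i / fact i)
      = (1 / (1 - r) ^ n) * ((- (r * t) / (1 - r)) ^ i /\<^sub>R fact i)"
      unfolding power_divide using n by (simp add: power_add field_simps)
    ultimately show ?thesis unfolding g_def by simp
  qed
  have tot: "(\<lambda>i. (1 / (1 - r) ^ n) * ((- (r * t) / (1 - r)) ^ i /\<^sub>R fact i))
      sums ((1 / (1 - r) ^ n) * exp (- (r * t) / (1 - r)))" for r t :: real
    by (intro sums_mult exp_converges)
  \<comment> \<open>Absolute values stay within the family \<open>g\<close>, so absolute summability
    is again an instance of the row sums.\<close>
  have absg: "\<bar>g r t i m\<bar> = g \<bar>r\<bar> (- \<bar>t\<bar>) i m" for r t i m
    by (simp add: g_def abs_mult power_abs)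
  have hs_row: "((\<lambda>m. g r t i m) has_sum ((1 / (1 - r) ^ n) * ((- (r * t) / (1 - r)) ^ i /\<^sub>R fact i))) UNIV"
    if "\<bar>r\<bar> < 1" for r t i
  proof (rule norm_summable_imp_has_sum[OF _ row[OF that]])
    show "summable (\<lambda>m. norm (g r t i m))"
      using row[of "\<bar>r\<bar>" "-\<bar>t\<bar>" i] that by (simp add: absg sums_iff)
  qed
  have hs_tot: "((\<lambda>i. (1 / (1 - r) ^ n) * ((- (r * t) / (1 - r)) ^ i /\<^sub>R fact i))
     has_sum ((1 / (1 - r) ^ n) * exp (- (r * t) / (1 - r)))) UNIV" for r t :: real
  proof (rule norm_summable_imp_has_sum[OF _ tot])
    have "summable (\<lambda>i. \<bar>1 / (1 - r) ^ n\<bar> * norm ((- (r * t) / (1 - r)) ^ i /\<^sub>R fact i))"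
      by (intro summable_mult summable_norm_exp)
    then show "summable (\<lambda>i. norm ((1 / (1 - r) ^ n) * ((- (r * t) / (1 - r)) ^ i /\<^sub>R fact i)))"
      by (simp add: abs_mult)
  qed
  have summ: "(\<lambda>p. norm (case p of (i, m) \<Rightarrow> g r t i m)) summable_on UNIV \<times> UNIV" if "\<bar>r\<bar> < 1" for r t
  proof -
    have "(\<lambda>p. norm (case p of (i, m) \<Rightarrow> g r t i m)) summable_on Sigma UNIV (\<lambda>_. UNIV)"
    proof (rule summable_on_SigmaI[where g = "\<lambda>i. (1 / (1 - \<bar>r\<bar>) ^ n) * ((- (\<bar>r\<bar> * - \<bar>t\<bar>) / (1 - \<bar>r\<bar>)) ^ i /\<^sub>R fact i)"])
      show "((\<lambda>m. norm (case (i, m) of (i, m) \<Rightarrow> g r t i m)) has_sum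
         (1 / (1 - \<bar>r\<bar>) ^ n) * ((- (\<bar>r\<bar> * - \<bar>t\<bar>) / (1 - \<bar>r\<bar>)) ^ i /\<^sub>R fact i)) UNIV" for i
        using hs_row[of "\<bar>r\<bar>" "- \<bar>t\<bar>" i] that by (simp add: absg)
    next
      show "(\<lambda>i. (1 / (1 - \<bar>r\<bar>) ^ n) * ((- (\<bar>r\<bar> * - \<bar>t\<bar>) / (1 - \<bar>r\<bar>)) ^ i /\<^sub>R fact i)) summable_on UNIV"
        by (rule has_sum_imp_summable[OF hs_tot])
    qed simp_all
    then show ?thesis by simp
  qed
  have full: "((\<lambda>(i, m). g r t i m) has_sum ((1 / (1 - r) ^ n) * exp (- (r * t) / (1 - r)))) (UNIV \<times> UNIV)"
    if "\<bar>r\<bar> < 1" for r t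
    using hs_row[OF that] hs_tot abs_summable_summable[OF summ[OF that]]
    by (intro has_sum_SigmaI) auto
  have diag: "bij_betw (\<lambda>(k, i). (i, k - i)) (SIGMA k:UNIV. {..k}) (UNIV \<times> (UNIV :: nat set))"
    by (rule bij_betw_byWitness[where f' = "\<lambda>(i, m). (i + m, i)"]) auto
  have cell: "g r t i (k - i) = r ^ k * (real ((k + n - 1) choose (k - i)) * (- t) ^ i / fact i)"
    if "i \<le> k" for r t i k
  proof -
    have "(k + n - 1) choose (i + n - 1) = (k + n - 1) choose (k - i)"
      using that n by (subst binomial_symmetric) (auto intro: arg_cong2[where f="(choose)"])
    moreover have "r ^ (k - i) * (- (r * t)) ^ i = r ^ k * (- t) ^ i"
    proof -
      have "r ^ (k - i) * (- (r * t)) ^ i = r ^ (k - i) * (r * (- t)) ^ i" by simp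
      also have "\<dots> = r ^ (k - i + i) * (- t) ^ i" by (simp only: power_mult_distrib power_add mult.assoc)
      finally show ?thesis using that by simp
    qed
    ultimately show ?thesis using that unfolding g_def by (simp add: mult_ac)
  qed
  have full': "((\<lambda>(k, i). g r t i (k - i)) has_sum ((1 / (1 - r) ^ n) * exp (- (r * t) / (1 - r))))
     (SIGMA k:UNIV. {..k})" if "\<bar>r\<bar> < 1" for r t
    using full[OF that, of t] has_sum_reindex_bij_betw[OF diag, of "\<lambda>(i, m). g r t i m"]
    by (simp add: case_prod_unfold)
  have col: "(\<Sum>i\<le>k. g r t i (k - i)) = r ^ k * poly (laguerre (real n - 1) k) t" for k r t
    by (simp add: laguerre_explicit[OF n] sum_distrib_left cell)
  have main: "((\<lambda>k. r ^ k * poly (laguerre (real n - 1) k) t) has_sum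
       ((1 / (1 - r) ^ n) * exp (- (r * t) / (1 - r)))) UNIV" if "\<bar>r\<bar> < 1" for r t
    by (rule has_sum_SigmaD[OF full'[OF that]]) (simp add: col[symmetric] has_sum_finite)
  from has_sum_imp_sums[OF main[OF r]] show "(\<lambda>k. r ^ k * poly (laguerre (real n - 1) k) t)
      sums (exp (- (r * t / (1 - r))) / (1 - r) ^ n)" by simp
  have dom: "\<bar>r\<bar> ^ k * \<bar>poly (laguerre (real n - 1) k) t\<bar> \<le> \<bar>r\<bar> ^ k * poly (laguerre (real n - 1) k) (- \<bar>t\<bar>)" for k t
    unfolding laguerre_explicit[OF n]
    by (intro mult_left_mono order_trans[OF sum_abs]) (auto simp: abs_mult power_abs)
  have s: "(\<lambda>k. \<bar>r\<bar> ^ k * poly (laguerre (real n - 1) k) (- \<bar>t\<bar>)) sums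
      ((1 / (1 - \<bar>r\<bar>) ^ n) * exp (- (\<bar>r\<bar> * - \<bar>t\<bar>) / (1 - \<bar>r\<bar>)))" for t
    using r by (intro has_sum_imp_sums main) auto
  show sm: "summable (\<lambda>k. \<bar>r\<bar> ^ k * \<bar>poly (laguerre (real n - 1) k) t\<bar>)"
    by (rule summable_comparison_test'[OF sums_summable[OF s]]) (use dom in auto)
  show "(\<Sum>k. \<bar>r\<bar> ^ k * \<bar>poly (laguerre (real n - 1) k) t\<bar>)
           \<le> exp (\<bar>r\<bar> * t / (1 - \<bar>r\<bar>)) / (1 - \<bar>r\<bar>) ^ n" if "t \<ge> 0"
    using suminf_le[OF dom sm sums_summable[OF s]] sums_unique[OF s, of t] that by simp
qed

subsection \<open>Gaussian integrals\<close>

text \<open>Scaling by sqrt(2A) reduces all three claims to the density of the standard normal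
  distribution and its characteristic function.\<close>

lemma gaussian_char_real:
  fixes y :: real
  assumes A: "A > 0"
  shows "integrable lborel (\<lambda>x::real. exp (- (A * x\<^sup>2)))"
    and "integrable lborel (\<lambda>x. complex_of_real (exp (- (A * x\<^sup>2))) * exp (\<i> * complex_of_real (x * y)))"
    and "(LINT x|lborel. complex_of_real (exp (- (A * x\<^sup>2))) * exp (\<i> * complex_of_real (x * y)))
      = complex_of_real (sqrt (pi / A) * exp (- (y\<^sup>2 / (4 * A))))"
proof -
  let ?I = "LINT x|lborel. complex_of_real (exp (- (A * x\<^sup>2))) * exp (\<i> * complex_of_real (x * y))"
  define s where "s = sqrt (2 * A)"
  have s: "s > 0" "s\<^sup>2 = 2 * A" using A by (auto simp: s_def)
  have e: "exp (- (A * x\<^sup>2)) = sqrt (2 * pi) * std_normal_density (0 + s * x)" for x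
    using s by (simp add: std_normal_density_def power_mult_distrib)
  have "integrable lborel (\<lambda>x. std_normal_density (0 + s * x))"
    using s by (intro lborel_integrable_real_affine integrable_normal_density) auto
  then show i: "integrable lborel (\<lambda>x::real. exp (- (A * x\<^sup>2)))"
    unfolding e by (rule integrable_mult_right)
  show "integrable lborel (\<lambda>x. complex_of_real (exp (- (A * x\<^sup>2))) * exp (\<i> * complex_of_real (x * y)))"
    by (rule Bochner_Integration.integrable_bound[OF i]) (auto simp: norm_mult)
  have "complex_of_real (exp (- ((y / s)\<^sup>2 / 2))) = char std_normal_distribution (y / s)"
    by (simp add: char_std_normal_distribution)
  also have "\<dots> = (LINT x|lborel. std_normal_density x *\<^sub>R exp (\<i> * complex_of_real (y / s * x)))"
    unfolding char_def by (subst integral_density) auto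
  also have "\<dots> = \<bar>s\<bar> *\<^sub>R (LINT x|lborel. std_normal_density (0 + s * x) *\<^sub>R exp (\<i> * complex_of_real (y / s * (0 + s * x))))"
    using s by (intro lborel_integral_real_affine) simp
  also have "\<dots> = \<bar>s\<bar> *\<^sub>R (LINT x|lborel. (1 / sqrt (2 * pi)) *\<^sub>R (complex_of_real (exp (- (A * x\<^sup>2))) * exp (\<i> * complex_of_real (x * y))))"
  proof -
    have "std_normal_density (0 + s * x) *\<^sub>R exp (\<i> * complex_of_real (y / s * (0 + s * x)))
        = (1 / sqrt (2 * pi)) *\<^sub>R (complex_of_real (exp (- (A * x\<^sup>2))) * exp (\<i> * complex_of_real (x * y)))" for x
      using s by (simp add: e scaleR_conv_of_real mult_ac)
    then show ?thesis by simp
  qed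
  finally have *: "complex_of_real (exp (- ((y / s)\<^sup>2 / 2))) = (s / sqrt (2 * pi)) *\<^sub>R ?I"
    using s by simp
  have "(y / s)\<^sup>2 / 2 = y\<^sup>2 / (4 * A)" using s by (simp add: power_divide)
  moreover have "sqrt (2 * pi) / s = sqrt (pi / A)"
    using A unfolding s_def by (simp add: real_sqrt_divide real_sqrt_mult)
  moreover have "?I
     = (sqrt (2 * pi) / s) *\<^sub>R complex_of_real (exp (- ((y / s)\<^sup>2 / 2)))"
    unfolding * using s by simp
  ultimately show "?I
      = complex_of_real (sqrt (pi / A) * exp (- (y\<^sup>2 / (4 * A))))"
    by (simp add: scaleR_conv_of_real)
qed

lemma lborel_integral_prod:
  fixes f :: "'a::euclidean_space \<Rightarrow> real \<Rightarrow> complex"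
  assumes i: "\<And>b. b \<in> Basis \<Longrightarrow> integrable lborel (f b)"
  shows "integrable lborel (\<lambda>x::'a. \<Prod>b\<in>Basis. f b (x \<bullet> b))"
    and "(LINT x|lborel. (\<Prod>b\<in>Basis. f b (x \<bullet> b))) = (\<Prod>b\<in>Basis. (LINT x|lborel. f b x))"
proof -
  have [measurable]: "f b \<in> borel_measurable borel" if "b \<in> Basis" for b
    using i[OF that] by auto
  have m [measurable]: "(\<lambda>x::'a. \<Prod>b\<in>Basis. f b (x \<bullet> b)) \<in> borel_measurable borel"
    by measurable
  show "integrable lborel (\<lambda>x::'a. \<Prod>b\<in>Basis. f b (x \<bullet> b))"
    unfolding integrable_iff_bounded
  proof
    have "(\<integral>\<^sup>+ x. ennreal (norm (\<Prod>b\<in>(Basis::'a set). f b (x \<bullet> b))) \<partial>lborel)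
       = (\<integral>\<^sup>+ (x::'a). (\<Prod>b\<in>Basis. ennreal (norm (f b (x \<bullet> b)))) \<partial>lborel)"
      by (simp add: prod_norm[symmetric] prod_ennreal)
    also have "\<dots> = (\<Prod>b\<in>(Basis::'a set). (\<integral>\<^sup>+ x. ennreal (norm (f b x)) \<partial>lborel))"
      by (intro nn_integral_lborel_prod) auto
    also have "\<dots> = (\<Prod>b\<in>(Basis::'a set). ennreal (LINT x|lborel. norm (f b x)))"
      by (intro prod.cong refl nn_integral_eq_integral integrable_norm i) auto
    also have "\<dots> < \<infinity>"
      by (simp add: prod_ennreal)
    finally show "(\<integral>\<^sup>+ (x::'a). ennreal (norm (\<Prod>b\<in>(Basis::'a set). f b (x \<bullet> b))) \<partial>lborel) < \<infinity>" .
  qed simp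
  \<comment> \<open>\<open>lborel\<close> is the image of a product of copies of the line under the
    coordinate map, so an integral of functions of single coordinates factors.\<close>
  interpret product_sigma_finite "\<lambda>_::'a. lborel :: real measure" ..
  have "(LINT x|lborel. (\<Prod>b\<in>Basis. f b (x \<bullet> b)))
     = (LINT g|(\<Pi>\<^sub>M b\<in>(Basis::'a set). lborel). (\<Prod>b\<in>Basis. f b ((\<Sum>b\<in>Basis. g b *\<^sub>R b) \<bullet> b)))"
    by (subst lborel_eq, subst integral_distr) (auto simp: m)
  also have "\<dots> = (LINT g|(\<Pi>\<^sub>M b\<in>(Basis::'a set). lborel). (\<Prod>b\<in>Basis. f b (g b)))"
    by simp
  also have "\<dots> = (\<Prod>b\<in>Basis. (LINT x|lborel. f b x))"
    by (rule product_integral_prod) (use i in auto)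
  finally show "(LINT x|lborel. (\<Prod>b\<in>Basis. f b (x \<bullet> b))) = (\<Prod>b\<in>Basis. (LINT x|lborel. f b x))" .
qed

lemma gaussian_char:
  fixes y :: "'a::euclidean_space"
  assumes A: "A > 0"
  shows "integrable lborel (\<lambda>x::'a. complex_of_real (exp (- (A * (norm x)\<^sup>2))) * exp (\<i> * complex_of_real (x \<bullet> y)))"
    and "(LINT x|lborel. complex_of_real (exp (- (A * (norm x)\<^sup>2))) * exp (\<i> * complex_of_real (x \<bullet> y)))
      = complex_of_real (sqrt (pi / A) ^ DIM('a) * exp (- ((norm y)\<^sup>2 / (4 * A))))"
proof -
  define f where "f b x = complex_of_real (exp (- (A * x\<^sup>2))) * exp (\<i> * complex_of_real (x * (y \<bullet> b)))" for b :: 'a and x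
  have f: "integrable lborel (f b)" for b
    unfolding f_def by (rule gaussian_char_real[OF A])
  have n2: "(norm x)\<^sup>2 = (\<Sum>b\<in>Basis. (x \<bullet> b)\<^sup>2)" for x :: 'a
    unfolding power2_norm_eq_inner by (simp add: euclidean_inner[of x x] power2_eq_square)
  have e: "complex_of_real (exp (- (A * (norm x)\<^sup>2))) * exp (\<i> * complex_of_real (x \<bullet> y)) = (\<Prod>b\<in>Basis. f b (x \<bullet> b))" for x
    unfolding f_def prod.distrib n2 euclidean_inner[of x y] of_real_prod[symmetric]
    by (simp add: exp_sum[symmetric] sum_negf sum_distrib_left)
  show "integrable lborel (\<lambda>x::'a. complex_of_real (exp (- (A * (norm x)\<^sup>2))) * exp (\<i> * complex_of_real (x \<bullet> y)))"
    unfolding e by (rule lborel_integral_prod(1)[OF f])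
  show "(LINT x|lborel. complex_of_real (exp (- (A * (norm x)\<^sup>2))) * exp (\<i> * complex_of_real (x \<bullet> y)))
      = complex_of_real (sqrt (pi / A) ^ DIM('a) * exp (- ((norm y)\<^sup>2 / (4 * A))))"
    unfolding e lborel_integral_prod(2)[OF f] unfolding f_def gaussian_char_real(3)[OF A]
    by (simp add: prod.distrib n2 of_real_prod[symmetric] exp_sum[symmetric] sum_negf sum_divide_distrib del: of_real_mult of_real_prod)
qed

lemma gaussian_integrable:
  assumes A: "A > 0"
  shows "integrable lborel (\<lambda>x::'a::euclidean_space. exp (- (A * (norm x)\<^sup>2)))"
  using integrable_norm[OF gaussian_char(1)[OF A, of 0]] by simp

lemma lborel_integral_shift:
  fixes f :: "'a::euclidean_space \<Rightarrow> 'b::{banach, second_countable_topology}"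
  shows "(LINT x|lborel. f (x + c)) = (LINT x|lborel. f x)"
    and "integrable lborel f \<Longrightarrow> integrable lborel (\<lambda>x. f (x + c))"
proof -
  have "integrable lborel (\<lambda>x. f (c + x))" if f: "integrable lborel f" for f :: "'a \<Rightarrow> 'b" and c
  proof -
    have "integrable (distr lborel borel ((+) c)) f"
      by (subst lborel_distr_plus) (rule f)
    then show ?thesis by (subst (asm) integrable_distr_eq) (use f in auto)
  qed note i = this
  show "integrable lborel f \<Longrightarrow> integrable lborel (\<lambda>x. f (x + c))"
    using i[of f c] by (simp add: add.commute)
  show "(LINT x|lborel. f (x + c)) = (LINT x|lborel. f x)"
  proof (cases "integrable lborel f")
    case True
    have "(LINT x|lborel. f x) = (LINT x|distr lborel borel ((+) c). f x)"
      by (subst lborel_distr_plus) rule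
    also have "\<dots> = (LINT x|lborel. f (c + x))"
      using True by (subst integral_distr) auto
    finally show ?thesis by (simp add: add.commute)
  next
    \<comment> \<open>Translating back shows that the translate is not integrable either, so both
      integrals have the default value 0.\<close>
    case False
    have "\<not> integrable lborel (\<lambda>x. f (x + c))"
      using i[of "\<lambda>x. f (x + c)" "- c"] False by auto
    then show ?thesis using False by (simp add: not_integrable_integral_eq)
  qed
qed

lemma lborel_integral_reflect:
  fixes f :: "'a::euclidean_space \<Rightarrow> 'b::{banach, second_countable_topology}"
  assumes f: "integrable lborel f"
  shows "(LINT x|lborel. f (c - x)) = (LINT x|lborel. f x)"
    and "integrable lborel (\<lambda>x. f (c - x))"
proof -
  have d: "lborel = distr lborel borel (\<lambda>x::'a. c - x)"
    by (subst lborel_affine[of "-1" c]) (auto simp: density_1 scaleR_minus_left)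
  have [measurable]: "f \<in> borel_measurable borel" using f by auto
  show "(LINT x|lborel. f (c - x)) = (LINT x|lborel. f x)"
    by (subst (2) d, subst integral_distr) auto
  have "integrable (distr lborel borel (\<lambda>x::'a. c - x)) f" using f d by simp
  then show "integrable lborel (\<lambda>x. f (c - x))"
    by (subst (asm) integrable_distr_eq) auto
qed

text \<open>Complete the square in u. The centre is a multiple of w, and w is orthogonal to y, so
  shifting to it leaves the phase unchanged and only the Fourier transform of a centred Gaussian
  remains.\<close>

lemma gaussian_twisted:
  fixes w y :: "'a::euclidean_space"
  assumes b: "b > 0" and d: "d > 0" and wy: "w \<bullet> y = 0"
  shows "(LINT u|lborel. complex_of_real (exp (- (b * (norm (w - u))\<^sup>2)) * exp (- (d * (norm u)\<^sup>2))) * exp (\<i> * complex_of_real (u \<bullet> y)))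
     = complex_of_real (sqrt (pi / (b + d)) ^ DIM('a) *
         exp (- (b * (norm w)\<^sup>2) + (b\<^sup>2 * (norm w)\<^sup>2 - (norm y)\<^sup>2 / 4) / (b + d)))"
proof -
  define A where "A = b + d"
  have A: "A > 0" using b d by (simp add: A_def)
  define c where "c = (b / A) *\<^sub>R w"
  define K where "K = - (b * (norm w)\<^sup>2) + b\<^sup>2 / A * (norm w)\<^sup>2"
  have ex: "exp (- (b * (norm (w - (u + c)))\<^sup>2)) * exp (- (d * (norm (u + c))\<^sup>2)) = exp K * exp (- (A * (norm u)\<^sup>2))" for u
  proof -
    have "d = A - b" by (simp add: A_def)
    have "- (b * (norm (w - (u + c)))\<^sup>2) + - (d * (norm (u + c))\<^sup>2) = K + - (A * (norm u)\<^sup>2)"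
      unfolding power2_norm_eq_inner K_def c_def \<open>d = A - b\<close> using A
      by (simp add: inner_simps inner_commute field_simps power2_eq_square)
    then show ?thesis by (metis exp_add)
  qed
  have ph: "(u + c) \<bullet> y = u \<bullet> y" for u
    using wy by (simp add: c_def inner_simps)
  have "(LINT u|lborel. complex_of_real (exp (- (b * (norm (w - u))\<^sup>2)) * exp (- (d * (norm u)\<^sup>2))) * exp (\<i> * complex_of_real (u \<bullet> y)))
    = (LINT u|lborel. complex_of_real (exp (- (b * (norm (w - (u + c)))\<^sup>2)) * exp (- (d * (norm (u + c))\<^sup>2))) * exp (\<i> * complex_of_real ((u + c) \<bullet> y)))"
    by (rule lborel_integral_shift(1)[symmetric])
  also have "\<dots> = (LINT u|lborel. complex_of_real (exp K) * (complex_of_real (exp (- (A * (norm u)\<^sup>2))) * exp (\<i> * complex_of_real (u \<bullet> y))))"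
    unfolding ex ph by (simp add: mult_ac)
  also have "\<dots> = complex_of_real (exp K) * complex_of_real (sqrt (pi / A) ^ DIM('a) * exp (- ((norm y)\<^sup>2 / (4 * A))))"
    using gaussian_char(2)[OF A] by simp
  also have "\<dots> = complex_of_real (sqrt (pi / A) ^ DIM('a) * (exp K * exp (- ((norm y)\<^sup>2 / (4 * A)))))"
    by simp
  also have "exp K * exp (- ((norm y)\<^sup>2 / (4 * A))) = exp (- (b * (norm w)\<^sup>2) + (b\<^sup>2 * (norm w)\<^sup>2 - (norm y)\<^sup>2 / 4) / A)"
    unfolding exp_add[symmetric] K_def by (simp add: diff_divide_distrib)
  finally show ?thesis by (simp add: A_def)
qed

subsection \<open>Laguerre functions and twisted convolution\<close>

text \<open>Only real arguments near 0 occur, so real and imaginary parts are treated separately. By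
  strong induction the coefficients of the difference below m vanish; dividing by x^m and letting x
  tend to 0 isolates the m-th one.\<close>

lemma powser_real_unique:
  fixes a b :: "nat \<Rightarrow> complex"
  assumes e: "e > 0"
    and a: "\<And>r::real. \<bar>r\<bar> < e \<Longrightarrow> (\<lambda>k. of_real (r ^ k) * a k) sums S r"
    and b: "\<And>r::real. \<bar>r\<bar> < e \<Longrightarrow> (\<lambda>k. of_real (r ^ k) * b k) sums S r"
  shows "a k = b k"
proof -
  have real0: "d m = 0" if d: "\<And>r::real. \<bar>r\<bar> < e \<Longrightarrow> (\<lambda>k. d k * r ^ k) sums 0" for d :: "nat \<Rightarrow> real" and m
  proof (induction m rule: less_induct)
    case (less m)
    have "((\<lambda>_::real. 0) \<longlongrightarrow> d (0 + m)) (at (0::real))"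
    proof (rule powser_limit_0_strong[OF e])
      fix x :: real assume x: "x \<noteq> 0" "norm x < e"
      have "(\<lambda>k. d (k + m) * x ^ (k + m)) sums (0 - (\<Sum>k<m. d k * x ^ k))"
        using d[of x] x by (intro sums_split_initial_segment) auto
      moreover have "(\<Sum>k<m. d k * x ^ k) = 0" using less by (intro sum.neutral) auto
      ultimately have "(\<lambda>k. inverse (x ^ m) * (d (k + m) * x ^ (k + m))) sums (inverse (x ^ m) * 0)"
        by (intro sums_mult) simp
      moreover have "inverse (x ^ m) * (d (k + m) * x ^ (k + m)) = d (k + m) * x ^ k" for k
        using x by (simp add: power_add field_simps)
      ultimately show "(\<lambda>k. d (k + m) * x ^ k) sums 0" by simp
    qed
    then show ?case using tendsto_unique[OF _ _ tendsto_const, of "at (0::real)" 0 "d m"] by simp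
  qed
  have ab: "(\<lambda>k. of_real (r ^ k) * (a k - b k)) sums 0" if "\<bar>r\<bar> < e" for r :: real
    using sums_diff[OF a[OF that] b[OF that]] by (simp add: algebra_simps)
  have "(\<lambda>k. Re (a k - b k) * r ^ k) sums 0" "(\<lambda>k. Im (a k - b k) * r ^ k) sums 0" if "\<bar>r\<bar> < e" for r :: real
    using sums_Re[OF ab[OF that]] sums_Im[OF ab[OF that]] by (simp_all add: mult_ac del: of_real_power)
  from real0[OF this(1)] real0[OF this(2)] show ?thesis by (simp add: complex_eq_iff)
qed

text \<open>The sum of r^k times the k-th Laguerre function. With t = |l||z|^2/2, the factor
  exp(-t/2) combines with exp(-rt/(1-r)) from the Laguerre generating function to give the quotient
  (1+r)/(1-r).\<close>

definition gauss_gen :: "real \<Rightarrow> real \<Rightarrow> complex^'n \<Rightarrow> real" where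
  "gauss_gen l r z = exp (- (\<bar>l\<bar> / 4 * ((1 + r) / (1 - r)) * (norm z)\<^sup>2)) / (1 - r) ^ CARD('n)"

lemma lag_phi_measurable [measurable]:
  "(\<lambda>z::complex^'n. lag_phi k l z) \<in> borel_measurable borel"
  unfolding lag_phi_def by (intro borel_measurable_continuous_onI continuous_intros)

lemma gauss_gen_measurable [measurable]:
  "(\<lambda>z::complex^'n. gauss_gen l r z) \<in> borel_measurable borel"
  unfolding gauss_gen_def by measurable

lemma lag_phi_minus: "lag_phi k l (- z) = lag_phi k l z"
  by (simp add: lag_phi_def)

lemma lag_phi_0: "lag_phi k l (0 :: complex^'n) = fan_weight CARD('n) k"
proof -
  have n: "1 \<le> CARD('n)" by (simp add: Suc_leI)
  have "poly (laguerre (real CARD('n) - 1) k) 0 = (\<Sum>i\<le>k. if i = 0 then real ((k + CARD('n) - 1) choose k) else 0)"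
    unfolding laguerre_explicit[OF n] by (intro sum.cong) auto
  also have "\<dots> = fan_weight CARD('n) k"
  proof -
    have "k \<le> k + CARD('n) - 1" using n by linarith
    from binomial_fact[OF this, where ?'a = real] show ?thesis by (simp add: fan_weight_def)
  qed
  finally show ?thesis by (simp add: lag_phi_def)
qed

lemma fan_weight_pos: "fan_weight n k > 0"
  by (simp add: fan_weight_def)

lemma lag_phi_sums:
  assumes r: "\<bar>r\<bar> < 1"
  shows "(\<lambda>k. r ^ k * lag_phi k l z) sums gauss_gen l r (z :: complex^'n)"
proof -
  have n: "1 \<le> CARD('n)" by (simp add: Suc_leI)
  define t where "t = 1 / 2 * \<bar>l\<bar> * (norm z)\<^sup>2"
  have "(\<lambda>k. r ^ k * poly (laguerre (real CARD('n) - 1) k) t * exp (- t / 2)) sums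
      (exp (- (r * t / (1 - r))) / (1 - r) ^ CARD('n) * exp (- t / 2))"
    by (intro sums_mult2 laguerre_generating(1) n r)
  moreover have "exp (- (r * t / (1 - r))) / (1 - r) ^ CARD('n) * exp (- t / 2) = gauss_gen l r z"
  proof -
    have "- (r * t / (1 - r)) + - t / 2 = - (\<bar>l\<bar> / 4 * ((1 + r) / (1 - r)) * (norm z)\<^sup>2)"
      using r by (simp add: t_def field_simps)
    then show ?thesis unfolding gauss_gen_def by (simp add: exp_add[symmetric])
  qed
  moreover have "exp (- t / 2) = exp (- (1/4) * \<bar>l\<bar> * (norm z)\<^sup>2)" by (simp add: t_def)
  ultimately show ?thesis unfolding lag_phi_def t_def by (simp add: mult_ac)
qed

text \<open>One term of the absolutely convergent generating series at r = 1/4 is at most the whole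
  sum, which is bounded by (4/3)^n exp(t/3). The factor exp(-t/2) still wins and leaves exp(-t/6).
  The growth 4^k is crude but harmless for small r.\<close>

lemma lag_phi_bound:
  "\<bar>lag_phi k l z\<bar> \<le> (4/3) ^ CARD('n) * 4 ^ k * exp (- (\<bar>l\<bar> / 12 * (norm z)\<^sup>2))"
  for z :: "complex^'n"
proof -
  have n: "1 \<le> CARD('n)" by (simp add: Suc_leI)
  define t where "t = 1 / 2 * \<bar>l\<bar> * (norm z)\<^sup>2"
  have t: "t \<ge> 0" by (simp add: t_def)
  let ?L = "\<lambda>k. poly (laguerre (real CARD('n) - 1) k) t"
  have "(1/4) ^ k * \<bar>?L k\<bar> \<le> (\<Sum>k. \<bar>1/4\<bar> ^ k * \<bar>?L k\<bar>)"
    using sum_le_suminf[OF laguerre_generating(2)[OF n, of "1/4" t], of "{k}"] by simp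
  also have "\<dots> \<le> exp (\<bar>1/4\<bar> * t / (1 - \<bar>1/4\<bar>)) / (1 - \<bar>1/4\<bar>) ^ CARD('n)"
    by (rule laguerre_generating(3)[OF n _ t]) simp
  also have "\<dots> = (4/3) ^ CARD('n) * exp (t / 3)" by (simp add: power_divide)
  finally have "\<bar>?L k\<bar> \<le> (4/3) ^ CARD('n) * 4 ^ k * exp (t / 3)"
    by (simp add: power_divide field_simps)
  then have "\<bar>?L k\<bar> * exp (- t / 2) \<le> (4/3) ^ CARD('n) * 4 ^ k * exp (t / 3) * exp (- t / 2)"
    by (rule mult_right_mono) simp
  also have "\<dots> = (4/3) ^ CARD('n) * 4 ^ k * exp (- (\<bar>l\<bar> / 12 * (norm z)\<^sup>2))"
    by (simp add: t_def mult.assoc exp_add[symmetric])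
  also have "\<bar>?L k\<bar> * exp (- t / 2) = \<bar>lag_phi k l z\<bar>"
    by (simp add: lag_phi_def t_def abs_mult)
  finally show ?thesis .
qed

lemma lag_phi_bound':
  "\<bar>lag_phi k l (z :: complex^'n)\<bar> \<le> (4/3) ^ CARD('n) * 4 ^ k"
  using lag_phi_bound[of k l z] mult_left_mono[of "exp (- (\<bar>l\<bar> / 12 * (norm z)\<^sup>2))" 1 "(4/3) ^ CARD('n) * 4 ^ k"]
  by (auto intro: order_trans)

lemma lag_phi_integrable:
  assumes l: "l \<noteq> 0"
  shows "integrable lborel (\<lambda>z::complex^'n. lag_phi k l z)"
proof (rule Bochner_Integration.integrable_bound)
  show "integrable lborel (\<lambda>z::complex^'n. (4/3) ^ CARD('n) * 4 ^ k * exp (- (\<bar>l\<bar> / 12 * (norm z)\<^sup>2)))"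
    using l by (intro integrable_mult_right gaussian_integrable) auto
qed (use lag_phi_bound[of k l] in \<open>auto intro!: AE_I2\<close>)

text \<open>The condition |r| < 1/4 makes r^k beat the growth 4^k of the Laguerre functions, so the
  integrals of the norms are summable. The substitution \<open>g\<close> allows the series to be
  used both at u and at w - u.\<close>

lemma lag_phi_integral_sums:
  fixes H :: "complex^'n \<Rightarrow> complex"
  assumes H: "integrable lborel H" and r: "\<bar>r\<bar> < 1/4" and g[measurable]: "g \<in> borel \<rightarrow>\<^sub>M borel"
  shows "(\<lambda>k. of_real (r ^ k) * (LINT u|lborel. of_real (lag_phi k l (g u :: complex^'n)) * H u)) sums
    (LINT u|lborel. of_real (gauss_gen l r (g u)) * H u)"
proof -
  have [measurable]: "H \<in> borel_measurable borel" using H by auto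
  define C where "C = (4/3 :: real) ^ CARD('n)"
  define f where "f k u = complex_of_real (r ^ k * lag_phi k l (g u)) * H u" for k u
  have bd: "norm (f k u) \<le> C * (4 * \<bar>r\<bar>) ^ k * norm (H u)" for k u
  proof -
    have "\<bar>r\<bar> ^ k * \<bar>lag_phi k l (g u)\<bar> \<le> \<bar>r\<bar> ^ k * (C * 4 ^ k)"
      unfolding C_def by (intro mult_left_mono lag_phi_bound') auto
    then have "\<bar>r\<bar> ^ k * \<bar>lag_phi k l (g u)\<bar> * norm (H u) \<le> \<bar>r\<bar> ^ k * (C * 4 ^ k) * norm (H u)"
      by (rule mult_right_mono) simp
    moreover have "norm (f k u) = \<bar>r\<bar> ^ k * \<bar>lag_phi k l (g u)\<bar> * norm (H u)"
      unfolding f_def norm_mult norm_of_real by (simp add: abs_mult power_abs)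
    ultimately show ?thesis by (simp add: power_mult_distrib mult_ac)
  qed
  have [measurable]: "f k \<in> borel_measurable borel" for k
    unfolding f_def by measurable
  have i: "integrable lborel (f k)" for k
    by (rule Bochner_Integration.integrable_bound[where f = "\<lambda>u. C * (4 * \<bar>r\<bar>) ^ k * norm (H u)"])
      (use H bd in \<open>auto intro!: AE_I2 simp: C_def\<close>)
  have geo: "summable (\<lambda>k. C * (4 * \<bar>r\<bar>) ^ k * x)" for x
    using r by (intro summable_mult summable_mult2 summable_geometric) auto
  have "(\<lambda>k. integral\<^sup>L lborel (f k)) sums (LINT u|lborel. (\<Sum>k. f k u))"
  proof (rule sums_integral[OF i])
    show "AE u in lborel. summable (\<lambda>k. norm (f k u))"
      by (intro AE_I2 summable_comparison_test'[OF geo]) (use bd in auto)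
    show "summable (\<lambda>k. LINT u|lborel. norm (f k u))"
    proof (rule summable_comparison_test'[OF geo])
      fix k
      have "norm (LINT u|lborel. norm (f k u)) = (LINT u|lborel. norm (f k u))" by simp
      also have "\<dots> \<le> (LINT u|lborel. C * (4 * \<bar>r\<bar>) ^ k * norm (H u))"
        by (intro integral_mono integrable_norm integrable_mult_right i H bd)
      finally show "norm (LINT u|lborel. norm (f k u)) \<le> C * (4 * \<bar>r\<bar>) ^ k * (LINT u|lborel. norm (H u))"
        by simp
    qed
  qed
  moreover have "(\<Sum>k. f k u) = of_real (gauss_gen l r (g u)) * H u" for u
    unfolding f_def using r
    by (intro sums_unique[symmetric] sums_mult2 sums_of_real lag_phi_sums) auto
  moreover have "integral\<^sup>L lborel (f k) = of_real (r ^ k) * (LINT u|lborel. of_real (lag_phi k l (g u)) * H u)" for k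
    unfolding f_def of_real_mult mult.assoc by (rule integral_mult_right_zero)
  ultimately show ?thesis by simp
qed

text \<open>The complex structure as a real linear map. It writes the symplectic form Im(z . conj w)
  as a real inner product, so that the twisted phases become characters in Gaussian
  integrals.\<close>

definition Jmul :: "complex^'n \<Rightarrow> complex^'n" where
  "Jmul w = (\<chi> i. \<i> * w $ i)"

lemma inner_complex_Re: "x \<bullet> y = Re (x * cnj y)" for x y :: complex
  by (simp add: inner_complex_def)

lemma inner_Jmul: "z \<bullet> Jmul w = Im (\<Sum>i\<in>UNIV. z $ i * cnj (w $ i))"
  unfolding inner_vec_def Jmul_def inner_complex_Re Im_sum by (intro sum.cong) auto

lemma Jmul_antisym: "z \<bullet> Jmul w = - (w \<bullet> Jmul z)"
  unfolding inner_vec_def Jmul_def inner_complex_Re sum_negf[symmetric] by (intro sum.cong) auto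

lemma Jmul_self: "w \<bullet> Jmul w = 0"
  using Jmul_antisym[of w w] by simp

lemma norm_Jmul: "norm (Jmul w) = norm w"
  by (simp add: norm_vec_def Jmul_def norm_mult)

lemma linear_Jmul: "linear Jmul"
  by (rule linearI) (auto simp: Jmul_def vec_eq_iff algebra_simps scaleR_conv_of_real)

lemma Jmul_simps: "Jmul (x + y) = Jmul x + Jmul y" "Jmul (x - y) = Jmul x - Jmul y" "Jmul (c *\<^sub>R x) = c *\<^sub>R Jmul x" "Jmul 0 = 0"
  by (simp_all add: linear_add[OF linear_Jmul] linear_diff[OF linear_Jmul] linear_scale[OF linear_Jmul] linear_0[OF linear_Jmul])

lemma Jmul_measurable [measurable]: "Jmul \<in> borel_measurable borel"
  using linear_continuous_on[OF linear_Jmul[unfolded linear_conv_bounded_linear]]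
  by (intro borel_measurable_continuous_onI) auto

text \<open>With r = exp(-2x) the quotient (1+r)/(1-r) is coth x, and the identity behind the
  exponents is the addition formula coth(x+y) = (coth x coth y + 1)/(coth x + coth y). The result
  depends on r and s only through their product; this is what makes Laguerre functions of different
  index annihilate each other.\<close>

lemma gauss_gen_twisted:
  fixes w :: "complex^'n"
  assumes l: "l \<noteq> 0" and r: "\<bar>r\<bar> < 1" and s: "\<bar>s\<bar> < 1"
  shows "(LINT u|lborel. of_real (gauss_gen l r (w - u)) * (of_real (gauss_gen l s u) *
      exp (\<i> * of_real (u \<bullet> ((l / 2) *\<^sub>R Jmul w)))))
    = of_real ((2 * pi / \<bar>l\<bar>) ^ CARD('n) * gauss_gen l (r * s) w)"
proof -
  define N where "N = CARD('n)"
  define L where "L = \<bar>l\<bar>"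
  define b where "b = L / 4 * ((1 + r) / (1 - r))"
  define d where "d = L / 4 * ((1 + s) / (1 - s))"
  have L: "L > 0" using l by (simp add: L_def)
  have pos: "1 + r > 0" "1 - r > 0" "1 + s > 0" "1 - s > 0" using r s by auto
  have "\<bar>r * s\<bar> < 1" using r s by (metis abs_ge_zero abs_mult mult_strict_mono' mult_1)
  then have rs: "1 - r * s > 0" "\<bar>r * s\<bar> < 1" by auto
  have b: "b > 0" and d: "d > 0" using L pos by (auto simp: b_def d_def)
  have bd: "b + d = L / 2 * (1 - r * s) / ((1 - r) * (1 - s))"
  proof -
    have "(1 + r) / (1 - r) + (1 + s) / (1 - s)
        = ((1 + r) * (1 - s) + (1 + s) * (1 - r)) / ((1 - r) * (1 - s))"
      using pos by (intro add_frac_eq) auto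
    also have "(1 + r) * (1 - s) + (1 + s) * (1 - r) = 2 * (1 - r * s)" by (simp add: algebra_simps)
    finally have "b + d = L / 4 * (2 * (1 - r * s) / ((1 - r) * (1 - s)))"
      unfolding b_def d_def by (simp only: distrib_left[symmetric])
    moreover have "L / 4 * (2 * X / Y) = L / 2 * X / Y" for X Y :: real by simp
    ultimately show ?thesis by (simp only:)
  qed
  have q: "b * d + L\<^sup>2 / 16 = L\<^sup>2 / 8 * (1 + r * s) / ((1 - r) * (1 - s))"
  proof -
    define D where "D = (1 - r) * (1 - s)"
    have D: "D > 0" using pos by (simp add: D_def)
    have "b * d = L\<^sup>2 / 16 * ((1 + r) * (1 + s)) / D"
    proof -
      have "L / 4 * (a / x) * (L / 4 * (c / y)) = L\<^sup>2 / 16 * (a * c) / (x * y)" for a c x y :: real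
        by (simp add: power2_eq_square)
      then show ?thesis unfolding b_def d_def D_def .
    qed
    also have "(1 + r) * (1 + s) = 2 * (1 + r * s) - D" by (simp add: D_def algebra_simps)
    finally show ?thesis unfolding D_def[symmetric] using D by (simp add: field_simps)
  qed
  let ?y = "(l / 2) *\<^sub>R Jmul w"
  have ny: "(norm ?y)\<^sup>2 / 4 = L\<^sup>2 / 16 * (norm w)\<^sup>2"
    by (simp add: norm_Jmul power_mult_distrib power_divide L_def)
  have ex: "- (b * (norm w)\<^sup>2) + (b\<^sup>2 * (norm w)\<^sup>2 - (norm ?y)\<^sup>2 / 4) / (b + d)
      = - (L / 4 * ((1 + r * s) / (1 - r * s)) * (norm w)\<^sup>2)"
  proof -
    have "- (b * (norm w)\<^sup>2) + (b\<^sup>2 * (norm w)\<^sup>2 - (norm ?y)\<^sup>2 / 4) / (b + d)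
      = - ((b * d + L\<^sup>2 / 16) / (b + d)) * (norm w)\<^sup>2"
      unfolding ny using b d by (simp add: field_simps power2_eq_square)
    also have "(b * d + L\<^sup>2 / 16) / (b + d) = L / 4 * ((1 + r * s) / (1 - r * s))"
    proof -
      have "(L\<^sup>2 / 8 * Y / D) / (L / 2 * Z / D) = L / 4 * (Y / Z)" if "D > 0" "Z > 0" for Y Z D :: real
        using that L by (simp add: field_simps power2_eq_square)
      then show ?thesis unfolding q bd by this (use pos rs in auto)
    qed
    finally show ?thesis by simp
  qed
  have "(LINT u|lborel. of_real (gauss_gen l r (w - u)) * (of_real (gauss_gen l s u) * exp (\<i> * of_real (u \<bullet> ?y))))
    = (LINT u|lborel. complex_of_real (1 / ((1 - r) ^ N * (1 - s) ^ N)) *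
        (complex_of_real (exp (- (b * (norm (w - u))\<^sup>2)) * exp (- (d * (norm u)\<^sup>2))) * exp (\<i> * of_real (u \<bullet> ?y))))"
    unfolding gauss_gen_def b_def d_def N_def L_def by (simp add: mult_ac)
  also have "\<dots> = complex_of_real (1 / ((1 - r) ^ N * (1 - s) ^ N)) *
     complex_of_real (sqrt (pi / (b + d)) ^ DIM(complex^'n) * exp (- (L / 4 * ((1 + r * s) / (1 - r * s)) * (norm w)\<^sup>2)))"
    unfolding ex[symmetric]
    by (subst integral_mult_right_zero, subst gaussian_twisted[OF b d]) (auto simp: Jmul_self)
  also have "sqrt (pi / (b + d)) ^ DIM(complex^'n) = (pi / (b + d)) ^ N"
  proof -
    have "DIM(complex^'n) = 2 * N" by (simp add: N_def)
    moreover have "(sqrt (pi / (b + d)))\<^sup>2 = pi / (b + d)" using b d by simp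
    ultimately show ?thesis by (simp only: power_mult)
  qed
  also have "pi / (b + d) = (2 * pi / L) * ((1 - r) * (1 - s)) / (1 - r * s)"
    unfolding bd using L pos rs by (simp add: field_simps)
  also have "complex_of_real (1 / ((1 - r) ^ N * (1 - s) ^ N)) *
      complex_of_real (((2 * pi / L) * ((1 - r) * (1 - s)) / (1 - r * s)) ^ N * exp (- (L / 4 * ((1 + r * s) / (1 - r * s)) * (norm w)\<^sup>2)))
    = complex_of_real ((2 * pi / L) ^ N * (exp (- (L / 4 * ((1 + r * s) / (1 - r * s)) * (norm w)\<^sup>2)) / (1 - r * s) ^ N))"
  proof -
    have "1 / (P ^ N * Q ^ N) * ((x * (P * Q) / R) ^ N * E) = x ^ N * (E / R ^ N)"
      if "P > 0" "Q > 0" for P Q R x E :: real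
      using that by (simp add: power_mult_distrib power_divide)
    then show ?thesis unfolding of_real_mult[symmetric] using pos by metis
  qed
  finally show ?thesis
    unfolding gauss_gen_def N_def[symmetric] L_def[symmetric] .
qed

lemma gauss_gen_integrable:
  assumes l: "l \<noteq> 0" and r: "\<bar>r\<bar> < 1"
  shows "integrable lborel (\<lambda>z::complex^'n. gauss_gen l r z)"
  unfolding gauss_gen_def using l r
  by (intro Bochner_Integration.integrable_divide_zero gaussian_integrable) auto

lemma integrable_mult_bounded:
  fixes f g :: "'a \<Rightarrow> complex"
  assumes "integrable M f" "g \<in> borel_measurable M" "\<And>x. norm (g x) \<le> C"
  shows "integrable M (\<lambda>x. f x * g x)"
proof (rule Bochner_Integration.integrable_bound[where f = "\<lambda>x. C * norm (f x)"])
  have "norm (f x) * norm (g x) \<le> C * norm (f x)" for x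
    using mult_right_mono[OF assms(3)[of x], of "norm (f x)"] by (simp add: mult.commute)
  moreover have "C \<ge> 0" using assms(3) norm_ge_zero order_trans by blast
  ultimately show "AE x in M. norm (f x * g x) \<le> norm (C * norm (f x))"
    by (auto simp: norm_mult)
qed (use assms in auto)

text \<open>Compare the coefficients of \<open>r\<^sup>j s\<^sup>k\<close>, first in \<open>s\<close> and then in \<open>r\<close>, in the twisted
  convolution of the two generating Gaussians.  The range \<open>\<bar>r\<bar>, \<bar>s\<bar> < 1/4\<close> is where the bound
  \<open>\<bar>\<phi>\<^sub>k\<bar> \<le> C 4\<^sup>k\<close> allows exchanging sum and integral.\<close>

lemma lag_phi_twisted:
  fixes w :: "complex^'n"
  assumes l: "l \<noteq> 0"
  shows "(LINT u|lborel. of_real (lag_phi j l (w - u)) * (of_real (lag_phi k l u) *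
      exp (\<i> * of_real (u \<bullet> ((l / 2) *\<^sub>R Jmul w)))))
    = (if j = k then of_real ((2 * pi / \<bar>l\<bar>) ^ CARD('n) * lag_phi k l w) else 0)"
proof -
  define c where "c = (2 * pi / \<bar>l\<bar>) ^ CARD('n)"
  define ph where "ph u = exp (\<i> * complex_of_real (u \<bullet> ((l / 2) *\<^sub>R Jmul w)))" for u
  have [measurable]: "ph \<in> borel_measurable borel"
    unfolding ph_def by measurable
  have nph: "norm (ph u) \<le> 1" for u by (simp add: ph_def)
  define A where "A j k = (LINT u|lborel. of_real (lag_phi j l (w - u)) * (of_real (lag_phi k l u) * ph u))" for j k
  define B where "B r k = (LINT u|lborel. of_real (gauss_gen l r (w - u)) * (of_real (lag_phi k l u) * ph u))" for r k
  have s1: "(\<lambda>j. of_real (r ^ j) * A j k) sums B r k" if "\<bar>r\<bar> < 1/4" for r k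
    unfolding A_def B_def
    using that by (intro lag_phi_integral_sums integrable_mult_bounded[where C = 1] integrable_of_real lag_phi_integrable l nph) auto
  have s2: "(\<lambda>k. of_real (s ^ k) * B r k) sums of_real (c * gauss_gen l (r * s) w)"
    if r: "\<bar>r\<bar> < 1/4" and s: "\<bar>s\<bar> < 1/4" for r s
  proof -
    have g: "integrable lborel (\<lambda>u. gauss_gen l r (w - u))"
      using l r by (intro lborel_integral_reflect gauss_gen_integrable) auto
    have "(\<lambda>k. of_real (s ^ k) * (LINT u|lborel. of_real (lag_phi k l u) * (of_real (gauss_gen l r (w - u)) * ph u))) sums
        (LINT u|lborel. of_real (gauss_gen l s u) * (of_real (gauss_gen l r (w - u)) * ph u))"
      using s by (intro lag_phi_integral_sums integrable_mult_bounded[where C = 1] integrable_of_real g nph) auto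
    moreover have "(LINT u|lborel. of_real (gauss_gen l s u) * (of_real (gauss_gen l r (w - u)) * ph u)) = of_real (c * gauss_gen l (r * s) w)"
      unfolding c_def ph_def using r s
      by (subst gauss_gen_twisted[OF l, symmetric]) (auto simp: mult_ac)
    ultimately show ?thesis by (simp add: B_def mult_ac)
  qed
  have s2': "(\<lambda>k. of_real (s ^ k) * complex_of_real (c * r ^ k * lag_phi k l w)) sums of_real (c * gauss_gen l (r * s) w)"
    if r: "\<bar>r\<bar> < 1/4" and s: "\<bar>s\<bar> < 1/4" for r s
  proof -
    have "\<bar>r * s\<bar> < 1" using r s by (metis abs_ge_zero abs_mult mult_strict_mono' mult_1 order_less_trans[of _ "1/4" 1] divide_less_eq_1_pos zero_less_numeral one_less_numeral_iff semiring_norm(76))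
    then have "(\<lambda>k. complex_of_real (c * ((r * s) ^ k * lag_phi k l w))) sums of_real (c * gauss_gen l (r * s) w)"
      by (intro sums_of_real sums_mult lag_phi_sums)
    then show ?thesis by (simp add: power_mult_distrib mult_ac)
  qed
  have B: "B r k = of_real (c * r ^ k * lag_phi k l w)" if r: "\<bar>r\<bar> < 1/4" for r k
    by (rule powser_real_unique[of "1/4" _ "\<lambda>s. of_real (c * gauss_gen l (r * s) w)"])
      (use s2[OF r] s2'[OF r] in auto)
  have "A j k = (if j = k then of_real (c * lag_phi k l w) else 0)"
  proof (rule powser_real_unique[of "1/4" _ "\<lambda>r. B r k" "\<lambda>j. if j = k then of_real (c * lag_phi k l w) else 0" j])
    fix r :: real assume r: "\<bar>r\<bar> < 1/4"
    have "(\<lambda>j. of_real (r ^ j) * (if j = k then complex_of_real (c * lag_phi k l w) else 0))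
      = (\<lambda>j. if j = k then complex_of_real (r ^ j) * complex_of_real (c * lag_phi k l w) else 0)" by auto
    then show "(\<lambda>j. of_real (r ^ j) * (if j = k then complex_of_real (c * lag_phi k l w) else 0)) sums B r k"
      unfolding B[OF r] using sums_single[of k "\<lambda>j. complex_of_real (r ^ j) * complex_of_real (c * lag_phi k l w)"]
      by (simp add: mult_ac)
  qed (use s1 in auto)
  then show ?thesis unfolding A_def ph_def c_def .
qed

lemma lag_phi_le_weight:
  fixes w :: "complex^'n"
  assumes l: "l \<noteq> 0"
  shows "\<bar>lag_phi k l w\<bar> \<le> fan_weight CARD('n) k"
proof -
  define c where "c = (2 * pi / \<bar>l\<bar>) ^ CARD('n)"
  have c: "c > 0" using l by (simp add: c_def)
  let ?p = "lag_phi k l :: complex^'n \<Rightarrow> real"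
  define B where "B = (4/3 :: real) ^ CARD('n) * 4 ^ k"
  have i2: "integrable lborel (\<lambda>u. (?p u)\<^sup>2)"
  proof (rule Bochner_Integration.integrable_bound[where f = "\<lambda>u. B * ?p u"])
    show "integrable lborel (\<lambda>u. B * ?p u)"
      by (intro integrable_mult_right lag_phi_integrable l)
    show "AE u in lborel. norm ((?p u)\<^sup>2) \<le> norm (B * ?p u)"
    proof (rule AE_I2)
      fix u
      show "norm ((?p u)\<^sup>2) \<le> norm (B * ?p u)"
        using mult_right_mono[OF lag_phi_bound'[of k l u], of "\<bar>?p u\<bar>"]
        by (simp add: B_def abs_mult power2_eq_square)
    qed
  qed measurable
  have i2': "integrable lborel (\<lambda>u. (?p (w - u))\<^sup>2)"
    by (rule lborel_integral_reflect(2)[OF i2])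
  \<comment> \<open>This is the twisted relation at w = 0, where the phase disappears and evenness
    turns the integrand into a square.\<close>
  have norm2: "(LINT u|lborel. (?p u)\<^sup>2) = c * fan_weight CARD('n) k"
  proof -
    have "complex_of_real (LINT u|lborel. (?p u)\<^sup>2) = (LINT u|lborel. of_real ((?p u)\<^sup>2))"
      by (rule integral_complex_of_real[symmetric])
    also have "\<dots> = (LINT u|lborel. of_real (?p (0 - u)) * (of_real (?p u) *
      exp (\<i> * of_real (u \<bullet> ((l / 2) *\<^sub>R Jmul 0)))))"
      by (simp add: Jmul_simps lag_phi_minus power2_eq_square)
    also have "\<dots> = of_real (c * lag_phi k l (0 :: complex^'n))"
      unfolding lag_phi_twisted[OF l] c_def by simp
    finally show ?thesis unfolding lag_phi_0 of_real_eq_iff .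
  qed
  have "c * \<bar>?p w\<bar> = norm (complex_of_real (c * ?p w))"
    unfolding norm_of_real using c by (simp add: abs_mult)
  also have "complex_of_real (c * ?p w) = (LINT u|lborel. of_real (?p (w - u)) * (of_real (?p u) *
      exp (\<i> * of_real (u \<bullet> ((l / 2) *\<^sub>R Jmul w)))))"
    using lag_phi_twisted[OF l, of k w k] unfolding c_def by simp
  also have "norm \<dots> \<le> (LINT u|lborel. ((?p (w - u))\<^sup>2 + (?p u)\<^sup>2) / 2)"
  proof (rule Bochner_Integration.integral_norm_bound_integral)
    \<comment> \<open>This elementary inequality loses nothing against Cauchy-Schwarz here, since
      the two squares have equal integrals by reflection.\<close>
    have am: "\<bar>a\<bar> * \<bar>b\<bar> \<le> (a\<^sup>2 + b\<^sup>2) / 2" for a b :: real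
      using sum_squares_bound[of "\<bar>a\<bar>" "\<bar>b\<bar>"] by simp
    show nb: "norm (of_real (?p (w - u)) * (of_real (?p u) *
      exp (\<i> * of_real (u \<bullet> ((l / 2) *\<^sub>R Jmul w))))) \<le> ((?p (w - u))\<^sup>2 + (?p u)\<^sup>2) / 2" for u
      using am by (simp add: norm_mult)
    show ig: "integrable lborel (\<lambda>u. ((?p (w - u))\<^sup>2 + (?p u)\<^sup>2) / 2)"
      using i2 i2' by (intro Bochner_Integration.integrable_divide_zero Bochner_Integration.integrable_add) auto
    show "integrable lborel (\<lambda>u. of_real (?p (w - u)) * (of_real (?p u) *
      exp (\<i> * complex_of_real (u \<bullet> ((l / 2) *\<^sub>R Jmul w)))))"
    proof (rule Bochner_Integration.integrable_bound[OF ig])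
      show "(\<lambda>u. of_real (?p (w - u)) * (of_real (?p u) *
        exp (\<i> * complex_of_real (u \<bullet> ((l / 2) *\<^sub>R Jmul w))))) \<in> borel_measurable lborel"
        by measurable
    qed (intro AE_I2 order_trans[OF nb], simp)
  qed
  also have "\<dots> = c * fan_weight CARD('n) k"
    using i2 i2' lborel_integral_reflect(1)[OF i2, of w] norm2 by simp
  finally show ?thesis using c by simp
qed

subsection \<open>The twisted projections\<close>

text \<open>A bound on the integrals of |K| over its first argument, an integrable F and a bounded G
  together make the double integral absolutely convergent. This serves for composing kernels, for
  moving a kernel to the other factor of a pairing, and for the regularised Plancherel
  identity.\<close>

lemma kernel_Fubini:
  fixes K :: "'a::euclidean_space \<Rightarrow> 'b::euclidean_space \<Rightarrow> complex"
  assumes K [measurable]: "case_prod K \<in> borel_measurable (borel \<Otimes>\<^sub>M borel)"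
    and F: "integrable lborel F" and G [measurable]: "G \<in> borel_measurable borel"
    and KB: "\<And>z. (\<integral>\<^sup>+ w. ennreal (norm (K w z)) \<partial>lborel) \<le> ennreal B"
    and GM: "\<And>w. norm (G w) \<le> M"
  shows "(LINT w|lborel. (LINT z|lborel. K w z * F z) * G w) = (LINT z|lborel. F z * (LINT w|lborel. K w z * G w))"
    and "integrable lborel (\<lambda>w. (LINT z|lborel. K w z * F z) * G w)"
    and "integrable lborel (\<lambda>z. F z * (LINT w|lborel. K w z * G w))"
proof -
  have [measurable]: "F \<in> borel_measurable borel" using F by auto
  have M: "M \<ge> 0" using GM[of 0] norm_ge_zero order_trans by blast
  have [measurable]: "(\<lambda>(w, z). K w z * F z * G w) \<in> borel_measurable (lborel \<Otimes>\<^sub>M lborel)"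
    by measurable
  have i: "integrable (lborel \<Otimes>\<^sub>M lborel) (\<lambda>(w, z). K w z * F z * G w)"
    unfolding integrable_iff_bounded
  proof
    have "(\<integral>\<^sup>+ p. ennreal (norm (case p of (w, z) \<Rightarrow> K w z * F z * G w)) \<partial>(lborel \<Otimes>\<^sub>M lborel))
      = (\<integral>\<^sup>+ z. \<integral>\<^sup>+ w. ennreal (norm (K w z * F z * G w)) \<partial>lborel \<partial>lborel)"
      by (subst lborel_pair.nn_integral_snd[symmetric]) (auto simp: case_prod_unfold)
    also have "\<dots> \<le> (\<integral>\<^sup>+ z. \<integral>\<^sup>+ w. ennreal (norm (K w z)) * ennreal (M * norm (F z)) \<partial>lborel \<partial>lborel)"
    proof (intro nn_integral_mono)
      fix z w
      have "norm (F z) * norm (G w) \<le> norm (F z) * M" by (intro mult_left_mono GM) simp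
      from mult_left_mono[OF this, of "norm (K w z)"]
      show "ennreal (norm (K w z * F z * G w)) \<le> ennreal (norm (K w z)) * ennreal (M * norm (F z))"
        using M by (simp add: norm_mult ennreal_mult[symmetric] mult_ac)
    qed
    also have "\<dots> = (\<integral>\<^sup>+ z. (\<integral>\<^sup>+ w. ennreal (norm (K w z)) \<partial>lborel) * ennreal (M * norm (F z)) \<partial>lborel)"
      by (intro nn_integral_cong nn_integral_multc) measurable
    also have "\<dots> \<le> (\<integral>\<^sup>+ z. ennreal B * ennreal (M * norm (F z)) \<partial>lborel)"
      by (intro nn_integral_mono mult_right_mono KB) simp
    also have "\<dots> = ennreal B * (\<integral>\<^sup>+ z. ennreal (M * norm (F z)) \<partial>lborel)"
      by (rule nn_integral_cmult) measurable
    also have "(\<integral>\<^sup>+ z. ennreal (M * norm (F z)) \<partial>lborel) = ennreal (LINT z|lborel. M * norm (F z))"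
      using F M by (intro nn_integral_eq_integral integrable_mult_right integrable_norm) auto
    also have "ennreal B * ennreal (LINT z|lborel. M * norm (F z)) < \<infinity>"
      by (simp add: ennreal_mult_less_top)
    finally show "(\<integral>\<^sup>+ p. ennreal (norm (case p of (w, z) \<Rightarrow> K w z * F z * G w)) \<partial>(lborel \<Otimes>\<^sub>M lborel)) < \<infinity>" .
  qed measurable
  have e1: "(LINT z|lborel. K w z * F z) * G w = (LINT z|lborel. K w z * F z * G w)" for w
    by simp
  have e2: "F z * (LINT w|lborel. K w z * G w) = (LINT w|lborel. K w z * F z * G w)" for z
    unfolding integral_mult_right_zero[symmetric] by (simp add: mult_ac)
  show "(LINT w|lborel. (LINT z|lborel. K w z * F z) * G w) = (LINT z|lborel. F z * (LINT w|lborel. K w z * G w))"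
    unfolding e1 e2 by (rule lborel_pair.Fubini_integral[OF i, symmetric])
  show "integrable lborel (\<lambda>w. (LINT z|lborel. K w z * F z) * G w)"
    unfolding e1 using lborel_pair.integrable_fst[OF i] .
  show "integrable lborel (\<lambda>z. F z * (LINT w|lborel. K w z * G w))"
    unfolding e2 using lborel_pair.integrable_snd[OF i] .
qed

text \<open>The kernel of twisted convolution with the k-th Laguerre function. The phase is what the
  group law contributes to exp(i l t) at the point (z,t)^(-1)(w,0), apart from the part depending on
  t.\<close>

definition tkernel :: "nat \<Rightarrow> real \<Rightarrow> complex^'n \<Rightarrow> complex^'n \<Rightarrow> complex" where
  "tkernel k l w z = of_real (lag_phi k l (w - z)) * exp (\<i> * of_real (- (l / 2) * (z \<bullet> Jmul w)))"

lemma tkernel_measurable [measurable]: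
  "case_prod (tkernel k l) \<in> borel_measurable (borel \<Otimes>\<^sub>M (borel :: (complex^'n) measure))"
  unfolding tkernel_def case_prod_unfold by measurable

lemma tkernel_cnj: "cnj (tkernel k l w z) = tkernel k l z w"
  using Jmul_antisym[of z w] lag_phi_minus[of k l "w - z"]
  by (simp add: tkernel_def exp_cnj)

lemma norm_tkernel: "norm (tkernel k l w z) = \<bar>lag_phi k l (w - z)\<bar>"
  by (simp add: tkernel_def norm_mult)

lemma tkernel_nn_integral:
  assumes l: "l \<noteq> 0"
  shows "(\<integral>\<^sup>+ w. ennreal (norm (tkernel k l w (z :: complex^'n))) \<partial>lborel) \<le> ennreal (LINT w|lborel. \<bar>lag_phi k l (w :: complex^'n)\<bar>)"
proof -
  have i: "integrable lborel (\<lambda>w::complex^'n. \<bar>lag_phi k l w\<bar>)"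
    using lag_phi_integrable[OF l, of k] by (rule integrable_abs)
  have "(\<integral>\<^sup>+ w. ennreal (norm (tkernel k l w z)) \<partial>lborel) = ennreal (LINT w|lborel. \<bar>lag_phi k l (w + - z)\<bar>)"
    unfolding norm_tkernel using lborel_integral_shift(2)[OF i, of "- z"]
    by (subst nn_integral_eq_integral) auto
  then show ?thesis using lborel_integral_shift(1)[of "\<lambda>w. \<bar>lag_phi k l w\<bar>" "- z"] by simp
qed

text \<open>After the substitution u = v + z, antisymmetry of the symplectic form splits the total
  phase into one that is constant in v and a twisted phase in v with the sign of l reversed. Since
  the Laguerre functions depend on |l| only, \<open>lag_phi_twisted\<close> at -l applies.\<close>

lemma tkernel_comp:
  fixes w z :: "complex^'n"
  assumes l: "l \<noteq> 0"
  shows "(LINT u|lborel. tkernel k l u z * tkernel j l w u)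
    = (if j = k then of_real ((2 * pi / \<bar>l\<bar>) ^ CARD('n)) * tkernel k l w z else 0)"
proof -
  define E where "E = exp (\<i> * complex_of_real (- (l / 2) * (z \<bullet> Jmul w)))"
  have l': "- l \<noteq> 0" using l by simp
  have p: "lag_phi k l = (lag_phi k (- l) :: complex^'n \<Rightarrow> real)" for k
    by (rule ext) (simp add: lag_phi_def)
  have "(LINT u|lborel. tkernel k l u z * tkernel j l w u) = (LINT v|lborel. tkernel k l (v + z) z * tkernel j l w (v + z))"
    by (rule lborel_integral_shift(1)[symmetric])
  also have "\<dots> = (LINT v|lborel. E * (of_real (lag_phi j (- l) ((w - z) - v)) * (of_real (lag_phi k (- l) v) *
      exp (\<i> * of_real (v \<bullet> ((- l / 2) *\<^sub>R Jmul (w - z)))))))"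
  proof (intro Bochner_Integration.integral_cong refl)
    fix v
    have "z \<bullet> Jmul (v + z) + (v + z) \<bullet> Jmul w = v \<bullet> Jmul (w - z) + z \<bullet> Jmul w"
      using Jmul_antisym[of z v] by (simp add: Jmul_simps Jmul_self inner_simps)
    moreover have "- (l / 2) * a + - (l / 2) * b = - (l / 2) * d + (- l / 2) * c" if "a + b = c + d" for a b c d :: real
    proof -
      have "- (l / 2) * (a + b) = - (l / 2) * (c + d)" using that by simp
      then show ?thesis by (simp add: algebra_simps)
    qed
    ultimately have "- (l / 2) * (z \<bullet> Jmul (v + z)) + - (l / 2) * ((v + z) \<bullet> Jmul w)
       = - (l / 2) * (z \<bullet> Jmul w) + v \<bullet> ((- l / 2) *\<^sub>R Jmul (w - z))"
      unfolding inner_scaleR_right by blast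
    then have ex: "exp (\<i> * complex_of_real (- (l / 2) * (z \<bullet> Jmul (v + z)))) * exp (\<i> * complex_of_real (- (l / 2) * ((v + z) \<bullet> Jmul w)))
        = E * exp (\<i> * of_real (v \<bullet> ((- l / 2) *\<^sub>R Jmul (w - z))))"
      unfolding E_def exp_add[symmetric] distrib_left[symmetric] of_real_add[symmetric] by (rule arg_cong)
    have wv: "w - (v + z) = (w - z) - v" by simp
    have "tkernel k l (v + z) z * tkernel j l w (v + z) =
      of_real (lag_phi j l (w - (v + z))) * (of_real (lag_phi k l v) * (exp (\<i> * complex_of_real (- (l / 2) * (z \<bullet> Jmul (v + z)))) * exp (\<i> * complex_of_real (- (l / 2) * ((v + z) \<bullet> Jmul w)))))"
      unfolding tkernel_def by (simp only: add_diff_cancel_right' mult_ac)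
    then show "tkernel k l (v + z) z * tkernel j l w (v + z) =
      E * (of_real (lag_phi j (- l) ((w - z) - v)) * (of_real (lag_phi k (- l) v) *
      exp (\<i> * of_real (v \<bullet> ((- l / 2) *\<^sub>R Jmul (w - z))))))"
      unfolding ex wv p by (simp only: mult_ac)
  qed
  also have "\<dots> = E * (if j = k then of_real ((2 * pi / \<bar>- l\<bar>) ^ CARD('n) * lag_phi k (- l) (w - z)) else 0)"
    unfolding integral_mult_right_zero lag_phi_twisted[OF l'] ..
  finally show ?thesis
    by (simp add: tkernel_def E_def p[symmetric] mult_ac)
qed

text \<open>Divided by (2 pi/|l|)^n, this acts as an orthogonal projection, by
  \<open>tkernel_cnj\<close> and \<open>tkernel_comp\<close>.\<close>

definition tproj :: "nat \<Rightarrow> real \<Rightarrow> (complex^'n \<Rightarrow> complex) \<Rightarrow> complex^'n \<Rightarrow> complex" where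
  "tproj k l F w = (LINT z|lborel. tkernel k l w z * F z)"

lemma tproj_measurable [measurable]:
  assumes [measurable]: "F \<in> borel_measurable borel"
  shows "tproj k l F \<in> borel_measurable borel"
  unfolding tproj_def[abs_def] by measurable

lemma cnj_measurable [measurable]: "cnj \<in> borel_measurable borel"
  by (intro borel_measurable_continuous_onI continuous_intros)

lemma tproj_integrable:
  assumes "l \<noteq> 0" "integrable lborel F"
  shows "integrable lborel (tproj k l F)"
  using kernel_Fubini(2)[OF tkernel_measurable assms(2) _ tkernel_nn_integral[OF assms(1)], of "\<lambda>_. 1" 1 k]
  by (simp add: tproj_def[abs_def])

lemma tproj_bound:
  fixes F :: "complex^'n \<Rightarrow> complex"
  assumes l: "l \<noteq> 0" and F: "integrable lborel F"
  shows "norm (tproj k l F w) \<le> fan_weight CARD('n) k * (LINT z|lborel. norm (F z))"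
proof -
  have [measurable]: "F \<in> borel_measurable borel" using F by auto
  have b: "norm (tkernel k l w z * F z) \<le> fan_weight CARD('n) k * norm (F z)" for z
    unfolding norm_mult norm_tkernel by (intro mult_right_mono lag_phi_le_weight l) simp
  have "norm (tproj k l F w) \<le> (LINT z|lborel. fan_weight CARD('n) k * norm (F z))"
    unfolding tproj_def
  proof (rule Bochner_Integration.integral_norm_bound_integral)
    show "integrable lborel (\<lambda>z. tkernel k l w z * F z)"
      by (rule Bochner_Integration.integrable_bound[where f = "\<lambda>z. fan_weight CARD('n) k * norm (F z)"])
        (use F in \<open>auto intro!: AE_I2 order_trans[OF b abs_ge_self]\<close>)
    show "integrable lborel (\<lambda>z. fan_weight CARD('n) k * norm (F z))"
      using F by (intro integrable_mult_right integrable_norm)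
  qed (rule b)
  then show ?thesis by simp
qed

lemma tproj_comp:
  fixes F :: "complex^'n \<Rightarrow> complex"
  assumes l: "l \<noteq> 0" and F: "integrable lborel F"
  shows "tproj j l (tproj k l F) w = (if j = k then of_real ((2 * pi / \<bar>l\<bar>) ^ CARD('n)) * tproj k l F w else 0)"
proof -
  have "tproj j l (tproj k l F) w = (LINT u|lborel. (LINT z|lborel. tkernel k l u z * F z) * tkernel j l w u)"
    unfolding tproj_def by (rule Bochner_Integration.integral_cong[OF refl]) (rule mult.commute)
  also have "\<dots> = (LINT z|lborel. F z * (LINT u|lborel. tkernel k l u z * tkernel j l w u))"
    by (rule kernel_Fubini(1)[OF tkernel_measurable F _ tkernel_nn_integral[OF l], where M = "fan_weight CARD('n) j"])
      (auto simp: norm_tkernel lag_phi_le_weight[OF l])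
  also have "\<dots> = (if j = k then of_real ((2 * pi / \<bar>l\<bar>) ^ CARD('n)) * tproj k l F w else 0)"
  proof -
    have "F z * (if j = k then cc * T z else 0) = (if j = k then cc else 0) * (T z * F z)" for cc z and T :: "_ \<Rightarrow> complex"
      by simp
    then show ?thesis
      unfolding tkernel_comp[OF l] tproj_def by (simp only: integral_mult_right_zero) simp
  qed
  finally show ?thesis .
qed

text \<open>Expand \<open>\<parallel>c F - \<Sum>\<^sub>k P\<^sub>k F\<parallel>\<^sup>2 \<ge> 0\<close> with \<open>P\<^sub>j P\<^sub>k = \<delta>\<^sub>j\<^sub>k c P\<^sub>k\<close>.\<close>

lemma tproj_Bessel_finite:
  fixes F :: "complex^'n \<Rightarrow> complex"
  assumes l: "l \<noteq> 0" and F: "integrable lborel F" and F2: "integrable lborel (\<lambda>z. (norm (F z))\<^sup>2)"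
  shows "(\<Sum>k<m. (LINT w|lborel. (norm (tproj k l F w))\<^sup>2))
     \<le> ((2 * pi / \<bar>l\<bar>) ^ CARD('n))\<^sup>2 * (LINT z|lborel. (norm (F z))\<^sup>2)"
proof -
  define c where "c = (2 * pi / \<bar>l\<bar>) ^ CARD('n)"
  have c: "c > 0" using l by (simp add: c_def)
  have [measurable]: "F \<in> borel_measurable borel" using F by auto
  define p where "p k = tproj k l F" for k
  have pm [measurable]: "p k \<in> borel_measurable borel" for k unfolding p_def by measurable
  have pi: "integrable lborel (p k)" for k
    unfolding p_def by (rule tproj_integrable[OF l F])
  have pb: "norm (cnj (p k w)) \<le> fan_weight CARD('n) k * (LINT z|lborel. norm (F z))" for k w
    unfolding p_def complex_mod_cnj by (rule tproj_bound[OF l F])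
  have iFp: "integrable lborel (\<lambda>z. F z * cnj (p k z))" for k
    by (rule integrable_mult_bounded[OF F _ pb]) measurable
  have ipp: "integrable lborel (\<lambda>z. p j z * cnj (p k z))" for j k
    by (rule integrable_mult_bounded[OF pi _ pb]) measurable
  have iFF: "integrable lborel (\<lambda>z. F z * cnj (F z))"
    using integrable_of_real[OF F2, where 'a = complex] unfolding complex_norm_square .
  define x where "x k = (LINT z|lborel. F z * cnj (p k z))" for k
  \<comment> \<open>Hermitian symmetry of the kernel moves \<open>tproj j\<close> to the second
    factor, where it meets \<open>p k\<close> and the composition rule applies.\<close>
  have pp: "(LINT w|lborel. p j w * cnj (p k w)) = (if j = k then c * x k else 0)" for j k
  proof -
    have "(LINT w|lborel. p j w * cnj (p k w)) = (LINT z|lborel. F z * (LINT w|lborel. tkernel j l w z * cnj (p k w)))"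
      unfolding p_def tproj_def[of j]
      by (rule kernel_Fubini(1)[OF tkernel_measurable F _ tkernel_nn_integral[OF l] pb[unfolded p_def]]) measurable
    also have "\<dots> = (LINT z|lborel. F z * cnj (tproj j l (p k) z))"
    proof -
      have "(LINT w|lborel. tkernel j l w z * cnj (p k w)) = cnj (tproj j l (p k) z)" for z
      proof -
        have "(LINT w|lborel. tkernel j l w z * cnj (p k w)) = (LINT w|lborel. cnj (tkernel j l z w * p k w))"
          by (simp only: complex_cnj_mult tkernel_cnj)
        then show ?thesis unfolding tproj_def by (simp only: Bochner_Integration.integral_cnj)
      qed
      then show ?thesis by simp
    qed
    also have "\<dots> = (if j = k then c * x k else 0)"
      unfolding p_def tproj_comp[OF l F] x_def c_def[symmetric]
      by (auto simp: mult.left_commute[of "F _" "complex_of_real c"])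
    finally show ?thesis .
  qed
  have x: "complex_of_real (LINT w|lborel. (norm (p k w))\<^sup>2) = c * x k" for k
  proof -
    have "complex_of_real (LINT w|lborel. (norm (p k w))\<^sup>2) = (LINT w|lborel. p k w * cnj (p k w))"
      by (simp only: integral_complex_of_real[symmetric] complex_norm_square)
    then show ?thesis by (simp only: pp if_True simp_thms)
  qed
  define y where "y k = (LINT w|lborel. (norm (p k w))\<^sup>2)" for k
  \<comment> \<open>The pairing of F with its k-th component is thus a nonnegative real number, the
    squared norm of that component divided by c.\<close>
  have xy: "x k = of_real (y k / c)" for k using x[of k] c by (simp add: y_def field_simps)
  define S where "S z = (\<Sum>k<m. p k z)" for z
  have iFS: "integrable lborel (\<lambda>z. F z * cnj (S z))"
    unfolding S_def cnj_sum sum_distrib_left by (intro Bochner_Integration.integrable_sum iFp)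
  have iSF: "integrable lborel (\<lambda>z. cnj (F z * cnj (S z)))"
    using iFS by (rule integrable_cnj)
  have SS: "S z * cnj (S z) = (\<Sum>j<m. \<Sum>k<m. p j z * cnj (p k z))" for z
    unfolding S_def cnj_sum sum_product ..
  have iSS: "integrable lborel (\<lambda>z. S z * cnj (S z))"
    unfolding SS by (intro Bochner_Integration.integrable_sum ipp)
  have vFS: "(LINT z|lborel. F z * cnj (S z)) = of_real ((\<Sum>k<m. y k) / c)"
    unfolding S_def cnj_sum sum_distrib_left
  proof -
    have "(LINT z|lborel. (\<Sum>k<m. F z * cnj (p k z))) = (\<Sum>k<m. x k)"
      unfolding x_def by (intro Bochner_Integration.integral_sum iFp)
    then show "(LINT z|lborel. (\<Sum>k<m. F z * cnj (p k z))) = of_real ((\<Sum>k<m. y k) / c)"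
      unfolding xy by (simp add: sum_divide_distrib)
  qed
  have vSS: "(LINT z|lborel. S z * cnj (S z)) = of_real (\<Sum>k<m. y k)"
  proof -
    have "(LINT z|lborel. S z * cnj (S z)) = (\<Sum>j<m. (LINT z|lborel. (\<Sum>k<m. p j z * cnj (p k z))))"
      unfolding SS by (intro Bochner_Integration.integral_sum Bochner_Integration.integrable_sum ipp)
    also have "\<dots> = (\<Sum>j<m. \<Sum>k<m. (LINT z|lborel. p j z * cnj (p k z)))"
      by (intro sum.cong refl Bochner_Integration.integral_sum ipp)
    also have "\<dots> = (\<Sum>j<m. c * x j)"
      unfolding pp by (intro sum.cong refl) (simp add: sum.delta)
    also have "\<dots> = of_real (\<Sum>k<m. y k)"
      unfolding xy using c by simp
    finally show ?thesis .
  qed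
  have vFF: "(LINT z|lborel. F z * cnj (F z)) = of_real (LINT z|lborel. (norm (F z))\<^sup>2)"
    unfolding integral_complex_of_real[symmetric] complex_norm_square ..
  have "complex_of_real (LINT z|lborel. (norm (c * F z - S z))\<^sup>2) = (LINT z|lborel. (c * F z - S z) * cnj (c * F z - S z))"
    unfolding integral_complex_of_real[symmetric] complex_norm_square ..
  also have "\<dots> = (LINT z|lborel. (c\<^sup>2 * (F z * cnj (F z)) - c * (F z * cnj (S z)) - c * cnj (F z * cnj (S z))) + S z * cnj (S z))"
    by (intro Bochner_Integration.integral_cong refl) (simp add: algebra_simps power2_eq_square)
  also have "\<dots> = (c\<^sup>2 * (LINT z|lborel. F z * cnj (F z)) - c * (LINT z|lborel. F z * cnj (S z)) - c * (LINT z|lborel. cnj (F z * cnj (S z)))) + (LINT z|lborel. S z * cnj (S z))"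
  proof -
    have "(LINT z|lborel. (\<alpha> * a z - \<beta> * b z - \<beta> * d z) + e z)
        = (\<alpha> * (LINT z|lborel. a z) - \<beta> * (LINT z|lborel. b z) - \<beta> * (LINT z|lborel. d z)) + (LINT z|lborel. e z)"
      if "integrable lborel a" "integrable lborel b" "integrable lborel d" "integrable lborel e"
      for \<alpha> \<beta> and a b d e :: "complex^'n \<Rightarrow> complex"
      using that by simp
    from this[OF iFF iFS iSF iSS] show ?thesis .
  qed
  also have "\<dots> = complex_of_real (c\<^sup>2 * (LINT z|lborel. (norm (F z))\<^sup>2) - (\<Sum>k<m. y k))"
    unfolding Bochner_Integration.integral_cnj vFS vSS vFF using c by simp
  finally have "(LINT z|lborel. (norm (c * F z - S z))\<^sup>2) = c\<^sup>2 * (LINT z|lborel. (norm (F z))\<^sup>2) - (\<Sum>k<m. y k)"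
    unfolding of_real_eq_iff .
  moreover have "(LINT z|lborel. (norm (c * F z - S z))\<^sup>2) \<ge> 0" by simp
  ultimately show ?thesis by (simp add: y_def c_def p_def)
qed

lemma tproj_Bessel:
  fixes F :: "complex^'n \<Rightarrow> complex"
  assumes l: "l \<noteq> 0" and F: "integrable lborel F"
  shows "(\<Sum>k. \<integral>\<^sup>+ w. ennreal ((norm (tproj k l F w))\<^sup>2) \<partial>lborel)
     \<le> ennreal (((2 * pi / \<bar>l\<bar>) ^ CARD('n))\<^sup>2) * (\<integral>\<^sup>+ z. ennreal ((norm (F z))\<^sup>2) \<partial>lborel)"
proof (cases "(\<integral>\<^sup>+ z. ennreal ((norm (F z))\<^sup>2) \<partial>lborel) = \<infinity>")
  case True
  \<comment> \<open>Positivity matters here: in \<open>ennreal\<close> the product of 0 and infinity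
    is 0, so a vanishing factor would not make the right-hand side infinite.\<close>
  have "((2 * pi / \<bar>l\<bar>) ^ CARD('n))\<^sup>2 > 0" using l by simp
  then have "ennreal (((2 * pi / \<bar>l\<bar>) ^ CARD('n))\<^sup>2) \<noteq> 0" by (simp only: ennreal_eq_0_iff not_le)
  then have "ennreal (((2 * pi / \<bar>l\<bar>) ^ CARD('n))\<^sup>2) * \<infinity> = \<infinity>"
    by (simp only: ennreal_mult_top infinity_ennreal_def if_False)
  then show ?thesis unfolding True by (simp only: infinity_ennreal_def top_greatest)
next
  case False
  have [measurable]: "F \<in> borel_measurable borel" using F by auto
  have F2: "integrable lborel (\<lambda>z. (norm (F z))\<^sup>2)"
    unfolding integrable_iff_bounded using False by (simp add: less_top)
  have p2: "integrable lborel (\<lambda>w. (norm (tproj k l F w))\<^sup>2)" for k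
  proof -
    have "integrable lborel (\<lambda>z. tproj k l F z * cnj (tproj k l F z))"
      by (rule integrable_mult_bounded[OF tproj_integrable[OF l F], where C = "fan_weight CARD('n) k * (LINT z|lborel. norm (F z))"])
        (auto intro: tproj_bound[OF l F])
    from integrable_norm[OF this] show ?thesis by (simp only: norm_mult complex_mod_cnj power2_eq_square)
  qed
  have "(\<Sum>k<m. \<integral>\<^sup>+ w. ennreal ((norm (tproj k l F w))\<^sup>2) \<partial>lborel)
    \<le> ennreal (((2 * pi / \<bar>l\<bar>) ^ CARD('n))\<^sup>2) * (\<integral>\<^sup>+ z. ennreal ((norm (F z))\<^sup>2) \<partial>lborel)" for m
  proof -
    have "(\<Sum>k<m. \<integral>\<^sup>+ w. ennreal ((norm (tproj k l F w))\<^sup>2) \<partial>lborel)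
       = ennreal (\<Sum>k<m. (LINT w|lborel. (norm (tproj k l F w))\<^sup>2))"
    proof -
      have "(\<Sum>k<m. \<integral>\<^sup>+ w. ennreal ((norm (tproj k l F w))\<^sup>2) \<partial>lborel)
        = (\<Sum>k<m. ennreal (LINT w|lborel. (norm (tproj k l F w))\<^sup>2))"
        by (intro sum.cong refl nn_integral_eq_integral p2 AE_I2) simp
      also have "\<dots> = ennreal (\<Sum>k<m. (LINT w|lborel. (norm (tproj k l F w))\<^sup>2))"
        by (rule sum_ennreal) simp
      finally show ?thesis .
    qed
    also have "\<dots> \<le> ennreal (((2 * pi / \<bar>l\<bar>) ^ CARD('n))\<^sup>2 * (LINT z|lborel. (norm (F z))\<^sup>2))"
      by (intro ennreal_leI tproj_Bessel_finite l F F2)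
    also have "\<dots> = ennreal (((2 * pi / \<bar>l\<bar>) ^ CARD('n))\<^sup>2) * (\<integral>\<^sup>+ z. ennreal ((norm (F z))\<^sup>2) \<partial>lborel)"
    proof -
      have "(\<integral>\<^sup>+ z. ennreal ((norm (F z))\<^sup>2) \<partial>lborel) = ennreal (LINT z|lborel. (norm (F z))\<^sup>2)"
        by (intro nn_integral_eq_integral F2 AE_I2) simp
      then show ?thesis by (simp only: ennreal_mult' zero_le_power2)
    qed
    finally show ?thesis .
  qed
  then show ?thesis by (intro suminf_le_const) auto
qed

subsection \<open>Plancherel inequality on the line\<close>

text \<open>For a function that is not integrable the left-hand side is 0 by default, so no
  integrability has to be checked when this is used.\<close>

lemma norm_integral_le_nn_integral:
  fixes f :: "'a \<Rightarrow> 'b::{banach, second_countable_topology}"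
  shows "ennreal (norm (LINT x|M. f x)) \<le> (\<integral>\<^sup>+ x. ennreal (norm (f x)) \<partial>M)"
  by (cases "integrable M f") (auto intro: integral_norm_bound_ennreal simp: not_integrable_integral_eq)

lemma gaussian_nn_integral:
  assumes A: "A > 0"
  shows "(\<integral>\<^sup>+ s. ennreal (exp (- (A * (t - s)\<^sup>2))) \<partial>lborel) = ennreal (sqrt (pi / A))"
    and "(\<integral>\<^sup>+ s. ennreal (exp (- (A * (s - t)\<^sup>2))) \<partial>lborel) = ennreal (sqrt (pi / A))"
proof -
  have i: "integrable lborel (\<lambda>x::real. exp (- (A * x\<^sup>2)))" by (rule gaussian_char_real(1)[OF A])
  have "complex_of_real (LINT x|lborel. exp (- (A * x\<^sup>2))) = complex_of_real (sqrt (pi / A))"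
    using gaussian_char_real(3)[OF A, of 0] unfolding integral_complex_of_real[symmetric] by simp
  then have v: "(LINT x|lborel. exp (- (A * x\<^sup>2))) = sqrt (pi / A)" unfolding of_real_eq_iff .
  have e: "(t - s)\<^sup>2 = (s - t)\<^sup>2" for s by (simp add: power2_commute)
  show *: "(\<integral>\<^sup>+ s. ennreal (exp (- (A * (t - s)\<^sup>2))) \<partial>lborel) = ennreal (sqrt (pi / A))"
    using lborel_integral_reflect[OF i, of t] v by (subst nn_integral_eq_integral) auto
  then show "(\<integral>\<^sup>+ s. ennreal (exp (- (A * (s - t)\<^sup>2))) \<partial>lborel) = ennreal (sqrt (pi / A))"
    unfolding e .
qed

definition fourier1 :: "(real \<Rightarrow> complex) \<Rightarrow> real \<Rightarrow> complex" where
  "fourier1 g l = (LINT t|lborel. exp (\<i> * of_real (- (l * t))) * g t)"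

lemma fourier1_measurable [measurable]:
  assumes [measurable]: "g \<in> borel_measurable borel"
  shows "fourier1 g \<in> borel_measurable borel"
  unfolding fourier1_def[abs_def] by measurable

lemma norm_fourier1_le: "integrable lborel g \<Longrightarrow> norm (fourier1 g l) \<le> (LINT t|lborel. norm (g t))"
  using integral_norm_bound[of lborel "\<lambda>t. exp (\<i> * of_real (- (l * t))) * g t"]
  by (simp add: fourier1_def norm_mult)

text \<open>The Gaussian factor makes Fubini's theorem applicable and turns the left-hand side into
  the pairing of g with its convolution with \<open>E\<close>, a positive kernel of total mass 2 pi.
  Bounding |g(t)||g(s)| by half the sum of the squares then gives the estimate, for either variable
  with the same mass.\<close>

lemma fourier1_gaussian_le:
  assumes g: "integrable lborel g" and e: "e > 0"
  shows "(\<integral>\<^sup>+ l. ennreal (exp (- (e * l\<^sup>2)) * (norm (fourier1 g l))\<^sup>2) \<partial>lborel)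
     \<le> ennreal (2 * pi) * (\<integral>\<^sup>+ t. ennreal ((norm (g t))\<^sup>2) \<partial>lborel)"
proof -
  have [measurable]: "g \<in> borel_measurable borel" using g by auto
  define K where "K l t = complex_of_real (exp (- (e * l\<^sup>2))) * exp (\<i> * of_real (- (l * t)))" for l t :: real
  define E where "E u = sqrt (pi / e) * exp (- (1 / (4 * e) * u\<^sup>2))" for u :: real
  have Epos: "E u > 0" for u using e by (simp add: E_def)
  have [measurable]: "E \<in> borel_measurable borel" unfolding E_def[abs_def] by measurable
  have Km [measurable]: "case_prod K \<in> borel_measurable (borel \<Otimes>\<^sub>M borel)"
    unfolding K_def case_prod_unfold by measurable
  have KB: "(\<integral>\<^sup>+ l. ennreal (norm (K l t)) \<partial>lborel) \<le> ennreal (sqrt (pi / e))" for t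
    using gaussian_nn_integral(2)[OF e, of 0] by (simp add: K_def norm_mult)
  have KF: "(LINT t|lborel. K l t * g t) = of_real (exp (- (e * l\<^sup>2))) * fourier1 g l" for l
    unfolding K_def fourier1_def mult.assoc by simp
  have sqE: "sqrt (pi / e) * sqrt (pi / (1 / (4 * e))) = 2 * pi"
  proof -
    have "sqrt (pi / e) * sqrt (pi / (1 / (4 * e))) = sqrt ((2 * pi)\<^sup>2)"
      unfolding real_sqrt_mult[symmetric] using e by (simp add: field_simps power2_eq_square)
    also have "\<dots> = 2 * pi" by (intro real_sqrt_unique) auto
    finally show ?thesis .
  qed
  have E1: "(\<integral>\<^sup>+ s. ennreal (E (t - s)) \<partial>lborel) = ennreal (2 * pi)"
    and E2: "(\<integral>\<^sup>+ s. ennreal (E (s - t)) \<partial>lborel) = ennreal (2 * pi)" for t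
  proof -
    have Ee: "ennreal (E u) = ennreal (sqrt (pi / e)) * ennreal (exp (- (1 / (4 * e) * u\<^sup>2)))" for u
      unfolding E_def using e by (intro ennreal_mult) auto
    have c: "ennreal (sqrt (pi / e)) * ennreal (sqrt (pi / (1 / (4 * e)))) = ennreal (2 * pi)"
      unfolding sqE[symmetric] using e by (intro ennreal_mult[symmetric]) auto
    have e': "1 / (4 * e) > 0" using e by simp
    show "(\<integral>\<^sup>+ s. ennreal (E (t - s)) \<partial>lborel) = ennreal (2 * pi)"
      unfolding Ee c[symmetric] gaussian_nn_integral(1)[OF e', of t, symmetric]
      by (rule nn_integral_cmult) measurable
    show "(\<integral>\<^sup>+ s. ennreal (E (s - t)) \<partial>lborel) = ennreal (2 * pi)"
      unfolding Ee c[symmetric] gaussian_nn_integral(2)[OF e', of t, symmetric]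
      by (rule nn_integral_cmult) measurable
  qed
  let ?G = "\<integral>\<^sup>+ s. ennreal ((norm (g s))\<^sup>2 / 2) \<partial>lborel"
  let ?gf = "\<lambda>l. complex_of_real (exp (- (e * l\<^sup>2))) * fourier1 g l"
  let ?q = "\<lambda>l. exp (- (e * l\<^sup>2)) * (norm (fourier1 g l))\<^sup>2"
  let ?cv = "\<lambda>t. LINT s|lborel. g s * of_real (E (t - s))"
  let ?A = "\<integral>\<^sup>+ t. (\<integral>\<^sup>+ s. ennreal ((norm (g t))\<^sup>2 / 2) * ennreal (E (t - s)) \<partial>lborel) \<partial>lborel"
  let ?B = "\<integral>\<^sup>+ t. (\<integral>\<^sup>+ s. ennreal ((norm (g s))\<^sup>2 / 2) * ennreal (E (t - s)) \<partial>lborel) \<partial>lborel"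
  have inner: "(LINT l|lborel. K l t * cnj (fourier1 g l)) = cnj (?cv t)" for t
  proof -
    have "(LINT l|lborel. (LINT s|lborel. K l s * g s) * exp (\<i> * of_real (l * t)))
       = (LINT s|lborel. g s * (LINT l|lborel. K l s * exp (\<i> * of_real (l * t))))"
      by (rule kernel_Fubini(1)[OF Km g _ KB, where M = 1]) auto
    moreover have "(LINT l|lborel. K l s * exp (\<i> * of_real (l * t))) = of_real (E (t - s))" for s
    proof -
      have "K l s * exp (\<i> * of_real (l * t)) = of_real (exp (- (e * l\<^sup>2))) * exp (\<i> * complex_of_real (l * (t - s)))" for l
        unfolding K_def mult.assoc exp_add[symmetric] by (simp add: algebra_simps)
      then show ?thesis using gaussian_char_real(3)[OF e, of "t - s"] by (simp add: E_def mult.commute)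
    qed
    ultimately have "(?cv t) = (LINT l|lborel. (?gf l) * exp (\<i> * of_real (l * t)))"
      unfolding KF by simp
    then have "cnj (?cv t) = (LINT l|lborel. cnj ((?gf l) * exp (\<i> * of_real (l * t))))"
      by (simp only: Bochner_Integration.integral_cnj)
    also have "\<dots> = (LINT l|lborel. K l t * cnj (fourier1 g l))"
      unfolding K_def by (intro Bochner_Integration.integral_cong refl) (simp add: exp_cnj mult_ac)
    finally show ?thesis by simp
  qed
  have main: "(LINT l|lborel. (?gf l) * cnj (fourier1 g l))
     = (LINT t|lborel. g t * cnj (?cv t))"
    unfolding KF[symmetric] inner[symmetric]
    by (rule kernel_Fubini(1)[OF Km g _ KB]) (use norm_fourier1_le[OF g] in \<open>auto simp: complex_mod_cnj\<close>)
  have imain: "integrable lborel (\<lambda>l. (?gf l) * cnj (fourier1 g l))"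
    unfolding KF[symmetric]
    by (rule kernel_Fubini(2)[OF Km g _ KB]) (use norm_fourier1_le[OF g] in \<open>auto simp: complex_mod_cnj\<close>)
  have nrm: "(?gf l) * cnj (fourier1 g l) = of_real (?q l)" for l
    by (simp only: of_real_mult complex_norm_square mult.assoc)
  have i1: "integrable lborel (\<lambda>l. ?q l)"
    using integrable_norm[OF imain] unfolding nrm norm_of_real by (simp add: abs_mult)
  have "(\<integral>\<^sup>+ l. ennreal (?q l) \<partial>lborel)
    = ennreal (LINT l|lborel. ?q l)"
    by (intro nn_integral_eq_integral i1 AE_I2) simp
  also have "(LINT l|lborel. ?q l)
     = norm (LINT l|lborel. complex_of_real (?q l))"
    unfolding integral_complex_of_real norm_of_real by simp
  also have "\<dots> = norm (LINT t|lborel. g t * cnj (?cv t))"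
    unfolding nrm[symmetric] main ..
  also have "ennreal \<dots> \<le> (\<integral>\<^sup>+ t. ennreal (norm (g t * cnj (?cv t))) \<partial>lborel)"
    by (rule norm_integral_le_nn_integral)
  also have "\<dots> = (\<integral>\<^sup>+ t. ennreal (norm (g t)) * ennreal (norm (?cv t)) \<partial>lborel)"
    by (simp only: norm_mult complex_mod_cnj ennreal_mult norm_ge_zero)
  also have "\<dots> \<le> (\<integral>\<^sup>+ t. ennreal (norm (g t)) * (\<integral>\<^sup>+ s. ennreal (norm (g s * of_real (E (t - s)))) \<partial>lborel) \<partial>lborel)"
    by (intro nn_integral_mono mult_left_mono norm_integral_le_nn_integral) simp
  also have "\<dots> = (\<integral>\<^sup>+ t. (\<integral>\<^sup>+ s. ennreal (norm (g t)) * ennreal (norm (g s * of_real (E (t - s)))) \<partial>lborel) \<partial>lborel)"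
    by (intro nn_integral_cong nn_integral_cmult[symmetric]) measurable
  also have "\<dots> \<le> (\<integral>\<^sup>+ t. (\<integral>\<^sup>+ s. ennreal ((norm (g t))\<^sup>2 / 2) * ennreal (E (t - s)) + ennreal ((norm (g s))\<^sup>2 / 2) * ennreal (E (t - s)) \<partial>lborel) \<partial>lborel)"
  proof (intro nn_integral_mono)
    fix t s
    have "norm (g t) * norm (g s) \<le> (norm (g t))\<^sup>2 / 2 + (norm (g s))\<^sup>2 / 2"
      using sum_squares_bound[of "norm (g t)" "norm (g s)"] by simp
    then have "norm (g t) * norm (g s) * E (t - s) \<le> ((norm (g t))\<^sup>2 / 2 + (norm (g s))\<^sup>2 / 2) * E (t - s)"
      by (rule mult_right_mono) (rule less_imp_le[OF Epos])
    then show "ennreal (norm (g t)) * ennreal (norm (g s * of_real (E (t - s))))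
       \<le> ennreal ((norm (g t))\<^sup>2 / 2) * ennreal (E (t - s)) + ennreal ((norm (g s))\<^sup>2 / 2) * ennreal (E (t - s))"
      using Epos[of "t - s"]
      by (simp add: norm_mult ennreal_mult[symmetric] ennreal_plus[symmetric] distrib_right mult.assoc
          del: ennreal_plus)
  qed
  also have "\<dots> = ?A
     + ?B"
    by (simp add: nn_integral_add)
  also have "?B
     = (\<integral>\<^sup>+ s. (\<integral>\<^sup>+ t. ennreal ((norm (g s))\<^sup>2 / 2) * ennreal (E (t - s)) \<partial>lborel) \<partial>lborel)"
    by (rule lborel_pair.Fubini') measurable
  also have "\<dots> = ?G * ennreal (2 * pi)"
    by (simp add: nn_integral_cmult E2 nn_integral_multc)
  also have "?A
     = ?G * ennreal (2 * pi)"
    by (simp add: nn_integral_cmult E1 nn_integral_multc)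
  also have "?G * ennreal (2 * pi) + ?G * ennreal (2 * pi)
     = (?G + ?G) * ennreal (2 * pi)"
    by (simp only: distrib_right)
  also have "?G + ?G
     = (\<integral>\<^sup>+ s. ennreal ((norm (g s))\<^sup>2) \<partial>lborel)"
    by (subst nn_integral_add[symmetric]) (auto simp: ennreal_plus[symmetric] simp del: ennreal_plus)
  finally show ?thesis by (simp only: mult.commute)
qed

text \<open>The bound with Gaussian factor is uniform in its parameter; monotone convergence removes
  the factor.\<close>

lemma fourier1_Plancherel_le:
  assumes g: "integrable lborel g"
  shows "(\<integral>\<^sup>+ l. ennreal ((norm (fourier1 g l))\<^sup>2) \<partial>lborel)
     \<le> ennreal (2 * pi) * (\<integral>\<^sup>+ t. ennreal ((norm (g t))\<^sup>2) \<partial>lborel)"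
proof -
  have [measurable]: "g \<in> borel_measurable borel" using g by auto
  let ?e = "\<lambda>i::nat. inverse (real (Suc i))"
  have "(\<lambda>i. \<integral>\<^sup>+ l. ennreal (exp (- (?e i * l\<^sup>2)) * (norm (fourier1 g l))\<^sup>2) \<partial>lborel)
     \<longlonglongrightarrow> (\<integral>\<^sup>+ l. ennreal ((norm (fourier1 g l))\<^sup>2) \<partial>lborel)"
  proof (rule nn_integral_LIMSEQ)
    show "incseq (\<lambda>i l. ennreal (exp (- (?e i * l\<^sup>2)) * (norm (fourier1 g l))\<^sup>2))"
      by (auto simp: incseq_def le_fun_def intro!: ennreal_leI mult_right_mono le_imp_inverse_le)
    show "(\<lambda>i. ennreal (exp (- (?e i * l\<^sup>2)) * (norm (fourier1 g l))\<^sup>2)) \<longlonglongrightarrow> ennreal ((norm (fourier1 g l))\<^sup>2)" for l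
    proof (rule tendsto_ennrealI)
      have "(\<lambda>i. exp (- (?e i * l\<^sup>2)) * (norm (fourier1 g l))\<^sup>2) \<longlonglongrightarrow> exp (- (0 * l\<^sup>2)) * (norm (fourier1 g l))\<^sup>2"
        by (intro tendsto_intros LIMSEQ_inverse_real_of_nat)
      then show "(\<lambda>i. exp (- (?e i * l\<^sup>2)) * (norm (fourier1 g l))\<^sup>2) \<longlonglongrightarrow> (norm (fourier1 g l))\<^sup>2" by simp
    qed
  qed measurable
  then show ?thesis
    by (rule LIMSEQ_le_const2) (intro exI allI impI fourier1_gaussian_le g, simp)
qed

subsection \<open>The transform on the rays of the fan\<close>

text \<open>The dependence on t splits off as a character. The transform on a ray is therefore a
  Fourier transform in t followed by twisted convolution in z.\<close>

lemma e_fun_hmult: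
  "e_fun k l (hmult (hinv x) (w, 0)) = exp (\<i> * of_real (- (l * snd x))) * tkernel k l w (fst x)"
proof -
  have sn: "snd (hmult (hinv x) (w, 0)) = - snd x - 1/2 * (fst x \<bullet> Jmul w)"
    by (simp add: hmult_def hinv_def inner_Jmul sum_negf)
  have "l * snd (hmult (hinv x) (w, 0)) = - (l * snd x) + - (l / 2) * (fst x \<bullet> Jmul w)"
    unfolding sn by (simp add: algebra_simps)
  then have "\<i> * complex_of_real (l * snd (hmult (hinv x) (w, 0)))
     = \<i> * of_real (- (l * snd x)) + \<i> * of_real (- (l / 2) * (fst x \<bullet> Jmul w))"
    by (simp only: of_real_add distrib_left)
  moreover have "fst (hmult (hinv x) (w, 0)) = w - fst x"
    by (simp add: hmult_def hinv_def)
  ultimately show ?thesis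
    by (simp only: e_fun_def tkernel_def exp_add mult_ac)
qed

definition slice :: "((complex^'n) \<times> real \<Rightarrow> complex) \<Rightarrow> real \<Rightarrow> complex^'n \<Rightarrow> complex" where
  "slice f l z = fourier1 (\<lambda>t. f (z, t)) l"

lemma slice_measurable2 [measurable]:
  assumes [measurable]: "f \<in> borel_measurable borel"
  shows "(\<lambda>p. slice f (fst p) (snd p)) \<in> borel_measurable (borel \<Otimes>\<^sub>M borel)"
proof -
  have [measurable]: "f \<in> borel_measurable (borel \<Otimes>\<^sub>M borel)"
    using assms by (simp add: borel_prod)
  show ?thesis unfolding slice_def fourier1_def by measurable
qed

lemma slice_measurable [measurable]:
  assumes [measurable]: "f \<in> borel_measurable borel"
  shows "slice f l \<in> borel_measurable borel"
  using measurable_compose[OF measurable_Pair1' slice_measurable2[OF assms], of l] by simp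

lemma integrable_phase_mult:
  fixes f :: "(complex^'n) \<times> real \<Rightarrow> complex"
  assumes f: "integrable lborel f"
  shows "integrable (lborel \<Otimes>\<^sub>M lborel) (\<lambda>(z, t). exp (\<i> * of_real (- (l * t))) * f (z, t))"
proof -
  have "integrable (lborel \<Otimes>\<^sub>M lborel) f" using f by (simp add: lborel_prod)
  then have "integrable (lborel \<Otimes>\<^sub>M lborel) (\<lambda>p. f p * exp (\<i> * of_real (- (l * snd p))))"
    by (rule integrable_mult_bounded[where C = 1]) auto
  then show ?thesis by (simp add: case_prod_unfold mult.commute)
qed

lemma slice_integrable:
  assumes f: "integrable lborel f"
  shows "integrable lborel (slice f l)"
  using lborel_pair.integrable_fst[OF integrable_phase_mult[OF f]]
  by (simp add: slice_def[abs_def] fourier1_def)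

lemma strichartz_ray:
  fixes f :: "(complex^'n) \<times> real \<Rightarrow> complex"
  assumes f: "integrable lborel f" and l: "l \<noteq> 0"
  shows "strichartz f (l, (2 * real k + real CARD('n)) * \<bar>l\<bar>) w = tproj k l (slice f l) w"
proof -
  have k: "fan_index CARD('n) (l, (2 * real k + real CARD('n)) * \<bar>l\<bar>) = k"
    by (rule fan_index_ray) (use l in \<open>auto simp: fan_ray_def\<close>)
  have [measurable]: "f \<in> borel_measurable borel" using f by auto
  have i0: "integrable (lborel \<Otimes>\<^sub>M lborel) (\<lambda>p. tkernel k l w (fst p) * (exp (\<i> * of_real (- (l * snd p))) * f p))"
  proof -
    have "integrable (lborel \<Otimes>\<^sub>M lborel) (\<lambda>p. (exp (\<i> * of_real (- (l * snd p))) * f p) * tkernel k l w (fst p))"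
      by (rule integrable_mult_bounded[where C = "fan_weight CARD('n) k"])
        (use integrable_phase_mult[OF f, of l] in \<open>auto simp: case_prod_unfold norm_tkernel lag_phi_le_weight[OF l]\<close>)
    then show ?thesis by (simp only: mult.commute[of "tkernel k l w _"])
  qed
  have "strichartz f (l, (2 * real k + real CARD('n)) * \<bar>l\<bar>) w
     = (LINT x|lborel. f x * (exp (\<i> * of_real (- (l * snd x))) * tkernel k l w (fst x)))"
    using l by (simp only: strichartz_def k e_fun_hmult fst_conv if_True simp_thms)
  also have "\<dots> = (LINT p|(lborel \<Otimes>\<^sub>M lborel). tkernel k l w (fst p) * (exp (\<i> * of_real (- (l * snd p))) * f p))"
    unfolding lborel_prod by (simp only: mult_ac)
  also have "\<dots> = (LINT z|lborel. (LINT t|lborel. tkernel k l w z * (exp (\<i> * of_real (- (l * t))) * f (z, t))))"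
    using lborel_pair.integral_fst'[OF i0] by simp
  also have "\<dots> = tproj k l (slice f l) w"
    by (simp only: tproj_def slice_def fourier1_def integral_mult_right_zero)
  finally show ?thesis .
qed

lemma strichartz_normalized_ray:
  fixes f :: "(complex^'n) \<times> real \<Rightarrow> complex"
  assumes f: "integrable lborel f" and l: "l \<noteq> 0"
  shows "strichartz_normalized f (l, (2 * real k + real CARD('n)) * \<bar>l\<bar>) w
    = tproj k l (slice f l) w / of_real (fan_weight CARD('n) k)"
proof -
  have k: "fan_index CARD('n) (l, (2 * real k + real CARD('n)) * \<bar>l\<bar>) = k"
    by (rule fan_index_ray) (use l in \<open>auto simp: fan_ray_def\<close>)
  show ?thesis
    using l unfolding strichartz_normalized_def Let_def k strichartz_ray[OF f l] fan_weight_def by simp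
qed

text \<open>The value \<open>0\<close> on the limiting ray is harmless: the weight \<open>u\<close> vanishes there.\<close>

definition ray_transform :: "((complex^'n) \<times> real \<Rightarrow> complex) \<Rightarrow> (real \<times> real) \<times> (complex^'n) \<Rightarrow> complex" where
  "ray_transform f p = (if fst (fst p) \<noteq> 0 then strichartz_normalized f (fst p) (snd p) else 0)"

lemma heisenberg_fan_cases:
  assumes "a \<in> heisenberg_fan n" "fst a \<noteq> 0"
  obtains k where "a = (fst a, (2 * real k + real n) * \<bar>fst a\<bar>)"
  using assms by (auto simp: heisenberg_fan_def fan_ray_def fan_ray_inf_def)

lemma slice_norm_le:
  fixes f :: "(complex^'n) \<times> real \<Rightarrow> complex"
  assumes f: "integrable lborel f"
  shows "(LINT z|lborel. norm (slice f l z)) \<le> (LINT x|lborel. norm (f x))"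
proof -
  have [measurable]: "f \<in> borel_measurable borel" using f by auto
  have [measurable]: "f \<in> borel_measurable (borel \<Otimes>\<^sub>M borel)"
    by (simp add: borel_prod)
  have "ennreal (LINT z|lborel. norm (slice f l z)) = (\<integral>\<^sup>+ z. ennreal (norm (slice f l z)) \<partial>lborel)"
    by (intro nn_integral_eq_integral[symmetric] integrable_norm slice_integrable f AE_I2) simp
  also have "\<dots> \<le> (\<integral>\<^sup>+ z. (\<integral>\<^sup>+ t. ennreal (norm (exp (\<i> * of_real (- (l * t))) * f (z, t))) \<partial>lborel) \<partial>lborel)"
    unfolding slice_def fourier1_def by (intro nn_integral_mono norm_integral_le_nn_integral)
  also have "\<dots> = (\<integral>\<^sup>+ z. (\<integral>\<^sup>+ t. ennreal (norm (f (z, t))) \<partial>lborel) \<partial>lborel)"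
    by (simp add: norm_mult)
  also have "\<dots> = (\<integral>\<^sup>+ x. ennreal (norm (f x)) \<partial>(lborel \<Otimes>\<^sub>M lborel))"
    by (rule lborel.nn_integral_fst) measurable
  also have "\<dots> = ennreal (LINT x|lborel. norm (f x))"
    unfolding lborel_prod by (intro nn_integral_eq_integral integrable_norm f AE_I2) simp
  finally show ?thesis by (simp add: ennreal_le_iff integral_nonneg)
qed

text \<open>The normalising factor is the reciprocal of the maximum \<open>fan_weight\<close> of the
  Laguerre function, which gives the constant 1 on every ray.\<close>

lemma ray_transform_bound:
  fixes f :: "(complex^'n) \<times> real \<Rightarrow> complex"
  assumes f: "integrable lborel f" and a: "fst p \<in> heisenberg_fan CARD('n)"
  shows "norm (ray_transform f p) \<le> (LINT x|lborel. norm (f x))"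
proof (cases "fst (fst p) = 0")
  case True
  then show ?thesis by (simp add: ray_transform_def)
next
  case False
  define l where "l = fst (fst p)"
  have l: "l \<noteq> 0" using False by (simp add: l_def)
  from a False obtain k where k: "fst p = (l, (2 * real k + real CARD('n)) * \<bar>l\<bar>)"
    unfolding l_def by (rule heisenberg_fan_cases)
  let ?W = "fan_weight CARD('n) k"
  have W: "?W > 0" by (rule fan_weight_pos)
  have "norm (ray_transform f p) = norm (tproj k l (slice f l) (snd p)) / ?W"
    unfolding ray_transform_def k strichartz_normalized_ray[OF f l] using l W by (simp add: norm_divide)
  also have "\<dots> \<le> (?W * (LINT z|lborel. norm (slice f l z))) / ?W"
    using W by (intro divide_right_mono tproj_bound l slice_integrable f) auto
  also have "\<dots> = (LINT z|lborel. norm (slice f l z))" using W by simp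
  also have "\<dots> \<le> (LINT x|lborel. norm (f x))" by (rule slice_norm_le[OF f])
  finally show ?thesis .
qed

lemma measurable_fst_nu2 [measurable]:
  "(\<lambda>p. fst (fst p)) \<in> borel_measurable (nu2 m \<Otimes>\<^sub>M M)"
  "(\<lambda>p. snd (fst p)) \<in> borel_measurable (nu2 m \<Otimes>\<^sub>M M)"
proof -
  have "(\<lambda>x. x) \<in> nu2 m \<rightarrow>\<^sub>M borel"
    unfolding measurable_cong_sets[OF sets_nu2 refl] by (rule measurable_restrict_space1) simp
  then have [measurable]: "fst \<in> nu2 m \<Otimes>\<^sub>M M \<rightarrow>\<^sub>M borel \<Otimes>\<^sub>M borel"
    unfolding borel_prod by (rule measurable_compose[OF measurable_fst])
  show "(\<lambda>p. fst (fst p)) \<in> borel_measurable (nu2 m \<Otimes>\<^sub>M M)"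
    "(\<lambda>p. snd (fst p)) \<in> borel_measurable (nu2 m \<Otimes>\<^sub>M M)"
    by measurable
qed

text \<open>The index of the ray is a definite description and so not visibly measurable. On the fan
  it is recovered from the coordinates by solving \<tau> = (2k+n)|\<lambda>| for k, and the
  transform is then glued from countably many functions \<open>h k\<close>.\<close>

lemma ray_transform_measurable [measurable]:
  fixes f :: "(complex^'n) \<times> real \<Rightarrow> complex"
  assumes f: "integrable lborel f"
  shows "ray_transform f \<in> borel_measurable (nu2 CARD('n) \<Otimes>\<^sub>M lborel)"
proof -
  have [measurable]: "f \<in> borel_measurable borel" using f by auto
  let ?M = "nu2 CARD('n) \<Otimes>\<^sub>M (lborel :: (complex^'n) measure)"
  define kk where "kk p = nat \<lfloor>(snd (fst p) / \<bar>fst (fst p)\<bar> - real CARD('n)) / 2\<rfloor>" for p :: "(real \<times> real) \<times> (complex^'n)"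
  define h where "h k p = (if fst (fst p) \<noteq> 0 then tproj k (fst (fst p)) (slice f (fst (fst p))) (snd p) / complex_of_real (fan_weight CARD('n) k) else 0)"
    for k and p :: "(real \<times> real) \<times> (complex^'n)"
  have [measurable]: "kk \<in> ?M \<rightarrow>\<^sub>M count_space UNIV"
    unfolding kk_def by measurable
  have lagm [measurable]: "(\<lambda>x. lag_phi k (fst x) (snd x :: complex^'n)) \<in> borel_measurable (borel \<Otimes>\<^sub>M borel)" for k
    unfolding borel_prod lag_phi_def by (intro borel_measurable_continuous_onI continuous_intros)
  have lagm' [measurable]: "(\<lambda>q. lag_phi k (g q) (g' q :: complex^'n)) \<in> borel_measurable N"
    if "g \<in> borel_measurable N" "g' \<in> borel_measurable N" for k g g' and N :: "'c measure"
    using measurable_compose[OF measurable_Pair[OF that] lagm[of k]] by simp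
  have slm' [measurable]: "(\<lambda>q. slice f (g q) (g' q)) \<in> borel_measurable N"
    if "g \<in> borel_measurable N" "g' \<in> borel_measurable N" for g g' and N :: "'c measure"
    using measurable_compose[OF measurable_Pair[OF that] slice_measurable2[of f]] by simp
  have [measurable]: "h k \<in> borel_measurable ?M" for k
    unfolding h_def tproj_def tkernel_def by measurable
  have "(\<lambda>p. h (kk p) p) \<in> borel_measurable ?M"
    by (rule measurable_compose_countable) measurable
  moreover have "h (kk p) p = ray_transform f p" if "p \<in> space ?M" for p
  proof (cases "fst (fst p) = 0")
    case True
    then show ?thesis by (simp add: ray_transform_def h_def)
  next
    case False
    define l where "l = fst (fst p)"
    have l: "l \<noteq> 0" using False by (simp add: l_def)
    have "fst p \<in> heisenberg_fan CARD('n)" using that by (auto simp: space_pair_measure space_nu2)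
    with False obtain k where k: "fst p = (l, (2 * real k + real CARD('n)) * \<bar>l\<bar>)"
      unfolding l_def by (metis heisenberg_fan_cases)
    have "kk p = k" using l unfolding kk_def k by simp
    then show ?thesis
      using l unfolding ray_transform_def h_def k by (simp add: strichartz_normalized_ray[OF f l])
  qed
  ultimately show ?thesis by (subst measurable_cong[where g = "\<lambda>p. h (kk p) p"]) auto
qed

text \<open>All constants cancel: the squared weights in \<open>nu2\<close> against the
  normalisation, |l|^(2n) against the factor (2 pi/|l|)^(2n) of Bessel's inequality, and (2
  pi)^(-2n-1) against the remaining (2 pi)^(2n) and the 2 pi of Plancherel.\<close>

lemma ray_transform_Bessel:
  fixes f :: "(complex^'n) \<times> real \<Rightarrow> complex"
  assumes f: "integrable lborel f"
  shows "(\<integral>\<^sup>+ p. ennreal ((norm (ray_transform f p))\<^sup>2) \<partial>(nu2 CARD('n) \<Otimes>\<^sub>M lborel))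
    \<le> (\<integral>\<^sup>+ x. ennreal ((norm (f x))\<^sup>2) \<partial>lborel)"
proof -
  define N where "N = CARD('n)"
  have [measurable]: "f \<in> borel_measurable borel" using f by auto
  have [measurable]: "f \<in> borel_measurable (borel \<Otimes>\<^sub>M borel)"
    by (simp add: borel_prod)
  have rm [measurable]: "ray_transform f \<in> borel_measurable (nu2 N \<Otimes>\<^sub>M lborel)"
    unfolding N_def by (rule ray_transform_measurable[OF f])
  let ?W = "fan_weight N"
  have W: "?W k > 0" for k by (rule fan_weight_pos)
  let ?I = "\<lambda>a. \<integral>\<^sup>+ w. ennreal ((norm (ray_transform f (a, w)))\<^sup>2) \<partial>lborel"
  have Im: "?I \<in> borel_measurable (nu2 N)"
    by (rule lborel.borel_measurable_nn_integral_fst[where f = "\<lambda>p. ennreal ((norm (ray_transform f p))\<^sup>2)", simplified]) measurable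
  let ?S = "\<lambda>l. \<integral>\<^sup>+ z. ennreal ((norm (slice f l z))\<^sup>2) \<partial>lborel" and ?F = "\<integral>\<^sup>+ x. ennreal ((norm (f x))\<^sup>2) \<partial>lborel"
  let ?P = "\<lambda>k l. \<integral>\<^sup>+ w. ennreal ((norm (tproj k l (slice f l) w))\<^sup>2) \<partial>lborel"
  let ?a = "\<lambda>k l. (l, (2 * real k + real N) * \<bar>l\<bar>)"
  have ray: "ennreal ((?W k)\<^sup>2) * ?I (?a k l)
      = (?P k l)" if l: "l \<noteq> 0" for k l
  proof -
    have tm [measurable]: "tproj k l (slice f l) \<in> borel_measurable borel"
      by (intro tproj_measurable slice_measurable) measurable
    have "ennreal ((norm (ray_transform f ((?a k l), w)))\<^sup>2)
      = ennreal (1 / (?W k)\<^sup>2) * ennreal ((norm (tproj k l (slice f l) w))\<^sup>2)" for w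
      using l W[of k] unfolding ray_transform_def N_def
      by (simp add: strichartz_normalized_ray[OF f l] norm_divide power_divide ennreal_mult[symmetric])
    then have "?I (?a k l)
      = ennreal (1 / (?W k)\<^sup>2) * (?P k l)"
      by (simp add: nn_integral_cmult)
    moreover have "ennreal ((?W k)\<^sup>2) * ennreal (1 / (?W k)\<^sup>2) = 1"
      using W[of k] by (simp add: ennreal_mult[symmetric])
    ultimately show ?thesis by (simp add: mult.assoc[symmetric])
  qed
  have bes: "(\<Sum>k. ennreal ((?W k)\<^sup>2) * ?I (?a k l)) * ennreal (\<bar>l\<bar> ^ (2 * N))
      \<le> ennreal ((2 * pi) ^ (2 * N)) * (?S l)" for l
  proof (cases "l = 0")
    case True
    \<comment> \<open>At l = 0 the sum is not controlled, but the density vanishes, and in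
      \<open>ennreal\<close> a product with 0 is 0 even if the other factor is infinite.\<close>
    have "ennreal (\<bar>l\<bar> ^ (2 * N)) = 0" using True by (simp add: N_def zero_power)
    then show ?thesis by (simp only: mult_zero_right zero_le)
  next
    case False
    have "(\<Sum>k. ennreal ((?W k)\<^sup>2) * ?I (?a k l)) * ennreal (\<bar>l\<bar> ^ (2 * N))
      \<le> (ennreal (((2 * pi / \<bar>l\<bar>) ^ N)\<^sup>2) * (?S l)) * ennreal (\<bar>l\<bar> ^ (2 * N))"
      unfolding ray[OF False] unfolding N_def
      by (intro mult_right_mono tproj_Bessel False slice_integrable f) simp
    also have "\<dots> = (ennreal (((2 * pi / \<bar>l\<bar>) ^ N)\<^sup>2) * ennreal (\<bar>l\<bar> ^ (2 * N))) * (?S l)"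
      by (simp only: mult_ac)
    also have "ennreal (((2 * pi / \<bar>l\<bar>) ^ N)\<^sup>2) * ennreal (\<bar>l\<bar> ^ (2 * N)) = ennreal (((2 * pi / \<bar>l\<bar>) ^ N)\<^sup>2 * \<bar>l\<bar> ^ (2 * N))"
      by (intro ennreal_mult[symmetric]) auto
    also have "((2 * pi / \<bar>l\<bar>) ^ N)\<^sup>2 * \<bar>l\<bar> ^ (2 * N) = (2 * pi) ^ (2 * N)"
    proof -
      have "(y ^ N)\<^sup>2 * L ^ (2 * N) = (y * L) ^ (2 * N)" for y L :: real
        by (simp add: power_mult_distrib power_mult[symmetric] mult.commute[of N])
      then show ?thesis using False by simp
    qed
    finally show ?thesis .
  qed
  have "(\<integral>\<^sup>+ l. (?S l) \<partial>lborel)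
     = (\<integral>\<^sup>+ z. (\<integral>\<^sup>+ l. ennreal ((norm (slice f l z))\<^sup>2) \<partial>lborel) \<partial>lborel)"
    by (rule lborel_pair.Fubini'[symmetric]) (simp add: case_prod_unfold)
  also have "\<dots> \<le> (\<integral>\<^sup>+ z. ennreal (2 * pi) * (\<integral>\<^sup>+ t. ennreal ((norm (f (z, t)))\<^sup>2) \<partial>lborel) \<partial>lborel)"
  \<comment> \<open>Integrability of f in both variables gives integrability in t for almost every z
    only.\<close>
  proof (rule nn_integral_mono_AE)
    have "integrable (lborel \<Otimes>\<^sub>M lborel) f" using f by (simp add: lborel_prod)
    then have "AE z in lborel. integrable lborel (\<lambda>t. f (z, t))"
      by (rule lborel_pair.AE_integrable_fst')
    then show "AE z in lborel. (\<integral>\<^sup>+ l. ennreal ((norm (slice f l z))\<^sup>2) \<partial>lborel) \<le> ennreal (2 * pi) * (\<integral>\<^sup>+ t. ennreal ((norm (f (z, t)))\<^sup>2) \<partial>lborel)"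
      unfolding slice_def by eventually_elim (rule fourier1_Plancherel_le)
  qed
  also have "\<dots> = ennreal (2 * pi) * (\<integral>\<^sup>+ z. (\<integral>\<^sup>+ t. ennreal ((norm (f (z, t)))\<^sup>2) \<partial>lborel) \<partial>lborel)"
    by (rule nn_integral_cmult) measurable
  also have "(\<integral>\<^sup>+ z. (\<integral>\<^sup>+ t. ennreal ((norm (f (z, t)))\<^sup>2) \<partial>lborel) \<partial>lborel) = ?F"
    unfolding lborel_prod[symmetric]
    by (rule lborel.nn_integral_fst[where f = "\<lambda>x. ennreal ((norm (f x))\<^sup>2)"]) measurable
  finally have Planch: "(\<integral>\<^sup>+ l. (?S l) \<partial>lborel)
     \<le> ennreal (2 * pi) * ?F" .
  have "(\<integral>\<^sup>+ p. ennreal ((norm (ray_transform f p))\<^sup>2) \<partial>(nu2 N \<Otimes>\<^sub>M lborel)) = (\<integral>\<^sup>+ a. ?I a \<partial>nu2 N)"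
    by (rule lborel.nn_integral_fst[symmetric, where f = "\<lambda>p. ennreal ((norm (ray_transform f p))\<^sup>2)"]) measurable
  also have "\<dots> = ennreal (1 / (2 * pi) ^ (2 * N + 1)) * (\<integral>\<^sup>+ l. (\<Sum>k. ennreal ((?W k)\<^sup>2) * ?I (?a k l)) * ennreal (\<bar>l\<bar> ^ (2 * N)) \<partial>lborel)"
    unfolding fan_weight_def by (rule nn_integral_nu2[OF Im])
  also have "\<dots> \<le> ennreal (1 / (2 * pi) ^ (2 * N + 1)) * (\<integral>\<^sup>+ l. ennreal ((2 * pi) ^ (2 * N)) * (?S l) \<partial>lborel)"
    by (intro mult_left_mono nn_integral_mono bes) simp
  also have "\<dots> = ennreal (1 / (2 * pi) ^ (2 * N + 1)) * (ennreal ((2 * pi) ^ (2 * N)) * (\<integral>\<^sup>+ l. (?S l) \<partial>lborel))"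
  proof -
    have "(\<lambda>l. \<integral>\<^sup>+ z. ennreal ((norm (slice f l z))\<^sup>2) \<partial>lborel) \<in> borel_measurable lborel"
      using lborel.borel_measurable_nn_integral_fst[of "\<lambda>p. ennreal ((norm (slice f (fst p) (snd p)))\<^sup>2)" "lborel :: real measure"] by simp
    then show ?thesis by (simp only: nn_integral_cmult)
  qed
  also have "\<dots> \<le> ennreal (1 / (2 * pi) ^ (2 * N + 1)) * (ennreal ((2 * pi) ^ (2 * N)) * (ennreal (2 * pi) * ?F))"
    by (intro mult_left_mono Planch) auto
  also have "ennreal (1 / (2 * pi) ^ (2 * N + 1)) * (ennreal ((2 * pi) ^ (2 * N)) * (ennreal (2 * pi) * ?F))
    = (ennreal (1 / (2 * pi) ^ (2 * N + 1)) * ennreal ((2 * pi) ^ (2 * N)) * ennreal (2 * pi)) * ?F"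
    by (simp only: mult.assoc)
  also have "ennreal (1 / (2 * pi) ^ (2 * N + 1)) * ennreal ((2 * pi) ^ (2 * N)) * ennreal (2 * pi) = 1"
    by (simp add: ennreal_mult[symmetric] power_add)
  finally show ?thesis unfolding N_def mult_1_left .
qed

subsection \<open>Dyadic sums and weak integrability\<close>

definition dy :: "int \<Rightarrow> real" where "dy j = 2 powr real_of_int j"

lemma dy_pos: "dy j > 0" by (simp add: dy_def)

lemma dy_minus: "dy (- j) = 1 / dy j"
  by (simp add: dy_def powr_minus_divide)

lemma dy_powr: "dy j powr b = 2 powr (b * real_of_int j)"
  by (simp add: dy_def powr_powr mult.commute)

lemma ex_dyadic:
  assumes "x > 0"
  obtains j where "dy j < x" "x \<le> 2 * dy j"
proof
  \<comment> \<open>Ceiling minus one rather than floor: shells are open below and closed above, so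
    an exact power of 2 belongs to the shell beneath it.\<close>
  define j where "j = \<lceil>log 2 x\<rceil> - 1"
  have "real_of_int j < log 2 x" "log 2 x \<le> real_of_int j + 1"
    unfolding j_def by linarith+
  then have "2 powr real_of_int j < 2 powr log 2 x" "2 powr log 2 x \<le> 2 powr (real_of_int j + 1)"
    by (auto intro: powr_less_mono powr_mono)
  then show "dy j < x" "x \<le> 2 * dy j"
    using assms by (auto simp: dy_def powr_add)
qed

lemma dyadic_sum_le:
  assumes b: "b > 0" and c: "c > 0"
  shows "(\<integral>\<^sup>+ j. ennreal (dy j powr b) * indicator {j. dy j \<le> c} j \<partial>count_space UNIV)
    \<le> ennreal (c powr b / (1 - 2 powr (- b)))"
proof -
  define J where "J = \<lfloor>log 2 c\<rfloor>"
  have dJ: "dy j \<le> c \<longleftrightarrow> j \<le> J" for j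
    using c unfolding dy_def J_def by (simp add: le_floor_iff le_log_iff)
  let ?g = "\<lambda>i::nat. J - int i"
  have bij: "bij_betw ?g UNIV {..J}"
    by (rule bij_betw_byWitness[where f' = "\<lambda>j. nat (J - j)"]) auto
  have r: "0 \<le> 2 powr (- b)" "2 powr (- b) < 1"
    using b powr_less_mono[of "-b" 0 2] by auto
  have tm: "dy (?g i) powr b = dy J powr b * (2 powr (- b)) ^ i" for i
    unfolding dy_powr by (simp add: powr_realpow[symmetric] powr_powr powr_add[symmetric] algebra_simps)
  have "(\<integral>\<^sup>+ j. ennreal (dy j powr b) * indicator {j. dy j \<le> c} j \<partial>count_space UNIV)
    = (\<integral>\<^sup>+ j. ennreal (dy j powr b) * indicator {..J} j \<partial>count_space UNIV)"
    unfolding dJ by (simp add: atMost_def)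
  also have "\<dots> = (\<integral>\<^sup>+ j. ennreal (dy j powr b) \<partial>count_space {..J})"
    by (simp add: nn_integral_count_space_indicator)
  also have "\<dots> = (\<integral>\<^sup>+ i. ennreal (dy (?g i) powr b) \<partial>count_space UNIV)"
    by (rule nn_integral_bij_count_space[OF bij, symmetric])
  also have "\<dots> = (\<Sum>i. ennreal (dy J powr b * (2 powr (- b)) ^ i))"
    unfolding tm by (simp add: nn_integral_count_space_nat)
  also have "\<dots> = ennreal (dy J powr b * (1 / (1 - 2 powr (- b))))"
    using r by (intro suminf_ennreal_eq sums_mult geometric_sums) auto
  also have "\<dots> \<le> ennreal (c powr b * (1 / (1 - 2 powr (- b))))"
    using r b dJ[of J] dy_pos[of J] by (intro ennreal_leI mult_right_mono powr_mono2) auto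
  finally show ?thesis by simp
qed

lemma dyadic_sum_le':
  assumes b: "b > 0" and c: "c > 0"
  shows "(\<integral>\<^sup>+ j. ennreal (dy (- j) powr b) * indicator {j. dy (- j) \<le> c} j \<partial>count_space UNIV)
    \<le> ennreal (c powr b / (1 - 2 powr (- b)))"
proof -
  have bij: "bij_betw uminus (UNIV :: int set) UNIV"
    by (rule bij_betw_byWitness[where f' = uminus]) auto
  have "(\<integral>\<^sup>+ j. ennreal (dy (- j) powr b) * indicator {j. dy (- j) \<le> c} j \<partial>count_space UNIV)
    = (\<integral>\<^sup>+ j. ennreal (dy j powr b) * indicator {j. dy j \<le> c} j \<partial>count_space UNIV)"
    using nn_integral_bij_count_space[OF bij, of "\<lambda>j. ennreal (dy j powr b) * indicator {j. dy j \<le> c} j"]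
    by (simp add: indicator_def)
  then show ?thesis using dyadic_sum_le[OF b c] by simp
qed

text \<open>The inclusion of l^1 in l^r: every term is at most S, so r - 1 of its powers can be
  replaced by S.\<close>

lemma nn_integral_powr_sum_le:
  fixes c :: "'a \<Rightarrow> real"
  assumes c: "\<And>j. c j \<ge> 0" and s: "(\<integral>\<^sup>+ j. ennreal (c j) \<partial>count_space UNIV) \<le> ennreal S"
    and S: "S \<ge> 0" and r: "r \<ge> 1"
  shows "(\<integral>\<^sup>+ j. ennreal (c j powr r) \<partial>count_space UNIV) \<le> ennreal (S powr r)"
proof -
  have le: "c j \<le> S" for j
    using order_trans[OF nn_integral_ge_point[of j UNIV "\<lambda>j. ennreal (c j)"] s] S by simp
  have eq: "x powr r = x powr (r - 1) * x" if "x \<ge> 0" for x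
    using that powr_mult_base[of x "r - 1"] by (simp add: mult.commute)
  have "(\<integral>\<^sup>+ j. ennreal (c j powr r) \<partial>count_space UNIV) \<le> (\<integral>\<^sup>+ j. ennreal (S powr (r - 1)) * ennreal (c j) \<partial>count_space UNIV)"
  proof (rule nn_integral_mono)
    fix j
    have "c j powr (r - 1) * c j \<le> S powr (r - 1) * c j"
      using r le[of j] c[of j] by (intro mult_right_mono powr_mono2) auto
    then show "ennreal (c j powr r) \<le> ennreal (S powr (r - 1)) * ennreal (c j)"
      unfolding eq[OF c] using c[of j] by (simp add: ennreal_mult[symmetric] ennreal_leI)
  qed
  also have "\<dots> = ennreal (S powr (r - 1)) * (\<integral>\<^sup>+ j. ennreal (c j) \<partial>count_space UNIV)"
    by (rule nn_integral_cmult) simp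
  also have "\<dots> \<le> ennreal (S powr (r - 1)) * ennreal S"
    by (intro mult_left_mono s) simp
  also have "\<dots> = ennreal (S powr r)"
    using S by (simp add: eq ennreal_mult[symmetric])
  finally show ?thesis .
qed

text \<open>Stated with the exponents t and 1 - t on two functions with bounded integrals, since
  this is how the weighted factors arise. Young's inequality is applied after dividing by U and V;
  if one of them is 0, the integrand vanishes almost everywhere.\<close>

lemma nn_integral_Holder:
  fixes u v :: "'a \<Rightarrow> real"
  assumes [measurable]: "u \<in> borel_measurable M" "v \<in> borel_measurable M"
    and u: "\<And>x. u x \<ge> 0" and v: "\<And>x. v x \<ge> 0"
    and U: "(\<integral>\<^sup>+ x. ennreal (u x) \<partial>M) \<le> ennreal U" "U \<ge> 0"
    and V: "(\<integral>\<^sup>+ x. ennreal (v x) \<partial>M) \<le> ennreal V" "V \<ge> 0"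
    and t: "0 < t" "t < 1"
  shows "(\<integral>\<^sup>+ x. ennreal (u x powr t * v x powr (1 - t)) \<partial>M) \<le> ennreal (U powr t * V powr (1 - t))"
proof (cases "U = 0 \<or> V = 0")
  case True
  have "AE x in M. ennreal (u x powr t * v x powr (1 - t)) = 0"
    using True
  proof
    assume "U = 0"
    then have "(\<integral>\<^sup>+ x. ennreal (u x) \<partial>M) = 0" using U by simp
    then have "AE x in M. ennreal (u x) = 0" by (subst (asm) nn_integral_0_iff_AE) auto
    then show ?thesis by eventually_elim (use u in \<open>auto simp: antisym\<close>)
  next
    assume "V = 0"
    then have "(\<integral>\<^sup>+ x. ennreal (v x) \<partial>M) = 0" using V by simp
    then have "AE x in M. ennreal (v x) = 0" by (subst (asm) nn_integral_0_iff_AE) auto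
    then show ?thesis by eventually_elim (use v in \<open>auto simp: antisym\<close>)
  qed
  then have "(\<integral>\<^sup>+ x. ennreal (u x powr t * v x powr (1 - t)) \<partial>M) = 0"
    by (subst nn_integral_0_iff_AE) auto
  then show ?thesis by simp
next
  case False
  then have pos: "U > 0" "V > 0" using U V by auto
  define K where "K = U powr t * V powr (1 - t)"
  have K: "K \<ge> 0" by (simp add: K_def)
  have young: "u x powr t * v x powr (1 - t) \<le> K * (t / U * u x + (1 - t) / V * v x)" for x
  proof (cases "u x = 0 \<or> v x = 0")
    case True
    then show ?thesis using K pos t u[of x] v[of x] by auto
  next
    case False
    then have p: "u x / U > 0" "v x / V > 0" using u[of x] v[of x] pos by (auto simp: less_le)
    have "(u x / U) powr t * (v x / V) powr (1 - t) \<le> t * (u x / U) + (1 - t) * (v x / V)"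
      using t p by (intro Youngs_inequality_0) auto
    then have "K * ((u x / U) powr t * (v x / V) powr (1 - t)) \<le> K * (t * (u x / U) + (1 - t) * (v x / V))"
      by (rule mult_left_mono[OF _ K])
    moreover have "K * ((u x / U) powr t * (v x / V) powr (1 - t)) = u x powr t * v x powr (1 - t)"
      using pos u[of x] v[of x] by (simp add: K_def powr_divide)
    ultimately show ?thesis by simp
  qed
  have "(\<integral>\<^sup>+ x. ennreal (u x powr t * v x powr (1 - t)) \<partial>M)
     \<le> (\<integral>\<^sup>+ x. ennreal (K * t / U) * ennreal (u x) + ennreal (K * (1 - t) / V) * ennreal (v x) \<partial>M)"
  proof (rule nn_integral_mono)
    fix x
    have nn: "0 \<le> K * t / U" "0 \<le> K * (1 - t) / V" using K t pos by auto
    have "ennreal (K * t / U) * ennreal (u x) + ennreal (K * (1 - t) / V) * ennreal (v x) = ennreal (K * t / U * u x + K * (1 - t) / V * v x)"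
      using nn u[of x] v[of x]
      by (simp only: ennreal_mult[symmetric] ennreal_plus[symmetric] mult_nonneg_nonneg)
    also have "K * t / U * u x + K * (1 - t) / V * v x = K * (t / U * u x + (1 - t) / V * v x)"
      by (simp add: distrib_left)
    finally show "ennreal (u x powr t * v x powr (1 - t)) \<le> ennreal (K * t / U) * ennreal (u x) + ennreal (K * (1 - t) / V) * ennreal (v x)"
      using young[of x] by (simp add: ennreal_leI)
  qed
  also have "\<dots> = ennreal (K * t / U) * (\<integral>\<^sup>+ x. ennreal (u x) \<partial>M) + ennreal (K * (1 - t) / V) * (\<integral>\<^sup>+ x. ennreal (v x) \<partial>M)"
    by (simp add: nn_integral_add nn_integral_cmult)
  also have "\<dots> \<le> ennreal (K * t / U) * ennreal U + ennreal (K * (1 - t) / V) * ennreal V"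
    by (intro add_mono mult_left_mono U V) auto
  also have "\<dots> = ennreal (K * t / U * U + K * (1 - t) / V * V)"
    using K t pos by (simp add: ennreal_mult[symmetric] ennreal_plus[symmetric] del: ennreal_plus)
  also have "K * t / U * U + K * (1 - t) / V * V = K"
  proof -
    have "K * t / U * U = K * t" "K * (1 - t) / V * V = K * (1 - t)" using pos by simp_all
    then show ?thesis by (simp add: right_diff_distrib)
  qed
  finally show ?thesis by (simp add: K_def)
qed

text \<open>Every point with positive w lies in a dyadic shell, and F may be estimated there by a
  function depending on the shell. This is the common frame for all shell arguments below.\<close>

lemma nn_integral_dyadic_le:
  fixes w :: "'a \<Rightarrow> real" and F :: "'a \<Rightarrow> real" and G :: "int \<Rightarrow> 'a \<Rightarrow> real" and c :: "int \<Rightarrow> real"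
  assumes [measurable]: "w \<in> borel_measurable M" "\<And>j. G j \<in> borel_measurable M"
  assumes le: "\<And>j x. x \<in> space M \<Longrightarrow> dy j < w x \<Longrightarrow> w x \<le> 2 * dy j \<Longrightarrow> F x \<le> c j * G j x"
    and z: "\<And>x. x \<in> space M \<Longrightarrow> w x \<le> 0 \<Longrightarrow> F x \<le> 0"
    and c: "\<And>j. c j \<ge> 0" and G: "\<And>j x. G j x \<ge> 0"
  shows "(\<integral>\<^sup>+ x. ennreal (F x) \<partial>M)
    \<le> (\<integral>\<^sup>+ j. ennreal (c j) * (\<integral>\<^sup>+ x. ennreal (G j x) * indicator {x. dy j < w x \<and> w x \<le> 2 * dy j} x \<partial>M) \<partial>count_space UNIV)"
proof -
  let ?I = "\<lambda>j. {x. dy j < w x \<and> w x \<le> 2 * dy j}"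
  have m [measurable]: "(\<lambda>x. indicator (?I j) x :: ennreal) \<in> borel_measurable M" for j
    by (rule borel_measurable_indicator') simp
  have "(\<integral>\<^sup>+ x. ennreal (F x) \<partial>M)
    \<le> (\<integral>\<^sup>+ x. (\<integral>\<^sup>+ j. ennreal (c j) * (ennreal (G j x) * indicator (?I j) x) \<partial>count_space UNIV) \<partial>M)"
  proof (rule nn_integral_mono)
    fix x assume x: "x \<in> space M"
    show "ennreal (F x) \<le> (\<integral>\<^sup>+ j. ennreal (c j) * (ennreal (G j x) * indicator (?I j) x) \<partial>count_space UNIV)"
    proof (cases "w x > 0")
      case True
      then obtain j where j: "dy j < w x" "w x \<le> 2 * dy j" using ex_dyadic by blast
      have "ennreal (F x) \<le> ennreal (c j) * (ennreal (G j x) * indicator (?I j) x)"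
        using le[OF x j] c[of j] G[of j x] j by (simp add: ennreal_mult[symmetric] ennreal_leI)
      also have "\<dots> \<le> (\<integral>\<^sup>+ j. ennreal (c j) * (ennreal (G j x) * indicator (?I j) x) \<partial>count_space UNIV)"
        using nn_integral_ge_point[of j UNIV "\<lambda>j. ennreal (c j) * (ennreal (G j x) * indicator (?I j) x)"] by simp
      finally show ?thesis .
    next
      case False
      then show ?thesis using z[OF x] by (simp add: ennreal_neg)
    qed
  qed
  also have "\<dots> = (\<integral>\<^sup>+ j. (\<integral>\<^sup>+ x. ennreal (c j) * (ennreal (G j x) * indicator (?I j) x) \<partial>M) \<partial>count_space UNIV)"
    by (rule nn_integral_count_space_nn_integral) measurable
  also have "\<dots> = (\<integral>\<^sup>+ j. ennreal (c j) * (\<integral>\<^sup>+ x. ennreal (G j x) * indicator (?I j) x \<partial>M) \<partial>count_space UNIV)"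
    by (intro nn_integral_cong nn_integral_cmult) measurable
  finally show ?thesis .
qed

text \<open>On the shell k ~ 2^j the integrand is of size 2^(jg) and the measure at most C 2^(-j).
  The resulting geometric series in 2^(j(g-1)) converges towards large j if g < 1 and towards small
  j if g > 1.\<close>

lemma weak_L1_tail:
  fixes k :: "'a \<Rightarrow> real"
  assumes [measurable]: "k \<in> borel_measurable M"
    and weak: "\<And>\<tau>. \<tau> > 0 \<Longrightarrow> emeasure M {y \<in> space M. k y > \<tau>} \<le> ennreal (C / \<tau>)"
    and C: "C \<ge> 0" and g: "0 \<le> g"
  shows "g < 1 \<Longrightarrow> \<exists>D\<ge>0. \<forall>\<tau>>0. (\<integral>\<^sup>+ y. ennreal (k y powr g * indicator {y. k y > \<tau>} y) \<partial>M) \<le> ennreal (D * \<tau> powr (g - 1))"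
    and "g > 1 \<Longrightarrow> \<exists>D\<ge>0. \<forall>\<tau>>0. (\<integral>\<^sup>+ y. ennreal (k y powr g * indicator {y. 0 < k y \<and> k y \<le> \<tau>} y) \<partial>M) \<le> ennreal (D * \<tau> powr (g - 1))"
proof -
  let ?sh = "\<lambda>j. \<integral>\<^sup>+ y. ennreal 1 * indicator {y. dy j < k y \<and> k y \<le> 2 * dy j} y \<partial>M"
  let ?hi = "\<lambda>\<tau>. \<integral>\<^sup>+ y. ennreal (k y powr g * indicator {y. k y > \<tau>} y) \<partial>M"
  let ?lo = "\<lambda>\<tau>. \<integral>\<^sup>+ y. ennreal (k y powr g * indicator {y. 0 < k y \<and> k y \<le> \<tau>} y) \<partial>M"
  have shell: "(?sh j) \<le> ennreal (C * dy (- j))" for j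
  proof -
    have "(?sh j) \<le> (\<integral>\<^sup>+ y. indicator {y \<in> space M. dy j < k y} y \<partial>M)"
      by (intro nn_integral_mono) (auto simp: indicator_def)
    also have "\<dots> = emeasure M {y \<in> space M. dy j < k y}" by (rule nn_integral_indicator) measurable
    finally show ?thesis using weak[OF dy_pos[of j]] by (simp add: dy_minus)
  qed
  have kp: "k y powr g \<le> 2 powr g * dy j powr g" if "dy j < k y" "k y \<le> 2 * dy j" for j y
    using that g dy_pos[of j] powr_mono2[of g "k y" "2 * dy j"] by (simp add: powr_mult)
  show "\<exists>D\<ge>0. \<forall>\<tau>>0. (?hi \<tau>) \<le> ennreal (D * \<tau> powr (g - 1))"
    if g1: "g < 1"
  proof (intro exI conjI allI impI)
    define b where "b = 1 - g"
    have b: "b > 0" using g1 by (simp add: b_def)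
    have bb: "1 - 2 powr (- b) > 0" using b powr_less_mono[of "-b" 0 2] by auto
    show "0 \<le> 2 powr g * C * (2 powr b / (1 - 2 powr (- b)))" using C bb by simp
    fix \<tau> :: real assume \<tau>: "\<tau> > 0"
    have "(?hi \<tau>)
      \<le> (\<integral>\<^sup>+ j. ennreal (2 powr g * dy j powr g * indicator {j. dy (- j) \<le> 2 / \<tau>} j) *
          (?sh j) \<partial>count_space UNIV)"
    proof (rule nn_integral_dyadic_le)
      fix j y assume j: "dy j < k y" "k y \<le> 2 * dy j"
      show "k y powr g * indicator {y. k y > \<tau>} y \<le> 2 powr g * dy j powr g * indicator {j. dy (- j) \<le> 2 / \<tau>} j * 1"
      proof (cases "k y > \<tau>")
        case True
        then have "dy (- j) \<le> 2 / \<tau>" using j \<tau> dy_pos[of j] by (simp add: dy_minus field_simps)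
        then show ?thesis using kp[OF j] True by simp
      qed simp
    qed (use \<tau> in auto)
    also have "\<dots> \<le> (\<integral>\<^sup>+ j. ennreal (2 powr g * dy j powr g * indicator {j. dy (- j) \<le> 2 / \<tau>} j) * ennreal (C * dy (- j)) \<partial>count_space UNIV)"
      by (intro nn_integral_mono mult_left_mono shell) simp
    also have "\<dots> = (\<integral>\<^sup>+ j. ennreal (2 powr g * C) * (ennreal (dy (- j) powr b) * indicator {j. dy (- j) \<le> 2 / \<tau>} j) \<partial>count_space UNIV)"
    proof (intro nn_integral_cong)
      fix j
      have "dy j powr g * dy (- j) = dy (- j) powr b"
        using dy_pos[of j] by (simp add: dy_minus b_def powr_divide powr_diff field_simps)
      then show "ennreal (2 powr g * dy j powr g * indicator {j. dy (- j) \<le> 2 / \<tau>} j) * ennreal (C * dy (- j))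
         = ennreal (2 powr g * C) * (ennreal (dy (- j) powr b) * indicator {j. dy (- j) \<le> 2 / \<tau>} j)"
        using C dy_pos[of "- j"]
        by (auto simp: indicator_def ennreal_mult[symmetric] mult_ac)
    qed
    also have "\<dots> = ennreal (2 powr g * C) * (\<integral>\<^sup>+ j. ennreal (dy (- j) powr b) * indicator {j. dy (- j) \<le> 2 / \<tau>} j \<partial>count_space UNIV)"
      by (rule nn_integral_cmult) simp
    also have "\<dots> \<le> ennreal (2 powr g * C) * ennreal ((2 / \<tau>) powr b / (1 - 2 powr (- b)))"
      using \<tau> by (intro mult_left_mono dyadic_sum_le' b) auto
    also have "\<dots> = ennreal (2 powr g * C * (2 powr b / (1 - 2 powr (- b))) * \<tau> powr (g - 1))"
    proof -
      have "(2 / \<tau>) powr b = 2 powr b * \<tau> powr (g - 1)"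
        using \<tau> by (simp add: powr_divide b_def powr_diff field_simps)
      then show ?thesis using C bb by (simp add: ennreal_mult[symmetric] mult_ac)
    qed
    finally show "(?hi \<tau>)
      \<le> ennreal (2 powr g * C * (2 powr b / (1 - 2 powr (- b))) * \<tau> powr (g - 1))" .
  qed
  show "\<exists>D\<ge>0. \<forall>\<tau>>0. (?lo \<tau>) \<le> ennreal (D * \<tau> powr (g - 1))"
    if g1: "g > 1"
  proof (intro exI conjI allI impI)
    define b where "b = g - 1"
    have b: "b > 0" using g1 by (simp add: b_def)
    have bb: "1 - 2 powr (- b) > 0" using b powr_less_mono[of "-b" 0 2] by auto
    show "0 \<le> 2 powr g * C * (1 / (1 - 2 powr (- b)))" using C bb by simp
    fix \<tau> :: real assume \<tau>: "\<tau> > 0"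
    have "(?lo \<tau>)
      \<le> (\<integral>\<^sup>+ j. ennreal (2 powr g * dy j powr g * indicator {j. dy j \<le> \<tau>} j) *
          (?sh j) \<partial>count_space UNIV)"
    proof (rule nn_integral_dyadic_le)
      fix j y assume j: "dy j < k y" "k y \<le> 2 * dy j"
      show "k y powr g * indicator {y. 0 < k y \<and> k y \<le> \<tau>} y \<le> 2 powr g * dy j powr g * indicator {j. dy j \<le> \<tau>} j * 1"
        using kp[OF j] j by (auto simp: indicator_def)
    qed auto
    also have "\<dots> \<le> (\<integral>\<^sup>+ j. ennreal (2 powr g * dy j powr g * indicator {j. dy j \<le> \<tau>} j) * ennreal (C * dy (- j)) \<partial>count_space UNIV)"
      by (intro nn_integral_mono mult_left_mono shell) simp
    also have "\<dots> = (\<integral>\<^sup>+ j. ennreal (2 powr g * C) * (ennreal (dy j powr b) * indicator {j. dy j \<le> \<tau>} j) \<partial>count_space UNIV)"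
    proof (intro nn_integral_cong)
      fix j
      have "dy j powr g * dy (- j) = dy j powr b"
        using dy_pos[of j] by (simp add: dy_minus b_def powr_diff)
      then show "ennreal (2 powr g * dy j powr g * indicator {j. dy j \<le> \<tau>} j) * ennreal (C * dy (- j))
         = ennreal (2 powr g * C) * (ennreal (dy j powr b) * indicator {j. dy j \<le> \<tau>} j)"
        using C dy_pos[of "- j"]
        by (auto simp: indicator_def ennreal_mult[symmetric] mult_ac)
    qed
    also have "\<dots> = ennreal (2 powr g * C) * (\<integral>\<^sup>+ j. ennreal (dy j powr b) * indicator {j. dy j \<le> \<tau>} j \<partial>count_space UNIV)"
      by (rule nn_integral_cmult) simp
    also have "\<dots> \<le> ennreal (2 powr g * C) * ennreal (\<tau> powr b / (1 - 2 powr (- b)))"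
      using \<tau> by (intro mult_left_mono dyadic_sum_le b) auto
    also have "\<dots> = ennreal (2 powr g * C * (1 / (1 - 2 powr (- b))) * \<tau> powr (g - 1))"
      using C bb by (simp add: ennreal_mult[symmetric] mult_ac b_def)
    finally show "(?lo \<tau>)
      \<le> ennreal (2 powr g * C * (1 / (1 - 2 powr (- b))) * \<tau> powr (g - 1))" .
  qed
qed

text \<open>Used with \<open>d\<^sub>j = 2\<^sup>-\<^sup>j\<close> for \<open>k\<close> itself and with \<open>d\<^sub>j = 2\<^sup>j\<close> for \<open>1/k\<close>: the two halves of a
  Hardy-type inequality.\<close>

lemma weighted_dyadic_sum:
  fixes W k :: "'a \<Rightarrow> real" and d :: "int \<Rightarrow> real"
  assumes [measurable]: "W \<in> borel_measurable M" "k \<in> borel_measurable M"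
    and W: "\<And>y. W y \<ge> 0" and k: "\<And>y. k y > 0"
    and B: "(\<integral>\<^sup>+ y. ennreal (W y) \<partial>M) \<le> ennreal B" "B \<ge> 0"
    and b: "b > 0" and d: "\<And>j. d j > 0"
    and sum: "\<And>c. c > 0 \<Longrightarrow> (\<integral>\<^sup>+ j. ennreal (d j powr b) * indicator {j. d j \<le> c} j \<partial>count_space UNIV)
        \<le> ennreal (c powr b / (1 - 2 powr (- b)))"
  obtains c where "\<And>j. c j \<ge> 0"
    and "\<And>j. (\<integral>\<^sup>+ y. ennreal (W y * k y powr (- b) * indicator {y. d j \<le> k y} y) \<partial>M) \<le> ennreal (c j * d j powr (- b))"
    and "(\<integral>\<^sup>+ j. ennreal (c j) \<partial>count_space UNIV) \<le> ennreal (B / (1 - 2 powr (- b)))"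
proof -
  define D where "D = 1 / (1 - 2 powr (- b))"
  have D: "D > 0" using b powr_less_mono[of "-b" 0 2] by (auto simp: D_def)
  define I where "I j = (\<integral>\<^sup>+ y. ennreal (W y * k y powr (- b) * indicator {y. d j \<le> k y} y) \<partial>M)" for j
  \<comment> \<open>Weighted so that, after exchanging sum and integral, the geometric sum over the
    j with \<open>d j \<le> k y\<close> produces \<open>k y powr b\<close> and cancels the negative
    power.\<close>
  define e where "e j = ennreal (d j powr b) * I j" for j
  have tot: "(\<integral>\<^sup>+ j. e j \<partial>count_space UNIV) \<le> ennreal (B * D)"
  proof -
    have "(\<integral>\<^sup>+ j. e j \<partial>count_space UNIV)
      = (\<integral>\<^sup>+ j. (\<integral>\<^sup>+ y. ennreal (W y * k y powr (- b)) * (ennreal (d j powr b) * indicator {j. d j \<le> k y} j) \<partial>M) \<partial>count_space UNIV)"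
    proof (intro nn_integral_cong)
      fix j
      have "e j = (\<integral>\<^sup>+ y. ennreal (d j powr b) * ennreal (W y * k y powr (- b) * indicator {y. d j \<le> k y} y) \<partial>M)"
        unfolding e_def I_def by (rule nn_integral_cmult[symmetric]) measurable
      also have "\<dots> = (\<integral>\<^sup>+ y. ennreal (W y * k y powr (- b)) * (ennreal (d j powr b) * indicator {j. d j \<le> k y} j) \<partial>M)"
        by (intro nn_integral_cong) (auto simp: indicator_def mult.commute)
      finally show "e j = \<dots>" .
    qed
    also have "\<dots> = (\<integral>\<^sup>+ y. (\<integral>\<^sup>+ j. ennreal (W y * k y powr (- b)) * (ennreal (d j powr b) * indicator {j. d j \<le> k y} j) \<partial>count_space UNIV) \<partial>M)"
    proof (rule nn_integral_count_space_nn_integral[symmetric])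
      fix j
      have "(\<lambda>y. indicator {j. d j \<le> k y} j :: ennreal) = indicator {y. d j \<le> k y}" by (auto simp: indicator_def)
      then show "(\<lambda>y. ennreal (W y * k y powr (- b)) * (ennreal (d j powr b) * indicator {j. d j \<le> k y} j)) \<in> borel_measurable M"
        by simp
    qed simp
    also have "\<dots> = (\<integral>\<^sup>+ y. ennreal (W y * k y powr (- b)) * (\<integral>\<^sup>+ j. ennreal (d j powr b) * indicator {j. d j \<le> k y} j \<partial>count_space UNIV) \<partial>M)"
      by (intro nn_integral_cong nn_integral_cmult) simp
    also have "\<dots> \<le> (\<integral>\<^sup>+ y. ennreal (W y * k y powr (- b)) * ennreal (k y powr b / (1 - 2 powr (- b))) \<partial>M)"
      by (intro nn_integral_mono mult_left_mono sum k) simp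
    also have "\<dots> = (\<integral>\<^sup>+ y. ennreal (W y) * ennreal D \<partial>M)"
    proof (intro nn_integral_cong)
      fix y
      have "W y * k y powr (- b) * (k y powr b / (1 - 2 powr (- b))) = W y * D"
        using k[of y] by (simp add: D_def powr_minus field_simps)
      then show "ennreal (W y * k y powr (- b)) * ennreal (k y powr b / (1 - 2 powr (- b))) = ennreal (W y) * ennreal D"
        using W[of y] D by (simp add: ennreal_mult[symmetric] D_def)
    qed
    also have "\<dots> = (\<integral>\<^sup>+ y. ennreal (W y) \<partial>M) * ennreal D" by (rule nn_integral_multc) measurable
    also have "\<dots> \<le> ennreal B * ennreal D" by (intro mult_right_mono B) simp
    also have "\<dots> = ennreal (B * D)" using B D by (simp add: ennreal_mult[symmetric])
    finally show ?thesis .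
  qed
  define c where "c j = enn2real (e j)" for j
  \<comment> \<open>Each term is at most the finite total, so the passage to real numbers preserves
    its value.\<close>
  have "e j < \<top>" for j
    using order_trans[OF nn_integral_ge_point[of j UNIV e] tot] by (auto simp: le_less_trans)
  then have ce: "ennreal (c j) = e j" for j by (simp add: c_def)
  show ?thesis
  proof (rule that[of c])
    show "c j \<ge> 0" for j by (simp add: c_def)
    have "I j = ennreal (c j * d j powr (- b))" for j
    proof -
      have "ennreal (c j * d j powr (- b)) = ennreal (d j powr (- b)) * (ennreal (d j powr b) * I j)"
        using ce[of j] by (simp add: ennreal_mult'' mult.commute e_def)
      also have "\<dots> = ennreal (d j powr (- b) * d j powr b) * I j"
        by (simp add: mult.assoc[symmetric] ennreal_mult[symmetric])
      also have "d j powr (- b) * d j powr b = 1" using d[of j] by (simp add: powr_minus)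
      finally show ?thesis by simp
    qed
    then show "(\<integral>\<^sup>+ y. ennreal (W y * k y powr (- b) * indicator {y. d j \<le> k y} y) \<partial>M) \<le> ennreal (c j * d j powr (- b))" for j
      by (simp add: I_def)
    show "(\<integral>\<^sup>+ j. ennreal (c j) \<partial>count_space UNIV) \<le> ennreal (B / (1 - 2 powr (- b)))"
      using tot by (simp add: ce D_def)
  qed
qed

subsection \<open>Interpolation between the two endpoint bounds\<close>

definition cut :: "'a set \<Rightarrow> ('a \<Rightarrow> complex) \<Rightarrow> 'a \<Rightarrow> complex" where
  "cut A f y = (if y \<in> A then f y else 0)"

lemma cut_measurable [measurable]:
  assumes [measurable]: "f \<in> borel_measurable M" "Measurable.pred M (\<lambda>y. y \<in> A)"
  shows "cut A f \<in> borel_measurable M"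
  unfolding cut_def[abs_def] by measurable

lemma cut_integrable:
  assumes "integrable M f" "Measurable.pred M (\<lambda>y. y \<in> A)"
  shows "integrable M (cut A f)"
proof (rule Bochner_Integration.integrable_bound[OF assms(1)])
  show "cut A f \<in> borel_measurable M" using assms by (intro cut_measurable) auto
qed (auto simp: cut_def)

text \<open>Only these four properties of the transform enter the interpolation. Additivity is used
  to split a function into two cut pieces.\<close>

locale pitt_operator =
  fixes M :: "'a measure" and X :: "'b measure" and T :: "('a \<Rightarrow> complex) \<Rightarrow> 'b \<Rightarrow> complex"
  assumes T_measurable: "\<And>f. integrable M f \<Longrightarrow> T f \<in> borel_measurable X"
    and T_bound: "\<And>f x. integrable M f \<Longrightarrow> x \<in> space X \<Longrightarrow> norm (T f x) \<le> (LINT y|M. norm (f y))"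
    and T_L2: "\<And>f. integrable M f \<Longrightarrow>
      (\<integral>\<^sup>+ x. ennreal ((norm (T f x))\<^sup>2) \<partial>X) \<le> (\<integral>\<^sup>+ y. ennreal ((norm (f y))\<^sup>2) \<partial>M)"
    and T_add: "\<And>f g x. integrable M f \<Longrightarrow> integrable M g \<Longrightarrow> x \<in> space X \<Longrightarrow>
      T (\<lambda>y. f y + g y) x = T f x + T g x"
begin

lemma T_split:
  assumes f: "integrable M f" and A: "Measurable.pred M (\<lambda>y. y \<in> A)" and x: "x \<in> space X"
  shows "norm (T f x) \<le> norm (T (cut A f) x) + norm (T (cut (- A) f) x)"
proof -
  have A': "Measurable.pred M (\<lambda>y. y \<in> - A)" using A by simp
  have "f = (\<lambda>y. cut A f y + cut (- A) f y)" by (auto simp: cut_def)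
  then have "T f x = T (cut A f) x + T (cut (- A) f) x"
    using T_add[OF cut_integrable[OF f A] cut_integrable[OF f A'] x] by simp
  then show ?thesis by (simp add: norm_triangle_ineq)
qed

text \<open>Real interpolation in the manner of Marcinkiewicz. With N in the role of the a-th power
  of the norm, N^(1/(a-1)) = N^(b-1) is the b-th power of the norm. As one endpoint is a sup bound,
  the cut can be chosen so that one piece stays below half of the level 2^j, and only the L^2 bound
  has to be summed.\<close>

lemma hausdorff_young:
  assumes a: "1 < a" "a < 2"
  shows "\<exists>C\<ge>0. \<forall>f N. integrable M f \<longrightarrow> N \<ge> 0 \<longrightarrow> (\<integral>\<^sup>+ y. ennreal (norm (f y) powr a) \<partial>M) \<le> ennreal N \<longrightarrow>
    (\<integral>\<^sup>+ x. ennreal (norm (T f x) powr (a / (a - 1))) \<partial>X) \<le> ennreal (C * N powr (1 / (a - 1)))"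
proof -
  define b where "b = a / (a - 1)"
  have b: "b > 2" using a by (simp add: b_def field_simps)
  have b1: "b - 1 = 1 / (a - 1)" using a by (simp add: b_def field_simps)
  \<comment> \<open>With x proportional to r^(1-a), this turns x^(b-2) into r^(a-2), which r^2
    completes to r^a.\<close>
  have ab: "(1 - a) * (b - 2) = a - 2" using a by (simp add: b_def field_simps)
  define D where "D = 1 / (1 - 2 powr (- (b - 2)))"
  have D: "D > 0" using b powr_less_mono[of "-(b-2)" 0 2] by (auto simp: D_def)
  define C where "C = 2 powr b * 4 * 2 powr (b - 2) * D"
  have C: "C \<ge> 0" using D by (simp add: C_def)
  let ?Na = "\<lambda>f. \<integral>\<^sup>+ y. ennreal (norm (f y) powr a) \<partial>M"
  have main: "(\<integral>\<^sup>+ x. ennreal (norm (T f x) powr b) \<partial>X) \<le> ennreal (C * N powr (b - 1))"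
    if f: "integrable M f" and N: "N \<ge> 0" and fN: "(?Na f) \<le> ennreal N" for f N
  proof (cases "N = 0")
    \<comment> \<open>Separated because the cut pieces are estimated by dividing by N.\<close>
    case True
    have [measurable]: "f \<in> borel_measurable M" using f by auto
    have "(?Na f) = 0" using fN True by simp
    then have "AE y in M. ennreal (norm (f y) powr a) = 0" by (subst (asm) nn_integral_0_iff_AE) auto
    then have "AE y in M. norm (f y) = 0" by eventually_elim auto
    then have "(LINT y|M. norm (f y)) = 0" by (simp add: integral_eq_zero_AE)
    then have "norm (T f x) = 0" if "x \<in> space X" for x using T_bound[OF f that] by simp
    then have "(\<integral>\<^sup>+ x. ennreal (norm (T f x) powr b) \<partial>X) = (\<integral>\<^sup>+ x. 0 \<partial>X)"
      by (intro nn_integral_cong) auto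
    then show ?thesis by simp
  next
    case False
    then have N0: "N > 0" using N by simp
    have [measurable]: "f \<in> borel_measurable M" using f by auto
    have [measurable]: "T f \<in> borel_measurable X" by (rule T_measurable[OF f])
    \<comment> \<open>At this level the part of \<open>f\<close> on \<open>A j\<close> has \<open>L\<^sup>1\<close> norm at most half of \<open>dy j\<close>, so it cannot
      account for \<open>\<bar>T f\<bar> > dy j\<close>.\<close>
    define A where "A j = {y. dy j * norm (f y) powr (a - 1) > 2 * N}" for j
    have A [measurable]: "Measurable.pred M (\<lambda>y. y \<in> A j)" for j unfolding A_def by simp
    have A' [measurable]: "Measurable.pred M (\<lambda>y. y \<in> - A j)" for j using A[of j] by simp
    have i1: "integrable M (cut (A j) f)" and i2: "integrable M (cut (- A j) f)" for j
      by (rule cut_integrable[OF f A] cut_integrable[OF f A'])+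
    have [measurable]: "T (cut (- A j) f) \<in> borel_measurable X" for j by (rule T_measurable[OF i2])
    let ?t = "\<lambda>j x. norm (T (cut (- A j) f) x)" and ?u = "\<lambda>j y. norm (cut (- A j) f y)" and ?sh = "\<lambda>j. {x. dy j < norm (T f x) \<and> norm (T f x) \<le> 2 * dy j}"
    have high: "(LINT y|M. norm (cut (A j) f y)) \<le> dy j / 2" for j
    proof -
      have "ennreal (LINT y|M. norm (cut (A j) f y)) = (\<integral>\<^sup>+ y. ennreal (norm (cut (A j) f y)) \<partial>M)"
        by (intro nn_integral_eq_integral[symmetric] integrable_norm i1 AE_I2) simp
      also have "\<dots> \<le> (\<integral>\<^sup>+ y. ennreal (dy j / (2 * N)) * ennreal (norm (f y) powr a) \<partial>M)"
      proof (rule nn_integral_mono)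
        fix y
        have "norm (cut (A j) f y) \<le> dy j / (2 * N) * norm (f y) powr a"
        proof (cases "y \<in> A j")
          case True
          have e: "norm (f y) powr a = norm (f y) * norm (f y) powr (a - 1)"
            using powr_mult_base[of "norm (f y)" "a - 1"] by simp
          have "norm (f y) * (2 * N) \<le> norm (f y) * (dy j * norm (f y) powr (a - 1))"
            using True by (intro mult_left_mono) (auto simp: A_def)
          then show ?thesis using True N0 unfolding e by (simp add: cut_def field_simps)
        next
          case False
          then show ?thesis using N0 dy_pos[of j] by (simp add: cut_def)
        qed
        then show "ennreal (norm (cut (A j) f y)) \<le> ennreal (dy j / (2 * N)) * ennreal (norm (f y) powr a)"
          using N0 dy_pos[of j] by (simp add: ennreal_mult[symmetric] ennreal_leI)
      qed
      also have "\<dots> = ennreal (dy j / (2 * N)) * (?Na f)"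
        by (rule nn_integral_cmult) measurable
      also have "\<dots> \<le> ennreal (dy j / (2 * N)) * ennreal N" by (intro mult_left_mono fN) simp
      also have "\<dots> = ennreal (dy j / 2)" using N0 dy_pos[of j] by (simp add: ennreal_mult[symmetric])
      finally show ?thesis using dy_pos[of j] by simp
    qed
    define c where "c j = 2 powr b * 4 * dy j powr (b - 2)" for j
    have c: "c j \<ge> 0" for j by (simp add: c_def)
    have "(\<integral>\<^sup>+ x. ennreal (norm (T f x) powr b) \<partial>X)
      \<le> (\<integral>\<^sup>+ j. ennreal (c j) * (\<integral>\<^sup>+ x. ennreal ((?t j x)\<^sup>2) * indicator (?sh j) x \<partial>X) \<partial>count_space UNIV)"
    proof (rule nn_integral_dyadic_le)
      fix j x assume x: "x \<in> space X" and j: "dy j < norm (T f x)" "norm (T f x) \<le> 2 * dy j"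
      have "norm (T (cut (A j) f) x) \<le> dy j / 2" using T_bound[OF i1 x] high by (rule order_trans)
      then have "dy j / 2 \<le> ?t j x" using T_split[OF f A x, of j] j by linarith
      then have "(dy j / 2)\<^sup>2 \<le> (?t j x)\<^sup>2"
        using dy_pos[of j] by (intro power_mono) auto
      then have g: "(dy j)\<^sup>2 \<le> 4 * (?t j x)\<^sup>2" by (simp add: power_divide)
      have "norm (T f x) powr b \<le> (2 * dy j) powr b" using j b by (intro powr_mono2) auto
      also have "\<dots> = 2 powr b * dy j powr (b - 2) * (dy j)\<^sup>2"
        using dy_pos[of j] by (simp add: powr_mult powr_diff powr_numeral)
      also have "\<dots> \<le> 2 powr b * dy j powr (b - 2) * (4 * (?t j x)\<^sup>2)"
        by (intro mult_left_mono g) simp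
      finally show "norm (T f x) powr b \<le> c j * (?t j x)\<^sup>2"
        by (simp add: c_def mult_ac)
    qed (use c in \<open>auto\<close>)
    also have "\<dots> \<le> (\<integral>\<^sup>+ j. ennreal (c j) * (\<integral>\<^sup>+ y. ennreal ((?u j y)\<^sup>2) \<partial>M) \<partial>count_space UNIV)"
    proof (intro nn_integral_mono mult_left_mono)
      fix j
      have "(\<integral>\<^sup>+ x. ennreal ((?t j x)\<^sup>2) * indicator (?sh j) x \<partial>X)
         \<le> (\<integral>\<^sup>+ x. ennreal ((?t j x)\<^sup>2) \<partial>X)"
        by (intro nn_integral_mono) (auto simp: indicator_def)
      also have "\<dots> \<le> (\<integral>\<^sup>+ y. ennreal ((?u j y)\<^sup>2) \<partial>M)" by (rule T_L2[OF i2])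
      finally show "(\<integral>\<^sup>+ x. ennreal ((?t j x)\<^sup>2) * indicator (?sh j) x \<partial>X)
         \<le> (\<integral>\<^sup>+ y. ennreal ((?u j y)\<^sup>2) \<partial>M)" .
    qed simp
    also have "\<dots> = (\<integral>\<^sup>+ j. (\<integral>\<^sup>+ y. ennreal (c j) * ennreal ((?u j y)\<^sup>2) \<partial>M) \<partial>count_space UNIV)"
      by (intro nn_integral_cong nn_integral_cmult[symmetric]) measurable
    also have "\<dots> = (\<integral>\<^sup>+ y. (\<integral>\<^sup>+ j. ennreal (c j) * ennreal ((?u j y)\<^sup>2) \<partial>count_space UNIV) \<partial>M)"
      by (rule nn_integral_count_space_nn_integral[symmetric]) measurable
    also have "\<dots> \<le> (\<integral>\<^sup>+ y. ennreal (C * N powr (b - 2)) * ennreal (norm (f y) powr a) \<partial>M)"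
    proof (rule nn_integral_mono)
      fix y
      show "(\<integral>\<^sup>+ j. ennreal (c j) * ennreal ((?u j y)\<^sup>2) \<partial>count_space UNIV) \<le> ennreal (C * N powr (b - 2)) * ennreal (norm (f y) powr a)"
      proof (cases "f y = 0")
        case True
        then have "cut (- A j) f y = 0" for j by (simp add: cut_def)
        then show ?thesis by simp
      next
        case False
        define r where "r = norm (f y)"
        have r: "r > 0" using False by (simp add: r_def)
        \<comment> \<open>For fixed y this is the threshold in 2^j up to which y is kept in the
          complement of \<open>A j\<close>; the sum over j is geometric up to x, with exponent b - 2
          > 0.\<close>
        define x where "x = 2 * N * r powr (1 - a)"
        have x: "x > 0" using N0 r by (simp add: x_def)
        have Ax: "y \<in> - A j \<longleftrightarrow> dy j \<le> x" for j
        proof -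
          have "r powr (1 - a) * r powr (a - 1) = 1" using r by (simp add: powr_add[symmetric])
          then have "x * r powr (a - 1) = 2 * N" by (simp add: x_def)
          moreover have "dy j \<le> x \<longleftrightarrow> dy j * r powr (a - 1) \<le> x * r powr (a - 1)"
            using r by simp
          ultimately show ?thesis unfolding A_def r_def by auto
        qed
        have "(\<integral>\<^sup>+ j. ennreal (c j) * ennreal ((?u j y)\<^sup>2) \<partial>count_space UNIV)
          = (\<integral>\<^sup>+ j. ennreal (2 powr b * 4 * r\<^sup>2) * (ennreal (dy j powr (b - 2)) * indicator {j. dy j \<le> x} j) \<partial>count_space UNIV)"
        proof (intro nn_integral_cong)
          fix j
          have "?u j y = r * indicator {j. dy j \<le> x} j"
            using Ax[of j] by (auto simp: cut_def r_def indicator_def)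
          then show "ennreal (c j) * ennreal ((?u j y)\<^sup>2) = ennreal (2 powr b * 4 * r\<^sup>2) * (ennreal (dy j powr (b - 2)) * indicator {j. dy j \<le> x} j)"
            by (auto simp: c_def indicator_def ennreal_mult[symmetric] mult_ac)
        qed
        also have "\<dots> = ennreal (2 powr b * 4 * r\<^sup>2) * (\<integral>\<^sup>+ j. ennreal (dy j powr (b - 2)) * indicator {j. dy j \<le> x} j \<partial>count_space UNIV)"
          by (rule nn_integral_cmult) simp
        also have "\<dots> \<le> ennreal (2 powr b * 4 * r\<^sup>2) * ennreal (x powr (b - 2) / (1 - 2 powr (- (b - 2))))"
          using b by (intro mult_left_mono dyadic_sum_le x) auto
        also have "\<dots> = ennreal (2 powr b * 4 * r\<^sup>2 * (x powr (b - 2) * D))"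
          using D by (simp add: ennreal_mult[symmetric] D_def)
        also have "2 powr b * 4 * r\<^sup>2 * (x powr (b - 2) * D) = C * N powr (b - 2) * r powr a"
        proof -
          have xb: "x powr (b - 2) = 2 powr (b - 2) * N powr (b - 2) * r powr (a - 2)"
            unfolding x_def using N0 r by (simp add: powr_mult powr_powr ab)
          have ra: "r powr a = r\<^sup>2 * r powr (a - 2)"
            using r by (simp add: powr_diff powr_numeral)
          show ?thesis unfolding C_def xb ra by (simp only: mult_ac)
        qed
        finally show ?thesis using C by (simp add: r_def ennreal_mult[symmetric])
      qed
    qed
    also have "\<dots> = ennreal (C * N powr (b - 2)) * (?Na f)"
      by (rule nn_integral_cmult) measurable
    also have "\<dots> \<le> ennreal (C * N powr (b - 2)) * ennreal N"
      by (intro mult_left_mono fN) simp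
    also have "\<dots> = ennreal (C * N powr (b - 1))"
    proof -
      have "N powr (b - 2) * N = N powr (b - 1)"
        using N0 powr_mult_base[of N "b - 2"] by (simp add: mult.commute)
      then show ?thesis using C N0 by (simp add: ennreal_mult[symmetric] mult.assoc)
    qed
    finally show ?thesis .
  qed
  show ?thesis
    unfolding b_def[symmetric] b1[symmetric] using C main by blast
qed

end

section \<open>Weighted estimates for the two pieces and the Pitt inequality\<close>

context pitt_operator
begin

text \<open>Hoelder with exponents p and its conjugate on the set k > 2^(-j): |f| is the 1/p-th
  power of the weighted density times k^(-\<delta>p), multiplied by k^(A+\<delta>). Since \<delta>
  is half of 1 - \<theta>, the power \<open>g\<close> of k in the second factor stays below 1 and
  its tail integral is finite, while the extra k^(-\<delta>p) makes the first factors summable over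
  j after rescaling.\<close>

lemma pitt_high:
  fixes k :: "'a \<Rightarrow> real"
  assumes km [measurable]: "k \<in> borel_measurable M" and k: "\<And>y. k y > 0"
    and weak: "\<forall>\<tau>>0. emeasure M {y \<in> space M. k y > \<tau>} \<le> ennreal (Ck / \<tau>)" and Ck: "Ck \<ge> 0"
    and p: "1 < p" and A: "0 < A" and \<theta>: "1 / p + A < 1"
  shows "\<exists>K\<ge>0. \<exists>D\<ge>0. \<forall>f B. integrable M f \<longrightarrow> B \<ge> 0 \<longrightarrow>
      (\<integral>\<^sup>+ y. ennreal (norm (f y) powr p * k y powr (- (A * p))) \<partial>M) \<le> ennreal B \<longrightarrow>
      (\<exists>c. (\<forall>j. c j \<ge> 0) \<and> (\<integral>\<^sup>+ j. ennreal (c j) \<partial>count_space UNIV) \<le> ennreal (D * B) \<and>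
        (\<forall>j. (LINT y|M. norm (cut {y. dy (- j) < k y} f y)) \<le> K * c j powr (1 / p) * dy j powr (1 - (1 / p + A))))"
proof -
  let ?W = "\<lambda>f. \<integral>\<^sup>+ y. ennreal (norm (f y) powr p * k y powr (- (A * p))) \<partial>M"
  define \<theta> where "\<theta> = 1 / p + A"
  define \<delta> where "\<delta> = (1 - \<theta>) / 2"
  define t where "t = 1 / p"
  define g where "g = (A + \<delta>) / (1 - t)"
  have t: "0 < t" "t < 1" using p by (auto simp: t_def)
  have \<delta>: "\<delta> > 0" using \<theta> by (simp add: \<delta>_def \<theta>_def)
  have Ad: "A + \<delta> < 1 - t" using \<theta> by (simp add: \<delta>_def \<theta>_def t_def field_simps)
  have g: "0 \<le> g" "g < 1" using A \<delta> t Ad by (auto simp: g_def)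
  define b where "b = \<delta> * p"
  have b: "b > 0" using \<delta> p by (simp add: b_def)
  define D where "D = 1 / (1 - 2 powr (- b))"
  have D: "D \<ge> 0" using b powr_less_mono[of "-b" 0 2] by (auto simp: D_def)
  from weak_L1_tail(1)[OF km weak[rule_format] Ck g(1) g(2)] obtain V where V: "V \<ge> 0"
    and Vb: "\<And>\<tau>. \<tau> > 0 \<Longrightarrow> (\<integral>\<^sup>+ y. ennreal (k y powr g * indicator {y. k y > \<tau>} y) \<partial>M) \<le> ennreal (V * \<tau> powr (g - 1))"
    by blast
  have main: "\<exists>c. (\<forall>j. c j \<ge> 0) \<and> (\<integral>\<^sup>+ j. ennreal (c j) \<partial>count_space UNIV) \<le> ennreal (D * B) \<and>
        (\<forall>j. (LINT y|M. norm (cut {y. dy (- j) < k y} f y)) \<le> V powr (1 - t) * c j powr t * dy j powr (1 - \<theta>))"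
    if f: "integrable M f" and B: "B \<ge> 0"
      and fB: "(?W f) \<le> ennreal B" for f B
  proof -
    have [measurable]: "f \<in> borel_measurable M" using f by auto
    define W where "W y = norm (f y) powr p * k y powr (- (A * p))" for y
    have [measurable]: "W \<in> borel_measurable M" unfolding W_def[abs_def] by measurable
    have W: "W y \<ge> 0" for y by (simp add: W_def)
    obtain c where c: "\<And>j. c j \<ge> 0"
      and cW: "\<And>j. (\<integral>\<^sup>+ y. ennreal (W y * k y powr (- b) * indicator {y. dy (- j) \<le> k y} y) \<partial>M) \<le> ennreal (c j * dy (- j) powr (- b))"
      and cs: "(\<integral>\<^sup>+ j. ennreal (c j) \<partial>count_space UNIV) \<le> ennreal (B / (1 - 2 powr (- b)))"
      by (rule weighted_dyadic_sum[of W M k B b "\<lambda>j. dy (- j)"])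
        (use W k fB B b dy_pos dyadic_sum_le' in \<open>auto simp: W_def\<close>)
    have "(LINT y|M. norm (cut {y. dy (- j) < k y} f y)) \<le> V powr (1 - t) * c j powr t * dy j powr (1 - \<theta>)" for j
    proof -
      define \<tau> where "\<tau> = dy (- j)"
      have \<tau>: "\<tau> > 0" by (simp add: \<tau>_def dy_pos)
      define u where "u y = W y * k y powr (- b) * indicator {y. \<tau> < k y} y" for y
      define v where "v y = k y powr g * indicator {y. \<tau> < k y} y" for y
      have [measurable]: "u \<in> borel_measurable M" "v \<in> borel_measurable M"
        unfolding u_def[abs_def] v_def[abs_def] by measurable
      have i: "integrable M (cut {y. \<tau> < k y} f)" by (rule cut_integrable[OF f]) simp
      have uv: "norm (cut {y. \<tau> < k y} f y) = u y powr t * v y powr (1 - t)" for y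
      proof (cases "\<tau> < k y")
        case True
        have "u y powr t = norm (f y) * (k y powr (- A) * k y powr (- \<delta>))"
          using True k[of y] p by (simp add: u_def W_def powr_mult powr_powr t_def b_def)
        moreover have "v y powr (1 - t) = k y powr (A + \<delta>)"
          using True t by (simp add: v_def powr_powr g_def)
        moreover have "k y powr (- A) * k y powr (- \<delta>) * k y powr (A + \<delta>) = 1"
          using k[of y] by (simp add: powr_add[symmetric])
        ultimately show ?thesis using True by (simp add: cut_def mult.assoc)
      qed (use t in \<open>auto simp: cut_def u_def\<close>)
      have "ennreal (LINT y|M. norm (cut {y. \<tau> < k y} f y)) = (\<integral>\<^sup>+ y. ennreal (norm (cut {y. \<tau> < k y} f y)) \<partial>M)"
        by (intro nn_integral_eq_integral[symmetric] integrable_norm i AE_I2) simp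
      also have "\<dots> = (\<integral>\<^sup>+ y. ennreal (u y powr t * v y powr (1 - t)) \<partial>M)" unfolding uv ..
      also have "\<dots> \<le> ennreal ((c j * \<tau> powr (- b)) powr t * (V * \<tau> powr (g - 1)) powr (1 - t))"
      proof (rule nn_integral_Holder)
        have "(\<integral>\<^sup>+ y. ennreal (u y) \<partial>M) \<le> (\<integral>\<^sup>+ y. ennreal (W y * k y powr (- b) * indicator {y. \<tau> \<le> k y} y) \<partial>M)"
          using W unfolding u_def by (intro nn_integral_mono ennreal_leI) (auto simp: indicator_def)
        then show "(\<integral>\<^sup>+ y. ennreal (u y) \<partial>M) \<le> ennreal (c j * \<tau> powr (- b))"
          using cW[of j] unfolding \<tau>_def by (rule order_trans)
        show "(\<integral>\<^sup>+ y. ennreal (v y) \<partial>M) \<le> ennreal (V * \<tau> powr (g - 1))"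
          unfolding v_def by (rule Vb[OF \<tau>])
      qed (use W c V t in \<open>auto simp: u_def v_def\<close>)
      also have "(c j * \<tau> powr (- b)) powr t * (V * \<tau> powr (g - 1)) powr (1 - t) = V powr (1 - t) * c j powr t * \<tau> powr (\<theta> - 1)"
      proof -
        have "- b * t + (g - 1) * (1 - t) = \<theta> - 1"
          using t p by (simp add: g_def b_def \<theta>_def t_def field_simps)
        then have "\<tau> powr (- b * t) * \<tau> powr ((g - 1) * (1 - t)) = \<tau> powr (\<theta> - 1)"
          by (simp add: powr_add[symmetric])
        then show ?thesis using c V by (simp add: powr_mult powr_powr mult_ac)
      qed
      also have "\<tau> powr (\<theta> - 1) = dy j powr (1 - \<theta>)"
        using dy_pos[of j] unfolding \<tau>_def by (simp add: dy_minus powr_divide powr_diff)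
      finally show ?thesis unfolding \<tau>_def by (simp add: ennreal_le_iff)
    qed
    with c cs show ?thesis unfolding D_def by (intro exI[of _ c]) simp
  qed
  show ?thesis
    by (rule exI[of _ "V powr (1 - t)"], rule conjI, simp, rule exI[of _ D], rule conjI, rule D,
        unfold \<theta>_def[symmetric], unfold t_def[symmetric], intro allI impI, rule main)
qed

text \<open>The counterpart on k \<le> 2^(-j), in L^(1/e). As 1/e < p, Hoelder applies with t =
  1/(ep). Here \<delta> is half of \<theta> - e, which puts the power \<open>g\<close> above 1, so
  that it is integrable where k is small; the first factor now carries the extra power
  k^(\<delta>p), and the sum over j is obtained with 1/k in place of k.\<close>

lemma pitt_low:
  fixes k :: "'a \<Rightarrow> real"
  assumes km [measurable]: "k \<in> borel_measurable M" and k: "\<And>y. k y > 0"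
    and weak: "\<forall>\<tau>>0. emeasure M {y \<in> space M. k y > \<tau>} \<le> ennreal (Ck / \<tau>)" and Ck: "Ck \<ge> 0"
    and p: "1 < p" and e: "1 / p < e" "e < 1 / p + A" "e < 1"
  shows "\<exists>K\<ge>0. \<exists>D\<ge>0. \<forall>f B. integrable M f \<longrightarrow> B \<ge> 0 \<longrightarrow>
      (\<integral>\<^sup>+ y. ennreal (norm (f y) powr p * k y powr (- (A * p))) \<partial>M) \<le> ennreal B \<longrightarrow>
      (\<exists>c. (\<forall>j. c j \<ge> 0) \<and> (\<integral>\<^sup>+ j. ennreal (c j) \<partial>count_space UNIV) \<le> ennreal (D * B) \<and>
        (\<forall>j. (\<integral>\<^sup>+ y. ennreal (norm (cut (- {y. dy (- j) < k y}) f y) powr (1 / e)) \<partial>M)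
            \<le> ennreal (K * c j powr (1 / (e * p)) * dy j powr (- ((1 / p + A - e) / e)))))"
proof -
  let ?W = "\<lambda>f. \<integral>\<^sup>+ y. ennreal (norm (f y) powr p * k y powr (- (A * p))) \<partial>M"
  define \<theta> where "\<theta> = 1 / p + A"
  define \<delta> where "\<delta> = (\<theta> - e) / 2"
  have e0: "e > 0" using e p by (meson less_trans zero_less_divide_1_iff zero_less_one)
  define a where "a = 1 / e"
  define t where "t = a / p"
  have t: "0 < t" "t < 1" using e p e0 by (auto simp: t_def a_def field_simps)
  have t1: "1 - t = (e - 1 / p) / e" using e0 p by (simp add: t_def a_def field_simps)
  define g where "g = (A - \<delta>) / (e - 1 / p)"
  have \<delta>: "\<delta> > 0" using e by (simp add: \<delta>_def \<theta>_def)
  have Ad: "A - \<delta> > e - 1 / p" using e by (simp add: \<delta>_def \<theta>_def field_simps)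
  have g: "g > 1" "g \<ge> 0" using e Ad by (auto simp: g_def)
  define b where "b = \<delta> * p"
  have b: "b > 0" using \<delta> p by (simp add: b_def)
  define D where "D = 1 / (1 - 2 powr (- b))"
  have D: "D \<ge> 0" using b powr_less_mono[of "-b" 0 2] by (auto simp: D_def)
  from weak_L1_tail(2)[OF km weak[rule_format] Ck g(2) g(1)] obtain V where V: "V \<ge> 0"
    and Vb: "\<And>\<tau>. \<tau> > 0 \<Longrightarrow> (\<integral>\<^sup>+ y. ennreal (k y powr g * indicator {y. 0 < k y \<and> k y \<le> \<tau>} y) \<partial>M) \<le> ennreal (V * \<tau> powr (g - 1))"
    by blast
  have main: "\<exists>c. (\<forall>j. c j \<ge> 0) \<and> (\<integral>\<^sup>+ j. ennreal (c j) \<partial>count_space UNIV) \<le> ennreal (D * B) \<and>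
        (\<forall>j. (\<integral>\<^sup>+ y. ennreal (norm (cut (- {y. dy (- j) < k y}) f y) powr a) \<partial>M) \<le> ennreal (V powr (1 - t) * c j powr t * dy j powr (- ((\<theta> - e) / e))))"
    if f: "integrable M f" and B: "B \<ge> 0"
      and fB: "(?W f) \<le> ennreal B" for f B
  proof -
    have [measurable]: "f \<in> borel_measurable M" using f by auto
    define W where "W y = norm (f y) powr p * k y powr (- (A * p))" for y
    have [measurable]: "W \<in> borel_measurable M" unfolding W_def[abs_def] by measurable
    have W: "W y \<ge> 0" for y by (simp add: W_def)
    obtain c where c: "\<And>j. c j \<ge> 0"
      and cW: "\<And>j. (\<integral>\<^sup>+ y. ennreal (W y * (1 / k y) powr (- b) * indicator {y. dy j \<le> 1 / k y} y) \<partial>M) \<le> ennreal (c j * dy j powr (- b))"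
      and cs: "(\<integral>\<^sup>+ j. ennreal (c j) \<partial>count_space UNIV) \<le> ennreal (B / (1 - 2 powr (- b)))"
      by (rule weighted_dyadic_sum[of W M "\<lambda>y. 1 / k y" B b dy])
        (use W k fB B b dy_pos dyadic_sum_le in \<open>auto simp: W_def\<close>)
    have "(\<integral>\<^sup>+ y. ennreal (norm (cut (- {y. dy (- j) < k y}) f y) powr a) \<partial>M) \<le> ennreal (V powr (1 - t) * c j powr t * dy j powr (- ((\<theta> - e) / e)))" for j
    proof -
      define \<tau> where "\<tau> = dy (- j)"
      have \<tau>: "\<tau> > 0" by (simp add: \<tau>_def dy_pos)
      define u where "u y = W y * k y powr b * indicator {y. k y \<le> \<tau>} y" for y
      define v where "v y = k y powr g * indicator {y. 0 < k y \<and> k y \<le> \<tau>} y" for y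
      have [measurable]: "u \<in> borel_measurable M" "v \<in> borel_measurable M"
        unfolding u_def[abs_def] v_def[abs_def] by measurable
      have uv: "norm (cut (- {y. \<tau> < k y}) f y) powr a = u y powr t * v y powr (1 - t)" for y
      proof (cases "k y \<le> \<tau>")
        case True
        have "u y powr t = norm (f y) powr a * (k y powr (- (A * a)) * k y powr (\<delta> * a))"
          using True k[of y] p by (simp add: u_def W_def powr_mult powr_powr t_def b_def)
        moreover have "v y powr (1 - t) = k y powr ((A - \<delta>) * a)"
        proof -
          have "g * (1 - t) = (A - \<delta>) * a" using e unfolding t1 by (simp add: g_def a_def)
          then show ?thesis using True k[of y] by (simp add: v_def powr_powr)
        qed
        moreover have "k y powr (- (A * a)) * k y powr (\<delta> * a) * k y powr ((A - \<delta>) * a) = 1"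
          using k[of y] by (simp add: powr_add[symmetric] algebra_simps)
        ultimately show ?thesis using True by (simp add: cut_def mult.assoc)
      qed (use t in \<open>auto simp: cut_def u_def\<close>)
      have "(\<integral>\<^sup>+ y. ennreal (norm (cut (- {y. \<tau> < k y}) f y) powr a) \<partial>M) = (\<integral>\<^sup>+ y. ennreal (u y powr t * v y powr (1 - t)) \<partial>M)"
        unfolding uv ..
      also have "\<dots> \<le> ennreal ((c j * dy j powr (- b)) powr t * (V * \<tau> powr (g - 1)) powr (1 - t))"
      proof (rule nn_integral_Holder)
        have "u y = W y * (1 / k y) powr (- b) * indicator {y. dy j \<le> 1 / k y} y" for y
        proof -
          have "dy j \<le> 1 / k y \<longleftrightarrow> k y \<le> \<tau>"
            using k[of y] dy_pos[of j] unfolding \<tau>_def by (simp add: dy_minus field_simps)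
          moreover have "(1 / k y) powr (- b) = k y powr b"
            using k[of y] by (simp add: powr_divide powr_minus field_simps)
          ultimately show ?thesis by (simp add: u_def indicator_def)
        qed
        then show "(\<integral>\<^sup>+ y. ennreal (u y) \<partial>M) \<le> ennreal (c j * dy j powr (- b))"
          using cW[of j] by simp
        show "(\<integral>\<^sup>+ y. ennreal (v y) \<partial>M) \<le> ennreal (V * \<tau> powr (g - 1))"
          unfolding v_def by (rule Vb[OF \<tau>])
      qed (use W c V t in \<open>auto simp: u_def v_def\<close>)
      also have "(c j * dy j powr (- b)) powr t * (V * \<tau> powr (g - 1)) powr (1 - t) = V powr (1 - t) * c j powr t * dy j powr (- ((\<theta> - e) / e))"
      proof -
        have tt: "\<tau> powr (g - 1) = dy j powr (1 - g)"
          using dy_pos[of j] unfolding \<tau>_def by (simp add: dy_minus powr_divide powr_diff)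
        have "(1 - g) * (1 - t) = ((e - 1 / p) - (A - \<delta>)) / e"
        proof -
          have "(1 - Y / X) * (X / e) = (X - Y) / e" if "X > 0" for X Y :: real
            using that e0 by (simp add: field_simps)
          then show ?thesis unfolding t1 g_def using e by simp
        qed
        moreover have "- b * t = - \<delta> / e" using p by (simp add: b_def t_def a_def)
        ultimately have "- b * t + (1 - g) * (1 - t) = - ((\<theta> - e) / e)"
          by (simp add: \<theta>_def add_divide_distrib diff_divide_distrib)
        then have "dy j powr (- b * t) * dy j powr ((1 - g) * (1 - t)) = dy j powr (- ((\<theta> - e) / e))"
          by (simp add: powr_add[symmetric])
        then show ?thesis unfolding tt using c V by (simp add: powr_mult powr_powr mult_ac)
      qed
      finally show ?thesis unfolding \<tau>_def .
    qed
    with c cs show ?thesis unfolding D_def by (intro exI[of _ c]) simp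
  qed
  have te: "t = 1 / (e * p)" by (simp add: t_def a_def)
  show ?thesis
    by (rule exI[of _ "V powr (1 - t)"], rule conjI, simp, rule exI[of _ D], rule conjI, rule D,
        unfold \<theta>_def[symmetric] te[symmetric] a_def[symmetric], intro allI impI, rule main)
qed

text \<open>\<open>1/k\<close> and \<open>h\<close> play the roles of powers of \<open>v\<^sub>\<alpha>\<close> and \<open>u\<close>, normalised so that \<open>k\<close> and \<open>h\<close> lie in
  weak \<open>L\<^sup>1\<close>.\<close>

theorem pitt:
  fixes k :: "'a \<Rightarrow> real" and h :: "'b \<Rightarrow> real"
  assumes km: "k \<in> borel_measurable M" and k: "\<And>y. k y > 0"
    and kweak: "\<forall>\<tau>>0. emeasure M {y \<in> space M. k y > \<tau>} \<le> ennreal (Ck / \<tau>)" and Ck: "Ck \<ge> 0"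
    and hm [measurable]: "h \<in> borel_measurable X" and h: "\<And>x. h x \<ge> 0"
    and hweak: "\<And>\<tau>. \<tau> > 0 \<Longrightarrow> emeasure X {x \<in> space X. h x > \<tau>} \<le> ennreal (Ch / \<tau>)" and Ch: "Ch \<ge> 0"
    and p: "1 < p" and pq: "p \<le> q" and A: "0 < A" and S: "0 < S"
    and \<theta>: "1 / 2 < 1 / p + A" "1 / p + A < 1" and bal: "1 / q = 1 - (1 / p + A) + S"
  shows "\<exists>C\<ge>0. \<forall>f B. integrable M f \<longrightarrow> B \<ge> 0 \<longrightarrow>
    (\<integral>\<^sup>+ y. ennreal (norm (f y) powr p * k y powr (- (A * p))) \<partial>M) \<le> ennreal B \<longrightarrow>
    (\<integral>\<^sup>+ x. ennreal (norm (T f x) powr q * h x powr (S * q)) \<partial>X) \<le> ennreal (C * B powr (q / p))"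
proof -
  let ?W = "\<lambda>f. \<integral>\<^sup>+ y. ennreal (norm (f y) powr p * k y powr (- (A * p))) \<partial>M"
  define \<theta> where "\<theta> = 1 / p + A"
  have q: "q > 1" using p pq by simp
  \<comment> \<open>The midpoint between the largest lower bound and \<theta>. The bound 1/2 gives
    1/e < 2 for Hausdorff-Young, 1/p is required by \<open>pitt_low\<close>, and 1 - 1/q yields
    \<open>s < 1\<close>, that is, a dual exponent b larger than q. The last bound is below \<theta>
    because S > 0.\<close>
  define e where "e = (max (max (1 / p) (1 / 2)) (1 - 1 / q) + \<theta>) / 2"
  have "1 / p < \<theta>" "1 / 2 < \<theta>" "1 - 1 / q < \<theta>" using \<theta> A S bal by (auto simp: \<theta>_def)
  then have e: "1 / p < e" "1 / 2 < e" "1 - 1 / q < e" "e < \<theta>" by (auto simp: e_def)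
  have e1: "e < 1" using e \<theta> by (simp add: \<theta>_def)
  have e0: "e > 0" using e by simp
  define a where "a = 1 / e"
  have a: "1 < a" "a < 2" using e e1 e0 by (auto simp: a_def field_simps)
  define b where "b = a / (a - 1)"
  have b: "b = 1 / (1 - e)" using e0 e1 by (simp add: b_def a_def field_simps)
  define s where "s = q / b"
  have s_eq: "s = q * (1 - e)" by (simp add: s_def b)
  have s: "0 < s" "s < 1"
  proof -
    show "0 < s" using q e1 by (simp add: s_eq)
    have "1 - e < 1 / q" using e by simp
    then show "s < 1" using q by (simp add: s_eq field_simps)
  qed
  \<comment> \<open>The balance condition in the form in which the powers of 2^j cancel, in both
    \<open>part1\<close> and \<open>part2\<close>.\<close>
  have bal': "S * q = 1 - q * (1 - \<theta>)"
    using bal q by (simp add: \<theta>_def field_simps)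
  from hausdorff_young[OF a] obtain H where H: "H \<ge> 0"
    and HY: "\<And>f N. integrable M f \<Longrightarrow> N \<ge> 0 \<Longrightarrow> (\<integral>\<^sup>+ y. ennreal (norm (f y) powr a) \<partial>M) \<le> ennreal N \<Longrightarrow>
    (\<integral>\<^sup>+ x. ennreal (norm (T f x) powr b) \<partial>X) \<le> ennreal (H * N powr (1 / (a - 1)))"
    unfolding b_def by blast
  from pitt_high[OF km k kweak Ck p A \<theta>(2), folded \<theta>_def] obtain K1 D1 where K1: "K1 \<ge> 0" and D1: "D1 \<ge> 0"
    and high: "\<forall>f B. integrable M f \<longrightarrow> B \<ge> 0 \<longrightarrow>
      (?W f) \<le> ennreal B \<longrightarrow>
      (\<exists>c. (\<forall>j. c j \<ge> 0) \<and> (\<integral>\<^sup>+ j. ennreal (c j) \<partial>count_space UNIV) \<le> ennreal (D1 * B) \<and>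
        (\<forall>j. (LINT y|M. norm (cut {y. dy (- j) < k y} f y)) \<le> K1 * c j powr (1 / p) * dy j powr (1 - \<theta>)))"
    by (elim exE conjE) (rule that; assumption)
  from pitt_low[OF km k kweak Ck p e(1) e(4)[unfolded \<theta>_def] e1, folded \<theta>_def a_def] obtain K2 D2 where K2: "K2 \<ge> 0" and D2: "D2 \<ge> 0"
    and low: "\<forall>f B. integrable M f \<longrightarrow> B \<ge> 0 \<longrightarrow>
      (?W f) \<le> ennreal B \<longrightarrow>
      (\<exists>c. (\<forall>j. c j \<ge> 0) \<and> (\<integral>\<^sup>+ j. ennreal (c j) \<partial>count_space UNIV) \<le> ennreal (D2 * B) \<and>
        (\<forall>j. (\<integral>\<^sup>+ y. ennreal (norm (cut (- {y. dy (- j) < k y}) f y) powr a) \<partial>M)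
            \<le> ennreal (K2 * c j powr (1 / (e * p)) * dy j powr (- ((\<theta> - e) / e)))))"
    by (elim exE conjE) (rule that; assumption)
  define L1 where "L1 = K1 powr q * Ch"
  define L2 where "L2 = (H * K2 powr (1 / (a - 1))) powr s * Ch powr (1 - s)"
  define E where "E = 2 powr (S * q) * 2 powr q"
  define C where "C = E * (L1 * D1 powr (q / p) + L2 * D2 powr (q / p))"
  have L1: "L1 \<ge> 0" and L2: "L2 \<ge> 0" and E: "E \<ge> 0" using Ch by (auto simp: L1_def L2_def E_def)
  have C: "C \<ge> 0" using L1 L2 E by (simp add: C_def)
  have "(\<integral>\<^sup>+ x. ennreal (norm (T f x) powr q * h x powr (S * q)) \<partial>X) \<le> ennreal (C * B powr (q / p))"
    if f: "integrable M f" and B: "B \<ge> 0"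
      and fB: "(?W f) \<le> ennreal B" for f B
  proof -
    from high[rule_format, OF f B fB] obtain c where c: "\<And>j. c j \<ge> 0"
      and cs: "(\<integral>\<^sup>+ j. ennreal (c j) \<partial>count_space UNIV) \<le> ennreal (D1 * B)"
      and c_high: "\<And>j. (LINT y|M. norm (cut {y. dy (- j) < k y} f y)) \<le> K1 * c j powr (1 / p) * dy j powr (1 - \<theta>)"
      by blast
    from low[rule_format, OF f B fB] obtain c' where c': "\<And>j. c' j \<ge> 0"
      and cs': "(\<integral>\<^sup>+ j. ennreal (c' j) \<partial>count_space UNIV) \<le> ennreal (D2 * B)"
      and c_low: "\<And>j. (\<integral>\<^sup>+ y. ennreal (norm (cut (- {y. dy (- j) < k y}) f y) powr a) \<partial>M)
            \<le> ennreal (K2 * c' j powr (1 / (e * p)) * dy j powr (- ((\<theta> - e) / e)))"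
      by blast
    have [measurable]: "f \<in> borel_measurable M" using f by auto
    \<comment> \<open>The level of k is the reciprocal of that of h. This choice makes the powers of
      2^j cancel in both parts.\<close>
    define P where "P j = {y. dy (- j) < k y}" for j
    have P [measurable]: "Measurable.pred M (\<lambda>y. y \<in> P j)" for j
      using km unfolding P_def by simp
    have P' [measurable]: "Measurable.pred M (\<lambda>y. y \<in> - P j)" for j using P[of j] by simp
    have i1: "integrable M (cut (P j) f)" and i2: "integrable M (cut (- P j) f)" for j
      by (rule cut_integrable[OF f P] cut_integrable[OF f P'])+
    have [measurable]: "T f \<in> borel_measurable X" "T (cut (P j) f) \<in> borel_measurable X" "T (cut (- P j) f) \<in> borel_measurable X" for j
      by (rule T_measurable[OF f] T_measurable[OF i1] T_measurable[OF i2])+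
    define R where "R j = {x. dy j < h x \<and> h x \<le> 2 * dy j}" for j
    have R [measurable]: "Measurable.pred X (\<lambda>x. x \<in> R j)" for j unfolding R_def by simp
    have RX: "(\<integral>\<^sup>+ x. ennreal (indicator (R j) x) \<partial>X) \<le> ennreal (Ch / dy j)" for j
    proof -
      have "(\<integral>\<^sup>+ x. ennreal (indicator (R j) x) \<partial>X) \<le> (\<integral>\<^sup>+ x. indicator {x \<in> space X. dy j < h x} x \<partial>X)"
        by (intro nn_integral_mono) (auto simp: indicator_def R_def)
      also have "\<dots> = emeasure X {x \<in> space X. dy j < h x}" by (rule nn_integral_indicator) measurable
      finally show ?thesis using hweak[OF dy_pos[of j]] by (rule order_trans)
    qed
    let ?n1 = "\<lambda>j x. norm (T (cut (P j) f) x) powr q" and ?n2 = "\<lambda>j x. norm (T (cut (- P j) f) x) powr q"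
    let ?I1 = "\<lambda>j. \<integral>\<^sup>+ x. ennreal (?n1 j x * indicator (R j) x) \<partial>X"
    let ?I2 = "\<lambda>j. \<integral>\<^sup>+ x. ennreal (?n2 j x * indicator (R j) x) \<partial>X"
    let ?I = "\<lambda>j. \<integral>\<^sup>+ x. ennreal (?n1 j x + ?n2 j x) * indicator {x. dy j < h x \<and> h x \<le> 2 * dy j} x \<partial>X"
    \<comment> \<open>Sup bound on the first piece times the measure Ch/2^j of the shell.\<close>
    have part1: "ennreal (dy j powr (S * q)) * (?I1 j)
       \<le> ennreal (L1 * c j powr (q / p))" for j
    proof -
      define m where "m = K1 * c j powr (1 / p) * dy j powr (1 - \<theta>)"
      have m: "m \<ge> 0" using K1 by (simp add: m_def)
      have "(?I1 j) \<le> (\<integral>\<^sup>+ x. ennreal (m powr q) * ennreal (indicator (R j) x) \<partial>X)"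
      proof (rule nn_integral_mono)
        fix x assume "x \<in> space X"
        then have "norm (T (cut (P j) f) x) \<le> m"
          using T_bound[OF i1, of x j] c_high[of j] unfolding m_def P_def by linarith
        then have "?n1 j x \<le> m powr q" using q by (intro powr_mono2) auto
        then show "ennreal (?n1 j x * indicator (R j) x) \<le> ennreal (m powr q) * ennreal (indicator (R j) x)"
          by (simp add: ennreal_mult[symmetric] ennreal_leI mult_right_mono)
      qed
      also have "\<dots> = ennreal (m powr q) * (\<integral>\<^sup>+ x. ennreal (indicator (R j) x) \<partial>X)"
        by (rule nn_integral_cmult) measurable
      also have "\<dots> \<le> ennreal (m powr q) * ennreal (Ch / dy j)"
        by (intro mult_left_mono RX) simp
      finally have "ennreal (dy j powr (S * q)) * (?I1 j)
        \<le> ennreal (dy j powr (S * q)) * (ennreal (m powr q) * ennreal (Ch / dy j))"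
        by (intro mult_left_mono) auto
      also have "\<dots> = ennreal (dy j powr (S * q) * (m powr q * (Ch / dy j)))"
        using Ch dy_pos[of j] by (simp add: ennreal_mult[symmetric])
      also have "dy j powr (S * q) * (m powr q * (Ch / dy j)) = L1 * c j powr (q / p)"
      proof -
        have mq: "m powr q = K1 powr q * c j powr (q / p) * dy j powr (q * (1 - \<theta>))"
          using K1 c dy_pos[of j] by (simp add: m_def powr_mult powr_powr mult.commute)
        have one: "dy j powr (S * q) * dy j powr (q * (1 - \<theta>)) / dy j = 1"
          using dy_pos[of j] unfolding bal' by (simp add: powr_add[symmetric])
        have gen: "x * ((u * v * y) * (Ch / d)) = (x * y / d) * (u * v * Ch)" for x y u v d :: real
          by simp
        show ?thesis unfolding mq gen one L1_def by simp
      qed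
      finally show ?thesis .
    qed
    \<comment> \<open>Hausdorff-Young gives the b-norm of the second piece. Since b > q, Hoelder on
      the shell lowers b to q at the cost of the power 1 - s of its measure.\<close>
    have part2: "ennreal (dy j powr (S * q)) * (?I2 j)
       \<le> ennreal (L2 * c' j powr (q / p))" for j
    proof -
      define N where "N = K2 * c' j powr (1 / (e * p)) * dy j powr (- ((\<theta> - e) / e))"
      have N: "N \<ge> 0" using K2 by (simp add: N_def)
      have "(\<integral>\<^sup>+ x. ennreal (norm (T (cut (- P j) f) x) powr b) \<partial>X) \<le> ennreal (H * N powr (1 / (a - 1)))"
        using c_low[of j] by (intro HY i2 N) (simp add: N_def P_def)
      then have "(\<integral>\<^sup>+ x. ennreal ((norm (T (cut (- P j) f) x) powr b) powr s * indicator (R j) x powr (1 - s)) \<partial>X)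
        \<le> ennreal ((H * N powr (1 / (a - 1))) powr s * (Ch / dy j) powr (1 - s))"
        using H Ch dy_pos[of j] s by (intro nn_integral_Holder RX) auto
      moreover have "(norm (T (cut (- P j) f) x) powr b) powr s * indicator (R j) x powr (1 - s) = ?n2 j x * indicator (R j) x" for x
      proof -
        have "b * s = q" using b e1 by (simp add: s_eq)
        then show ?thesis using s by (simp add: powr_powr indicator_def)
      qed
      ultimately have "ennreal (dy j powr (S * q)) * (?I2 j)
        \<le> ennreal (dy j powr (S * q)) * ennreal ((H * N powr (1 / (a - 1))) powr s * (Ch / dy j) powr (1 - s))"
        by (intro mult_left_mono) auto
      also have "\<dots> = ennreal (dy j powr (S * q) * ((H * N powr (1 / (a - 1))) powr s * (Ch / dy j) powr (1 - s)))"
        by (simp add: ennreal_mult[symmetric])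
      also have "dy j powr (S * q) * ((H * N powr (1 / (a - 1))) powr s * (Ch / dy j) powr (1 - s)) = L2 * c' j powr (q / p)"
      proof -
        define r where "r = 1 / (a - 1) * s"
        have r: "r = q * e" using e0 e1 by (simp add: r_def s_eq a_def field_simps)
        have pr: "(H * x powr (1 / (a - 1))) powr s = H powr s * x powr r" for x
          using H by (simp add: powr_mult powr_powr r_def)
        have Npr: "N powr r = K2 powr r * c' j powr (q / p) * dy j powr (- (q * (\<theta> - e)))"
          unfolding N_def using K2 c' dy_pos[of j] e0 p by (simp add: powr_mult powr_powr r mult.commute[of q "\<theta> - e"])
        have Nr: "(H * N powr (1 / (a - 1))) powr s = (H * K2 powr (1 / (a - 1))) powr s * c' j powr (q / p) * dy j powr (- (q * (\<theta> - e)))"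
          unfolding pr Npr by (simp only: mult_ac)
        have Cd: "(Ch / dy j) powr (1 - s) = Ch powr (1 - s) * dy j powr (s - 1)"
          using Ch dy_pos[of j] by (simp add: powr_divide powr_diff)
        have "S * q + - (q * (\<theta> - e)) + (s - 1) = 0"
          unfolding bal' s_eq by (simp add: algebra_simps)
        then have "dy j powr (S * q) * dy j powr (- (q * (\<theta> - e))) * dy j powr (s - 1) = 1"
          using dy_pos[of j] by (simp add: powr_add[symmetric])
        moreover have "dy j powr (S * q) * ((H * N powr (1 / (a - 1))) powr s * (Ch / dy j) powr (1 - s))
          = (dy j powr (S * q) * dy j powr (- (q * (\<theta> - e))) * dy j powr (s - 1)) * (L2 * c' j powr (q / p))"
          unfolding Nr Cd L2_def by (simp only: mult_ac)
        ultimately show ?thesis by simp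
      qed
      finally show ?thesis .
    qed
    have "(\<integral>\<^sup>+ x. ennreal (norm (T f x) powr q * h x powr (S * q)) \<partial>X)
      \<le> (\<integral>\<^sup>+ j. ennreal (E * dy j powr (S * q)) * (?I j) \<partial>count_space UNIV)"
    proof (rule nn_integral_dyadic_le)
      fix j x assume x: "x \<in> space X" and j: "dy j < h x" "h x \<le> 2 * dy j"
      define x1 where "x1 = norm (T (cut (P j) f) x)"
      define x2 where "x2 = norm (T (cut (- P j) f) x)"
      have x12: "x1 \<ge> 0" "x2 \<ge> 0" by (auto simp: x1_def x2_def)
      have "norm (T f x) \<le> x1 + x2" unfolding x1_def x2_def by (rule T_split[OF f P x])
      then have "norm (T f x) powr q \<le> (2 * max x1 x2) powr q"
        using q by (intro powr_mono2) auto
      also have "\<dots> = 2 powr q * max x1 x2 powr q" using x12 by (simp add: powr_mult)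
      also have "\<dots> \<le> 2 powr q * (x1 powr q + x2 powr q)"
        by (intro mult_left_mono) (auto simp: max_def)
      finally have t: "norm (T f x) powr q \<le> 2 powr q * (x1 powr q + x2 powr q)" .
      have "h x powr (S * q) \<le> (2 * dy j) powr (S * q)" using j h[of x] S q by (intro powr_mono2) auto
      also have "\<dots> = 2 powr (S * q) * dy j powr (S * q)" using dy_pos[of j] by (simp add: powr_mult)
      finally have hh: "h x powr (S * q) \<le> 2 powr (S * q) * dy j powr (S * q)" .
      have "norm (T f x) powr q * h x powr (S * q) \<le> (2 powr q * (x1 powr q + x2 powr q)) * (2 powr (S * q) * dy j powr (S * q))"
        by (intro mult_mono t hh) auto
      then show "norm (T f x) powr q * h x powr (S * q) \<le> E * dy j powr (S * q) * (?n1 j x + ?n2 j x)"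
        unfolding E_def x1_def x2_def by (simp only: mult_ac)
    next
      fix x assume "h x \<le> 0"
      then have "h x = 0" using h[of x] by simp
      then show "norm (T f x) powr q * h x powr (S * q) \<le> 0" using S q by simp
    qed (use E in auto)
    also have "\<dots> \<le> (\<integral>\<^sup>+ j. ennreal E * (ennreal L1 * ennreal (c j powr (q / p)) + ennreal L2 * ennreal (c' j powr (q / p))) \<partial>count_space UNIV)"
    proof (rule nn_integral_mono)
      fix j
      have "(?I j)
        = (\<integral>\<^sup>+ x. ennreal (?n1 j x * indicator (R j) x) + ennreal (?n2 j x * indicator (R j) x) \<partial>X)"
        by (intro nn_integral_cong) (auto simp: R_def indicator_def)
      also have "\<dots> = (?I1 j) + (?I2 j)"
        by (rule nn_integral_add) measurable
      finally have "ennreal (E * dy j powr (S * q)) * (?I j)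
        = ennreal E * (ennreal (dy j powr (S * q)) * (?I1 j) + ennreal (dy j powr (S * q)) * (?I2 j))"
        using E by (simp add: ennreal_mult distrib_left mult.assoc)
      also have "\<dots> \<le> ennreal E * (ennreal (L1 * c j powr (q / p)) + ennreal (L2 * c' j powr (q / p)))"
        by (intro mult_left_mono add_mono part1 part2) simp
      finally show "ennreal (E * dy j powr (S * q)) * (?I j)
        \<le> ennreal E * (ennreal L1 * ennreal (c j powr (q / p)) + ennreal L2 * ennreal (c' j powr (q / p)))"
        using L1 L2 by (simp add: ennreal_mult)
    qed
    also have "\<dots> = ennreal E * (ennreal L1 * (\<integral>\<^sup>+ j. ennreal (c j powr (q / p)) \<partial>count_space UNIV) + ennreal L2 * (\<integral>\<^sup>+ j. ennreal (c' j powr (q / p)) \<partial>count_space UNIV))"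
      by (simp add: nn_integral_cmult nn_integral_add)
    \<comment> \<open>Here p \<le> q enters: q/p \<ge> 1, so the bounds on the sums of
      \<open>c\<close> and \<open>c'\<close> pass to their powers.\<close>
    also have "\<dots> \<le> ennreal E * (ennreal L1 * ennreal ((D1 * B) powr (q / p)) + ennreal L2 * ennreal ((D2 * B) powr (q / p)))"
      using p pq B D1 D2 by (intro mult_left_mono add_mono nn_integral_powr_sum_le c c' cs cs') auto
    also have "\<dots> = ennreal (E * (L1 * (D1 * B) powr (q / p) + L2 * (D2 * B) powr (q / p)))"
      using E L1 L2 by (simp add: ennreal_mult[symmetric] ennreal_plus[symmetric] del: ennreal_plus)
    also have "E * (L1 * (D1 * B) powr (q / p) + L2 * (D2 * B) powr (q / p)) = C * B powr (q / p)"
      using B D1 D2 by (simp add: C_def powr_mult algebra_simps)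
    finally show ?thesis .
  qed
  with C show ?thesis by blast
qed

end

subsection \<open>Schwartz functions and the two weights\<close>

text \<open>The superlevel set lies in the ball of radius \<tau>^(-1/d), whose volume is
  proportional to 1/\<tau>.\<close>

lemma emeasure_norm_powr_gt:
  assumes \<tau>: "\<tau> > 0"
  shows "emeasure lborel {x \<in> space lborel. norm (x :: 'a::euclidean_space) powr (- real DIM('a)) > \<tau>}
    \<le> ennreal (unit_ball_vol (real DIM('a)) / \<tau>)"
proof -
  define d where "d = real DIM('a)"
  have d: "d > 0" by (simp add: d_def)
  define r where "r = \<tau> powr (- (1 / d))"
  have r: "r > 0" using \<tau> by (simp add: r_def)
  have rd: "r powr d = 1 / \<tau>"
  proof -
    have "r powr d = \<tau> powr (- (1 / d) * d)" unfolding r_def by (rule powr_powr)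
    also have "- (1 / d) * d = - 1" using d by simp
    finally show ?thesis using \<tau> by (simp add: powr_minus_divide)
  qed
  have "{x \<in> space lborel. norm (x :: 'a) powr (- d) > \<tau>} \<subseteq> ball 0 r"
  proof safe
    fix x :: 'a assume x: "\<tau> < norm x powr (- d)"
    then have x0: "norm x > 0" using \<tau> by (cases "x = 0") auto
    have "norm x powr d < r powr d"
      using x x0 \<tau> unfolding rd by (simp add: powr_minus_divide field_simps)
    then have "norm x < r" using x0 r d by (metis norm_ge_zero less_imp_le not_le powr_mono2)
    then show "x \<in> ball 0 r" by simp
  qed
  then have "emeasure lborel {x \<in> space lborel. norm (x :: 'a) powr (- d) > \<tau>} \<le> emeasure lborel (ball (0::'a) r)"
    by (rule emeasure_mono) simp
  also have "\<dots> = ennreal (unit_ball_vol d * r ^ DIM('a))"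
    using r by (simp add: emeasure_ball d_def)
  also have "r ^ DIM('a) = 1 / \<tau>" using r rd by (simp add: d_def powr_realpow)
  finally show ?thesis by (simp add: d_def)
qed

text \<open>The points with |x| \<ge> 1 are those where |x|^(-d) is positive and at most 1, so this
  is \<open>weak_L1_tail\<close> at level 1 and replaces polar coordinates.\<close>

lemma nn_integral_norm_powr_tail:
  assumes g: "g > 1"
  shows "(\<integral>\<^sup>+ x. ennreal (norm (x :: 'a::euclidean_space) powr (- (real DIM('a) * g)) * indicator {x. 1 \<le> norm x} x) \<partial>lborel) < \<infinity>"
proof -
  let ?k = "\<lambda>x::'a. norm x powr (- real DIM('a))"
  from weak_L1_tail(2)[of ?k lborel "unit_ball_vol (real DIM('a))" g] g emeasure_norm_powr_gt[where 'a = 'a]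
  obtain D where D: "\<And>\<tau>. \<tau> > 0 \<Longrightarrow> (\<integral>\<^sup>+ y. ennreal (?k y powr g * indicator {y. 0 < ?k y \<and> ?k y \<le> \<tau>} y) \<partial>lborel) \<le> ennreal (D * \<tau> powr (g - 1))"
    by auto
  have "(\<integral>\<^sup>+ x. ennreal (norm (x :: 'a) powr (- (real DIM('a) * g)) * indicator {x. 1 \<le> norm x} x) \<partial>lborel)
    \<le> (\<integral>\<^sup>+ y. ennreal (?k y powr g * indicator {y. 0 < ?k y \<and> ?k y \<le> 1} y) \<partial>lborel)"
  proof (intro nn_integral_mono ennreal_leI)
    fix x :: 'a
    have "?k x \<le> 1" if "1 \<le> norm x"
    proof -
      have "x \<noteq> 0" using that by auto
      then show ?thesis using that powr_mono[of "- real DIM('a)" 0 "norm x"] by simp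
    qed
    then show "norm x powr (- (real DIM('a) * g)) * indicator {x. 1 \<le> norm x} x \<le> ?k x powr g * indicator {y. 0 < ?k y \<and> ?k y \<le> 1} x"
      by (auto simp: indicator_def powr_powr)
  qed
  also have "\<dots> \<le> ennreal (D * 1 powr (g - 1))" by (rule D) simp
  also have "\<dots> < \<infinity>" by simp
  finally show ?thesis .
qed

lemma integrable_decay:
  "integrable lborel (\<lambda>x::'a::euclidean_space. (1 + norm x) powr (- (real DIM('a) * 2)))"
  unfolding integrable_iff_bounded
proof
  have "(\<integral>\<^sup>+ (x::'a). ennreal (norm ((1 + norm x) powr (- (real DIM('a) * 2)))) \<partial>lborel)
    \<le> (\<integral>\<^sup>+ (x::'a). indicator (ball 0 1) x + ennreal (norm x powr (- (real DIM('a) * 2)) * indicator {x. 1 \<le> norm x} x) \<partial>lborel)"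
  proof (rule nn_integral_mono)
    fix x :: 'a
    show "ennreal (norm ((1 + norm x) powr (- (real DIM('a) * 2))))
      \<le> indicator (ball 0 1) x + ennreal (norm x powr (- (real DIM('a) * 2)) * indicator {x. 1 \<le> norm x} x)"
    proof (cases "1 \<le> norm x")
      case True
      then have "(1 + norm x) powr (- (real DIM('a) * 2)) \<le> norm x powr (- (real DIM('a) * 2))"
        by (intro powr_mono2') auto
      then show ?thesis using True by (simp add: ennreal_leI)
    next
      case False
      have "(1 + norm x) powr (- (real DIM('a) * 2)) \<le> (1 + norm x) powr 0"
        by (intro powr_mono) auto
      then show ?thesis using False by (simp add: add_nonneg_eq_0_iff)
    qed
  qed
  also have "\<dots> = (\<integral>\<^sup>+ (x::'a). indicator (ball 0 1) x \<partial>lborel) + (\<integral>\<^sup>+ (x::'a). ennreal (norm x powr (- (real DIM('a) * 2)) * indicator {x. 1 \<le> norm x} x) \<partial>lborel)"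
    by (rule nn_integral_add) (auto intro!: borel_measurable_indicator)
  also have "\<dots> < \<infinity>"
    using nn_integral_norm_powr_tail[where 'a = 'a, of 2] by (simp add: emeasure_ball ennreal_add_less_top)
  finally show "(\<integral>\<^sup>+ (x::'a). ennreal (norm ((1 + norm x) powr (- (real DIM('a) * 2)))) \<partial>lborel) < \<infinity>" .
qed simp

lemma schwartzD:
  fixes f :: "'a::euclidean_space \<Rightarrow> 'b::real_normed_vector"
  assumes "f \<in> schwartz"
  shows "f differentiable (at x)" and "\<exists>B. \<forall>x. (1 + norm x) ^ N * norm (f x) \<le> B"
proof -
  have "(\<forall>x. iter_partial [] f differentiable (at x)) \<and>
     (\<forall>N. \<exists>B. \<forall>x. (1 + norm x) ^ N * norm (iter_partial [] f x) \<le> B)"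
    using assms unfolding schwartz_def mem_Collect_eq by (rule bspec) simp
  then show "f differentiable (at x)" and "\<exists>B. \<forall>x. (1 + norm x) ^ N * norm (f x) \<le> B"
    by simp_all
qed

lemma schwartz_measurable:
  fixes f :: "'a::euclidean_space \<Rightarrow> 'b::real_normed_vector"
  assumes "f \<in> schwartz"
  shows "f \<in> borel_measurable borel"
proof -
  have "continuous_on UNIV f"
    using schwartzD(1)[OF assms] by (simp add: continuous_on_eq_continuous_at differentiable_imp_continuous_within)
  then show ?thesis by (rule borel_measurable_continuous_onI)
qed

lemma schwartz_decay:
  fixes f :: "'a::euclidean_space \<Rightarrow> 'b::real_normed_vector"
  assumes "f \<in> schwartz"
  obtains B where "B \<ge> 0" "\<And>x::'a. norm (f x) \<le> B * (1 + norm x) powr (- real N)"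
proof -
  obtain B where B: "\<And>x. (1 + norm x) ^ N * norm (f x) \<le> B"
    using schwartzD(2)[OF assms] by blast
  show ?thesis
  proof (rule that)
    show "B \<ge> 0" using order_trans[OF _ B[of 0]] by simp
    fix x :: 'a
    have p: "1 + norm x > 0" by (simp add: add_pos_nonneg)
    have pw: "(1 + norm x) powr (- real N) = 1 / (1 + norm x) ^ N"
      using p by (simp add: powr_minus_divide powr_realpow)
    show "norm (f x) \<le> B * (1 + norm x) powr (- real N)"
      unfolding pw using B[of x] p by (simp add: field_simps)
  qed
qed

lemma schwartz_integrable:
  fixes f :: "'a::euclidean_space \<Rightarrow> complex"
  assumes f: "f \<in> schwartz"
  shows "integrable lborel f"
proof -
  obtain B where B: "B \<ge> 0" "\<And>x. norm (f x) \<le> B * (1 + norm x) powr (- real (DIM('a) * 2))"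
    using schwartz_decay[OF f] by blast
  show ?thesis
  proof (rule Bochner_Integration.integrable_bound)
    show "integrable lborel (\<lambda>x::'a. B * (1 + norm x) powr (- (real DIM('a) * 2)))"
      by (intro integrable_mult_right integrable_decay)
    show "AE x in lborel. norm (f x) \<le> norm (B * (1 + norm x) powr (- (real DIM('a) * 2)))"
      using B by (intro AE_I2) (simp add: abs_mult)
  qed (use schwartz_measurable[OF f] in simp)
qed

text \<open>17 = 1 + 16, as |z|^4 and t^2 are each at most (1 + |x|)^4.\<close>

lemma v_weight_le:
  assumes "\<alpha> > 0"
  shows "v_weight \<alpha> x \<le> 17 powr (\<alpha> / 4) * (1 + norm x) powr \<alpha>"
proof -
  define r where "r = norm x"
  have r: "r \<ge> 0" by (simp add: r_def)
  have "norm (fst x) \<le> r" "\<bar>snd x\<bar> \<le> r"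
    unfolding r_def using norm_fst_le[of "fst x" "snd x"] norm_snd_le[of "snd x" "fst x"] by simp_all
  then have "norm (fst x) ^ 4 \<le> r ^ 4" "(snd x)\<^sup>2 \<le> r\<^sup>2"
    by (auto intro: power_mono abs_le_square_iff[THEN iffD1])
  moreover have "r ^ 4 \<le> (1 + r) ^ 4" using r by (intro power_mono) auto
  moreover have "r\<^sup>2 \<le> (1 + r) ^ 4"
  proof -
    have "r\<^sup>2 \<le> (1 + r)\<^sup>2" using r by (intro power_mono) auto
    also have "\<dots> \<le> (1 + r) ^ 4" using r by (intro power_increasing) auto
    finally show ?thesis .
  qed
  ultimately have "norm (fst x) ^ 4 + 16 * (snd x)\<^sup>2 \<le> 17 * (1 + r) ^ 4" by linarith
  then have "v_weight \<alpha> x \<le> (17 * (1 + r) ^ 4) powr (\<alpha> / 4)"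
    unfolding v_weight_def using assms by (intro powr_mono2) auto
  also have "\<dots> = 17 powr (\<alpha> / 4) * (1 + r) powr \<alpha>"
  proof -
    have "(1 + r) ^ 4 = (1 + r) powr 4" using r by (simp add: powr_numeral)
    then have "((1 + r) ^ 4) powr (\<alpha> / 4) = (1 + r) powr (4 * (\<alpha> / 4))" by (simp only: powr_powr)
    then show ?thesis using r by (simp add: powr_mult)
  qed
  finally show ?thesis by (simp add: r_def)
qed

lemma v_weight_measurable [measurable]:
  "(\<lambda>x::(complex^'n) \<times> real. v_weight \<alpha> x) \<in> borel_measurable borel"
proof -
  have "(\<lambda>x::(complex^'n) \<times> real. norm (fst x) ^ 4 + 16 * (snd x)\<^sup>2) \<in> borel_measurable borel"
    by (intro borel_measurable_continuous_onI continuous_intros)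
  then show ?thesis unfolding v_weight_def by measurable
qed

text \<open>Guards the right-hand side of the final estimate: were the integrand not integrable, its
  Bochner integral would be 0 by default instead of infinite.\<close>

lemma schwartz_weighted_integrable:
  fixes f :: "(complex^'n) \<times> real \<Rightarrow> complex"
  assumes f: "f \<in> schwartz" and \<alpha>: "\<alpha> > 0" and p: "p > 1"
  shows "integrable lborel (\<lambda>x. norm (f x) powr p * v_weight \<alpha> x powr p)"
proof -
  define d where "d = real DIM((complex^'n) \<times> real) * 2"
  \<comment> \<open>Enough decay to absorb the growth of order \<alpha> of the weight and still
    leave twice the dimension; raising to the power p > 1 only improves it.\<close>
  define N where "N = nat \<lceil>\<alpha> + d\<rceil>"
  have N: "real N \<ge> \<alpha> + d" unfolding N_def by linarith
  have [measurable]: "f \<in> borel_measurable borel" by (rule schwartz_measurable[OF f])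
  obtain B where B: "B \<ge> 0" "\<And>x. norm (f x) \<le> B * (1 + norm x) powr (- real N)"
    using schwartz_decay[OF f] by blast
  define K where "K = B powr p * (17 powr (\<alpha> / 4)) powr p"
  have K: "K \<ge> 0" by (simp add: K_def)
  have le: "norm (f x) powr p * v_weight \<alpha> x powr p \<le> K * (1 + norm x) powr (- d)" for x
  proof -
    define R where "R = 1 + norm x"
    have R: "R \<ge> 1" by (simp add: R_def)
    have "norm (f x) powr p \<le> (B * R powr (- real N)) powr p"
      using B p unfolding R_def by (intro powr_mono2) auto
    moreover have "v_weight \<alpha> x powr p \<le> (17 powr (\<alpha> / 4) * R powr \<alpha>) powr p"
      using v_weight_le[OF \<alpha>, of x] p unfolding R_def by (intro powr_mono2) (auto simp: v_weight_def)
    ultimately have "norm (f x) powr p * v_weight \<alpha> x powr p \<le> (B * R powr (- real N)) powr p * (17 powr (\<alpha> / 4) * R powr \<alpha>) powr p"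
      by (intro mult_mono) auto
    also have "\<dots> = K * (R powr (- (real N * p)) * R powr (\<alpha> * p))"
      unfolding K_def using B R by (simp add: powr_mult powr_powr)
    also have "R powr (- (real N * p)) * R powr (\<alpha> * p) = R powr (- (real N - \<alpha>) * p)"
      by (simp add: powr_add[symmetric] algebra_simps)
    also have "\<dots> \<le> R powr (- d)"
    proof (rule powr_mono[OF _ R])
      have "d \<ge> 0" by (simp add: d_def)
      then have "d * 1 \<le> (real N - \<alpha>) * p" using N p by (intro mult_mono) auto
      then have "- ((real N - \<alpha>) * p) \<le> - d" by simp
      then show "- (real N - \<alpha>) * p \<le> - d" by (simp only: minus_mult_left)
    qed
    finally show ?thesis using K by (simp add: R_def mult_left_mono)
  qed
  show ?thesis
  proof (rule Bochner_Integration.integrable_bound)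
    show "integrable lborel (\<lambda>x::(complex^'n) \<times> real. K * (1 + norm x) powr (- d))"
      unfolding d_def by (intro integrable_mult_right integrable_decay)
    show "AE x in lborel. norm (norm (f x) powr p * v_weight \<alpha> x powr p) \<le> norm (K * (1 + norm x) powr (- d))"
      using le K by (intro AE_I2) (simp add: abs_mult)
  qed measurable
qed

section \<open>The ray transform as an instance of the abstract operator\<close>

lemma e_fun_integrable:
  fixes f :: "(complex^'n) \<times> real \<Rightarrow> complex"
  assumes f: "integrable lborel f" and l: "l \<noteq> 0"
  shows "integrable lborel (\<lambda>x. f x * e_fun k l (hmult (hinv x) (w, 0)))"
proof (rule integrable_mult_bounded[OF f])
  have "(\<lambda>p. exp (\<i> * of_real (- (l * snd p))) * tkernel k l w (fst p)) \<in> borel_measurable (borel \<Otimes>\<^sub>M borel)"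
    by measurable
  then show "(\<lambda>x. e_fun k l (hmult (hinv x) (w, 0))) \<in> borel_measurable lborel"
    unfolding e_fun_hmult borel_prod by simp
  show "norm (e_fun k l (hmult (hinv x) (w, 0))) \<le> fan_weight CARD('n) k" for x
    unfolding e_fun_hmult norm_mult norm_tkernel using lag_phi_le_weight[OF l] by simp
qed

lemma ray_transform_add:
  fixes f g :: "(complex^'n) \<times> real \<Rightarrow> complex"
  assumes f: "integrable lborel f" and g: "integrable lborel g"
  shows "ray_transform (\<lambda>x. f x + g x) p = ray_transform f p + ray_transform g p"
proof (cases "fst (fst p) = 0")
  case True
  then show ?thesis by (simp add: ray_transform_def)
next
  case False
  have "strichartz (\<lambda>x. f x + g x) (fst p) (snd p) = strichartz f (fst p) (snd p) + strichartz g (fst p) (snd p)"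
    using False e_fun_integrable[OF f False] e_fun_integrable[OF g False]
    by (simp add: strichartz_def distrib_right)
  then show ?thesis using False
    by (simp add: ray_transform_def strichartz_normalized_def Let_def distrib_left)
qed

interpretation ray: pitt_operator "lborel :: ((complex^'n) \<times> real) measure" "nu2 CARD('n) \<Otimes>\<^sub>M (lborel :: (complex^'n) measure)" ray_transform
proof
  fix f g :: "(complex^'n) \<times> real \<Rightarrow> complex" and x :: "(real \<times> real) \<times> (complex^'n)"
  assume f: "integrable lborel f"
  show "ray_transform f \<in> borel_measurable (nu2 CARD('n) \<Otimes>\<^sub>M lborel)" by (rule ray_transform_measurable[OF f])
  show "(\<integral>\<^sup>+ x. ennreal ((norm (ray_transform f x))\<^sup>2) \<partial>(nu2 CARD('n) \<Otimes>\<^sub>M lborel)) \<le> (\<integral>\<^sup>+ y. ennreal ((norm (f y))\<^sup>2) \<partial>lborel)"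
    by (rule ray_transform_Bessel[OF f])
  show "norm (ray_transform f x) \<le> (LINT y|lborel. norm (f y))" if "x \<in> space (nu2 CARD('n) \<Otimes>\<^sub>M lborel)"
    using that by (intro ray_transform_bound f) (auto simp: space_pair_measure space_nu2)
  show "ray_transform (\<lambda>y. f y + g y) x = ray_transform f x + ray_transform g x" if "integrable lborel g"
    by (rule ray_transform_add[OF f that])
qed

text \<open>\<open>v\<^sub>\<alpha>\<close> to the power \<open>-Q/\<alpha>\<close>; the value at the origin only serves to make it positive everywhere.\<close>

definition gauge_density :: "(complex^'n) \<times> real \<Rightarrow> real" where
  "gauge_density x = (if x = 0 then 1 else (norm (fst x) ^ 4 + 16 * (snd x)\<^sup>2) powr (- ((real CARD('n) + 1) / 2)))"

lemma gauge_pos: "x \<noteq> 0 \<Longrightarrow> norm (fst x) ^ 4 + 16 * (snd x)\<^sup>2 > (0::real)"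
proof (cases "fst x = 0")
  case True
  moreover assume "x \<noteq> 0"
  ultimately show ?thesis by (simp add: prod_eq_iff)
qed (simp add: add_pos_nonneg)

lemma gauge_density_pos: "gauge_density x > 0"
proof (cases "x = 0")
  case False
  from gauge_pos[OF this] show ?thesis unfolding gauge_density_def by auto
qed (simp add: gauge_density_def)

lemma gauge_density_measurable [measurable]:
  "(gauge_density :: (complex^'n) \<times> real \<Rightarrow> real) \<in> borel_measurable borel"
proof -
  have [measurable]: "(\<lambda>x::(complex^'n) \<times> real. norm (fst x) ^ 4 + 16 * (snd x)\<^sup>2) \<in> borel_measurable borel"
    by (intro borel_measurable_continuous_onI continuous_intros)
  show ?thesis unfolding gauge_density_def[abs_def] by measurable
qed

text \<open>With R = \<tau>^(-1/(2n+2)), the superlevel set lies in the product of the ball of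
  radius R and the interval from -R^2 to R^2. Its measure is at most a constant times R^(2n) R^2 =
  1/\<tau>, which reflects the homogeneous dimension 2n + 2.\<close>

lemma gauge_density_weak:
  assumes \<tau>: "\<tau> > 0"
  shows "emeasure lborel {x \<in> space lborel. gauge_density (x :: (complex^'n) \<times> real) > \<tau>}
    \<le> ennreal (2 * unit_ball_vol (2 * real CARD('n)) / \<tau>)"
proof -
  define N where "N = real CARD('n)"
  have N: "N > 0" by (simp add: N_def)
  define R where "R = \<tau> powr (- (1 / (2 * N + 2)))"
  have R: "R > 0" using \<tau> by (simp add: R_def)
  have R4: "R ^ 4 = \<tau> powr (- (2 / (N + 1)))"
  proof -
    have "R ^ 4 = R powr 4" using R by (simp add: powr_numeral)
    also have "\<dots> = \<tau> powr (- (1 / (2 * N + 2)) * 4)" unfolding R_def by (rule powr_powr)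
    also have "- (1 / (2 * N + 2)) * 4 = - (2 / (N + 1))" using N by (simp add: field_simps)
    finally show ?thesis .
  qed
  have RQ: "R ^ (2 * CARD('n)) * R\<^sup>2 = 1 / \<tau>"
  proof -
    have "R ^ (2 * CARD('n)) * R\<^sup>2 = R ^ (2 * CARD('n) + 2)" by (simp only: power_add)
    also have "\<dots> = R powr real (2 * CARD('n) + 2)" using R by (simp only: powr_realpow)
    also have "real (2 * CARD('n) + 2) = 2 * N + 2" by (simp add: N_def)
    also have "R powr (2 * N + 2) = \<tau> powr (- (1 / (2 * N + 2)) * (2 * N + 2))" unfolding R_def by (rule powr_powr)
    also have "- (1 / (2 * N + 2)) * (2 * N + 2) = - 1" using N by (simp add: field_simps)
    finally show ?thesis using \<tau> by (simp add: powr_minus_divide)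
  qed
  have "{x \<in> space lborel. gauge_density (x :: (complex^'n) \<times> real) > \<tau>} \<subseteq> ball 0 R \<times> {- R\<^sup>2..R\<^sup>2}"
  proof
    fix x :: "(complex^'n) \<times> real" assume "x \<in> {x \<in> space lborel. gauge_density x > \<tau>}"
    then have x: "gauge_density x > \<tau>" by simp
    show "x \<in> ball 0 R \<times> {- R\<^sup>2..R\<^sup>2}"
    proof (cases "x = 0")
      case True
      then show ?thesis using R by (simp add: zero_prod_def)
    next
      case False
      define G where "G = norm (fst x) ^ 4 + 16 * (snd x)\<^sup>2"
      have G: "G > 0" unfolding G_def by (rule gauge_pos[OF False])
      have "G powr (- ((N + 1) / 2)) > \<tau>" using x False by (simp add: gauge_density_def G_def N_def)
      then have "(G powr (- ((N + 1) / 2))) powr (- (2 / (N + 1))) < \<tau> powr (- (2 / (N + 1)))"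
        using \<tau> N by (intro powr_less_mono2_neg) auto
      moreover have "(G powr (- ((N + 1) / 2))) powr (- (2 / (N + 1))) = G"
      proof -
        have "- ((N + 1) / 2) * - (2 / (N + 1)) = 1" using N by simp
        then show ?thesis using G by (simp only: powr_powr powr_one)
      qed
      ultimately have "G < R ^ 4" by (simp only: R4)
      have "norm (fst x) ^ 4 < R ^ 4" "16 * (snd x)\<^sup>2 < R ^ 4"
      proof -
        have "0 \<le> norm (fst x) ^ 4" "0 \<le> (snd x)\<^sup>2" by simp_all
        with \<open>G < R ^ 4\<close> show "norm (fst x) ^ 4 < R ^ 4" "16 * (snd x)\<^sup>2 < R ^ 4"
          unfolding G_def by linarith+
      qed
      moreover have "0 \<le> (snd x)\<^sup>2" by simp
      moreover have "R ^ 4 = (R\<^sup>2)\<^sup>2" by simp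
      ultimately have "(snd x)\<^sup>2 \<le> (R\<^sup>2)\<^sup>2" by linarith
      then have "\<bar>snd x\<bar> \<le> R\<^sup>2" using abs_le_square_iff[of "snd x" "R\<^sup>2"] by simp
      moreover have "norm (fst x) < R"
        using \<open>norm (fst x) ^ 4 < R ^ 4\<close> R by (intro power_less_imp_less_base[of "norm (fst x)" 4 R]) auto
      ultimately show ?thesis by (cases x) auto
    qed
  qed
  then have "emeasure lborel {x \<in> space lborel. gauge_density (x :: (complex^'n) \<times> real) > \<tau>} \<le> emeasure lborel (ball (0::complex^'n) R \<times> {- R\<^sup>2..R\<^sup>2})"
    by (rule emeasure_mono) (simp add: borel_prod[symmetric] pair_measureI)
  also have "\<dots> = emeasure lborel (ball (0::complex^'n) R) * emeasure lborel {- R\<^sup>2..R\<^sup>2}"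
    unfolding lborel_prod[symmetric] by (rule lborel.emeasure_pair_measure_Times) auto
  also have "\<dots> = ennreal (unit_ball_vol (2 * real CARD('n)) * R ^ (2 * CARD('n))) * ennreal (2 * R\<^sup>2)"
    using R by (simp add: emeasure_ball mult.commute)
  also have "\<dots> = ennreal (2 * unit_ball_vol (2 * real CARD('n)) * (R ^ (2 * CARD('n)) * R\<^sup>2))"
    using R by (simp add: ennreal_mult[symmetric] mult_ac)
  finally show ?thesis unfolding RQ by simp
qed

section \<open>Weak integrability of the weight on the fan\<close>

lemma u_weight_measurable [measurable]:
  "(\<lambda>p. u_weight \<sigma> \<rho> (fst p) (snd p :: complex^'n)) \<in> borel_measurable (nu2 m \<Otimes>\<^sub>M lborel)"
  unfolding u_weight_def by measurable

lemma fan_weight_le: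
  assumes n: "n \<ge> (1::nat)"
  shows "fan_weight n k \<le> (2 * real k + real n) ^ (n - 1)"
proof -
  have "n - 1 \<le> k + n - 1" by simp
  from binomial_fact[OF this, where ?'a = real]
  have "fan_weight n k = real ((k + n - 1) choose (n - 1))"
    using n by (simp add: fan_weight_def mult.commute)
  also have "\<dots> \<le> real ((k + n - 1) ^ (n - 1))"
    by (intro of_nat_mono binomial_le_pow) simp
  also have "\<dots> = (real (k + n - 1)) ^ (n - 1)" by simp
  also have "\<dots> \<le> (2 * real k + real n) ^ (n - 1)"
    by (intro power_mono) auto
  finally show ?thesis .
qed

text \<open>The weight is at most x^(n-1) with x = 2k + n, so the total exponent of x is 2(n-1) -
  \<kappa>, which is below -3.\<close>

lemma fan_weight_powr_le:
  assumes n: "n \<ge> (1::nat)" and \<kappa>: "\<kappa> > 2 * real n + 1"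
  shows "(fan_weight n k)\<^sup>2 * (2 * real k + real n) powr (- \<kappa>) \<le> inverse (real (Suc k) ^ 2)"
proof -
  define x where "x = 2 * real k + real n"
  have x: "x \<ge> real (Suc k)" "x \<ge> 1" using n by (auto simp: x_def)
  have "(fan_weight n k)\<^sup>2 \<le> (x ^ (n - 1))\<^sup>2"
    unfolding x_def by (intro power_mono fan_weight_le n less_imp_le fan_weight_pos)
  also have "\<dots> = x powr (2 * (real n - 1))"
  proof -
    have "(x ^ (n - 1))\<^sup>2 = x ^ (2 * (n - 1))" by (simp add: power_mult[symmetric] mult.commute)
    also have "\<dots> = x powr real (2 * (n - 1))" using x by (simp only: powr_realpow)
    also have "real (2 * (n - 1)) = 2 * (real n - 1)" using n by (simp add: of_nat_diff)
    finally show ?thesis .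
  qed
  finally have "(fan_weight n k)\<^sup>2 * x powr (- \<kappa>) \<le> x powr (2 * (real n - 1)) * x powr (- \<kappa>)"
    by (rule mult_right_mono) simp
  also have "\<dots> = x powr (2 * (real n - 1) - \<kappa>)" by (simp add: powr_add[symmetric])
  also have "\<dots> \<le> x powr (- 2)" using x \<kappa> by (intro powr_mono) auto
  also have "\<dots> \<le> real (Suc k) powr (- 2)" using x by (intro powr_mono2') auto
  also have "\<dots> = inverse (real (Suc k) ^ 2)"
    by (simp add: powr_minus powr_numeral del: of_nat_Suc)
  finally show ?thesis by (simp add: x_def)
qed

text \<open>The integrand separates into a factor in k, summable by
  \<open>fan_weight_powr_le\<close>, and |\<lambda>|^(2n-\<kappa>) on |\<lambda>| > 1, integrable
  because \<kappa> > 2n + 1. The truncation at |\<lambda>| = 1 excludes the singularity at the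
  limiting ray.\<close>

lemma nn_integral_nu2_tail:
  assumes n: "n \<ge> (1::nat)" and \<kappa>: "\<kappa> > 2 * real n + 1"
  shows "(\<integral>\<^sup>+ a. ennreal (snd a powr (- \<kappa>) * indicator {a. 1 < \<bar>fst a\<bar>} a) \<partial>nu2 n) < \<infinity>"
proof -
  let ?\<phi> = "\<lambda>a :: real \<times> real. ennreal (snd a powr (- \<kappa>) * indicator {a. 1 < \<bar>fst a\<bar>} a)"
  have "?\<phi> \<in> borel_measurable (borel \<Otimes>\<^sub>M borel)" by measurable
  then have \<phi>: "?\<phi> \<in> borel_measurable (nu2 n)"
    unfolding measurable_cong_sets[OF sets_nu2 refl] borel_prod by (rule measurable_restrict_space1)
  let ?Z = "\<Sum>k. ennreal (inverse (real (Suc k) ^ 2))"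
  define g where "g = \<kappa> - 2 * real n"
  have g: "g > 1" using \<kappa> by (simp add: g_def)
  let ?m = "\<lambda>l::real. norm l powr (- (real DIM(real) * g)) * indicator {x. 1 \<le> norm x} l"
  have le: "(\<Sum>k. ennreal ((fan_weight n k)\<^sup>2) * ?\<phi> (l, (2 * real k + real n) * \<bar>l\<bar>)) * ennreal (\<bar>l\<bar> ^ (2 * n))
      \<le> ?Z * ennreal (?m l)" for l
    unfolding ennreal_suminf_multc[symmetric]
  proof (intro suminf_le summableI)
    fix k
    show "ennreal ((fan_weight n k)\<^sup>2) * ?\<phi> (l, (2 * real k + real n) * \<bar>l\<bar>) * ennreal (\<bar>l\<bar> ^ (2 * n))
        \<le> ennreal (inverse (real (Suc k) ^ 2)) * ennreal (?m l)"
    proof (cases "1 < \<bar>l\<bar>")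
      case True
      define x where "x = 2 * real k + real n"
      have x: "x > 0" using n by (simp add: x_def add_nonneg_pos)
      have "(x * \<bar>l\<bar>) powr (- \<kappa>) * \<bar>l\<bar> ^ (2 * n) = x powr (- \<kappa>) * \<bar>l\<bar> powr (- g)"
      proof -
        have "\<bar>l\<bar> ^ (2 * n) = \<bar>l\<bar> powr (2 * real n)" using True by (simp flip: powr_realpow)
        moreover have "\<bar>l\<bar> powr (- \<kappa>) * \<bar>l\<bar> powr (2 * real n) = \<bar>l\<bar> powr (- g)"
          by (simp add: powr_add[symmetric] g_def)
        ultimately show ?thesis using x by (simp add: powr_mult)
      qed
      then have "(fan_weight n k)\<^sup>2 * (x * \<bar>l\<bar>) powr (- \<kappa>) * \<bar>l\<bar> ^ (2 * n) = ((fan_weight n k)\<^sup>2 * x powr (- \<kappa>)) * \<bar>l\<bar> powr (- g)"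
        by simp
      also have "\<dots> \<le> inverse (real (Suc k) ^ 2) * \<bar>l\<bar> powr (- g)"
        unfolding x_def by (intro mult_right_mono fan_weight_powr_le n \<kappa>) simp
      finally show ?thesis using True
        by (simp add: x_def ennreal_mult[symmetric] ennreal_leI)
    qed simp
  qed
  have "(\<integral>\<^sup>+ a. ?\<phi> a \<partial>nu2 n) = ennreal (1 / (2 * pi) ^ (2 * n + 1)) *
    (\<integral>\<^sup>+ l. (\<Sum>k. ennreal ((fan_weight n k)\<^sup>2) * ?\<phi> (l, (2 * real k + real n) * \<bar>l\<bar>)) * ennreal (\<bar>l\<bar> ^ (2 * n)) \<partial>lborel)"
    unfolding fan_weight_def by (rule nn_integral_nu2[OF \<phi>])
  also have "\<dots> \<le> ennreal (1 / (2 * pi) ^ (2 * n + 1)) * (\<integral>\<^sup>+ l. ?Z * ennreal (?m l) \<partial>lborel)"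
    by (intro mult_left_mono nn_integral_mono le) simp
  also have "(\<integral>\<^sup>+ l. ?Z * ennreal (?m l) \<partial>lborel)
    = ?Z * (\<integral>\<^sup>+ l. ennreal (?m l) \<partial>lborel)"
    by (rule nn_integral_cmult) measurable
  also have "ennreal (1 / (2 * pi) ^ (2 * n + 1)) * \<dots> < \<infinity>"
  proof -
    have "summable (\<lambda>k. inverse (real (Suc k) ^ 2))"
      using inverse_power_summable[of 2, where ?'a = real] by (subst summable_Suc_iff) simp
    then have "?Z < \<infinity>"
      by (subst suminf_ennreal2) auto
    then show ?thesis
      using nn_integral_norm_powr_tail[where 'a = real, OF g] by (simp add: ennreal_mult_less_top)
  qed
  finally show ?thesis .
qed

text \<open>The power 2n/\<rho> turns |w|^(-\<rho>) into |w|^(-2n), which is weakly integrable in w,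
  and the exponent \<sigma> into \<kappa> = 2n\<sigma>/\<rho>. For fixed a the superlevel set in w
  has measure of order \<open>snd a\<close>^(-\<kappa>)/\<tau>, and the hypothesis on \<rho> and
  \<sigma> is the condition \<kappa> > 2n + 1 under which this can be integrated over the
  fan.\<close>

lemma u_weight_weak:
  fixes \<sigma> \<rho> :: real
  assumes \<rho>: "\<rho> > 0" and \<sigma>: "2 * real CARD('n) * \<sigma> > \<rho> * (2 * real CARD('n) + 1)"
  obtains C where "C \<ge> 0"
    "\<And>\<tau>. \<tau> > 0 \<Longrightarrow> emeasure (nu2 CARD('n) \<Otimes>\<^sub>M lborel)
       {p \<in> space (nu2 CARD('n) \<Otimes>\<^sub>M lborel). u_weight \<sigma> \<rho> (fst p) (snd p :: complex^'n) powr (2 * real CARD('n) / \<rho>) > \<tau>} \<le> ennreal (C / \<tau>)"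
proof -
  define N where "N = CARD('n)"
  have N1: "N \<ge> 1" by (simp add: N_def Suc_leI)
  define \<kappa> where "\<kappa> = 2 * real N * \<sigma> / \<rho>"
  have \<kappa>: "\<kappa> > 2 * real N + 1" using \<rho> \<sigma> by (simp add: \<kappa>_def N_def field_simps)
  define vol where "vol = unit_ball_vol (2 * real N)"
  have vol: "vol \<ge> 0" by (simp add: vol_def)
  let ?t = "\<lambda>a :: real \<times> real. snd a powr (- \<kappa>) * indicator {a. 1 < \<bar>fst a\<bar>} a"
  define I where "I = (\<integral>\<^sup>+ a. ennreal (?t a) \<partial>nu2 N)"
  have I: "I < \<infinity>" unfolding I_def by (rule nn_integral_nu2_tail[OF N1 \<kappa>])
  define J where "J = enn2real I"
  have J: "I = ennreal J" "J \<ge> 0" using I by (auto simp: J_def)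
  have main: "emeasure (nu2 N \<Otimes>\<^sub>M lborel) {p \<in> space (nu2 N \<Otimes>\<^sub>M lborel). u_weight \<sigma> \<rho> (fst p) (snd p :: complex^'n) powr (2 * real N / \<rho>) > \<tau>}
     \<le> ennreal (vol * J / \<tau>)" if \<tau>: "\<tau> > 0" for \<tau>
  proof -
    let ?A = "{p \<in> space (nu2 N \<Otimes>\<^sub>M lborel). u_weight \<sigma> \<rho> (fst p) (snd p :: complex^'n) powr (2 * real N / \<rho>) > \<tau>}"
    have A: "?A \<in> sets (nu2 N \<Otimes>\<^sub>M lborel)" by measurable
    have inner: "(\<integral>\<^sup>+ w. indicator ?A (a, w) \<partial>lborel) \<le> ennreal (vol / \<tau>) * ennreal (?t a)"
      if a: "a \<in> space (nu2 N)" for a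
    proof (cases "1 < \<bar>fst a\<bar>")
      case False
      then have "indicator ?A (a, w) = (0::ennreal)" for w
        using \<tau> by (auto simp: indicator_def u_weight_def)
      then show ?thesis by simp
    next
      case True
      then have "fst a \<noteq> 0" by auto
      with a obtain k where k: "a = (fst a, (2 * real k + real N) * \<bar>fst a\<bar>)"
        unfolding space_nu2 by (metis heisenberg_fan_cases)
      have "2 * real k + real N > 0" using N1 by (simp add: add_nonneg_pos)
      then have "(2 * real k + real N) * \<bar>fst a\<bar> > 0" using True by (intro mult_pos_pos) auto
      then have s: "snd a > 0" using k by (metis snd_conv)
      define \<tau>' where "\<tau>' = \<tau> * snd a powr \<kappa>"
      have \<tau>': "\<tau>' > 0" using \<tau> s by (simp add: \<tau>'_def)
      have "(\<integral>\<^sup>+ w. indicator ?A (a, w) \<partial>lborel) \<le> (\<integral>\<^sup>+ w. indicator {w \<in> space lborel. norm (w :: complex^'n) powr (- real DIM(complex^'n)) > \<tau>'} w \<partial>lborel)"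
      proof (rule nn_integral_mono)
        fix w :: "complex^'n"
        show "indicator ?A (a, w) \<le> (indicator {w \<in> space lborel. norm w powr (- real DIM(complex^'n)) > \<tau>'} w :: ennreal)"
        proof (cases "(a, w) \<in> ?A")
          case in_A: True
          then have u: "u_weight \<sigma> \<rho> a w powr (2 * real N / \<rho>) > \<tau>" by simp
          then have w: "w \<noteq> 0" using \<tau> by (cases "w = 0") (auto simp: u_weight_def)
          have "u_weight \<sigma> \<rho> a w powr (2 * real N / \<rho>) = snd a powr (- \<kappa>) * norm w powr (- (2 * real N))"
            using True w \<rho> by (simp add: u_weight_def powr_mult powr_powr \<kappa>_def mult_ac)
          then have "\<tau> < norm w powr (- (2 * real N)) / snd a powr \<kappa>"
            using u by (simp add: powr_minus_divide mult.commute)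
          then have "\<tau>' < norm w powr (- (2 * real N))"
            using s by (simp add: \<tau>'_def pos_less_divide_eq)
          then show ?thesis by (simp add: N_def mult.commute indicator_def)
        qed simp
      qed
      also have "\<dots> = emeasure lborel {w \<in> space lborel. norm (w :: complex^'n) powr (- real DIM(complex^'n)) > \<tau>'}"
        by (rule nn_integral_indicator) measurable
      also have "\<dots> \<le> ennreal (unit_ball_vol (real DIM(complex^'n)) / \<tau>')"
        by (rule emeasure_norm_powr_gt[OF \<tau>'])
      also have "unit_ball_vol (real DIM(complex^'n)) / \<tau>' = vol / \<tau> * snd a powr (- \<kappa>)"
        by (simp add: vol_def N_def \<tau>'_def powr_minus_divide mult.commute)
      finally show ?thesis using True vol \<tau> by (simp add: ennreal_mult[symmetric])
    qed
    have "emeasure (nu2 N \<Otimes>\<^sub>M lborel) ?A = (\<integral>\<^sup>+ a. (\<integral>\<^sup>+ w. indicator ?A (a, w) \<partial>lborel) \<partial>nu2 N)"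
      by (rule lborel.emeasure_pair_measure[OF A])
    also have "\<dots> \<le> (\<integral>\<^sup>+ a. ennreal (vol / \<tau>) * ennreal (?t a) \<partial>nu2 N)"
      by (rule nn_integral_mono) (rule inner)
    also have "\<dots> = ennreal (vol / \<tau>) * I"
      unfolding I_def
    proof (rule nn_integral_cmult)
      have "(\<lambda>a :: real \<times> real. ennreal (?t a)) \<in> borel_measurable (borel \<Otimes>\<^sub>M borel)" by measurable
      then show "(\<lambda>a. ennreal (?t a)) \<in> borel_measurable (nu2 N)"
        unfolding measurable_cong_sets[OF sets_nu2 refl] borel_prod by (rule measurable_restrict_space1)
    qed
    also have "\<dots> = ennreal (vol * J / \<tau>)"
      using J vol \<tau> by (simp add: ennreal_mult[symmetric])
    finally show ?thesis .
  qed
  show ?thesis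
    by (rule that[of "vol * J"]) (use vol J main in \<open>auto simp: N_def\<close>)
qed

section \<open>Translation of the exponents and of the weights\<close>

theorem theorem5p3p2:
  fixes p q p' \<alpha> \<sigma> \<rho> n :: real
  assumes n: "n = real CARD('n::finite)"
    and pq: "1 < p" "p \<le> q"
    and conj: "1 / p + 1 / p' = 1"
    and pos: "0 < \<alpha>" "0 < \<sigma>" "0 < \<rho>"
    and "\<rho> * (2 * n + 1) < 2 * n * \<sigma>"
    and "\<alpha> * p' < 2 * (n + 1)"
    and "q * \<rho> < 2 * n"
    and "- \<alpha> / (2 * (n + 1)) + 1 / p' + \<rho> / (2 * n) - 1 / q = 0"
  shows "\<exists>C::real. \<forall>f \<in> (schwartz :: ((complex^'n) \<times> real \<Rightarrow> complex) set).
      integrable (nu2 CARD('n) \<Otimes>\<^sub>M lborel)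
        (\<lambda>(a, w). norm (strichartz_normalized f a w) powr q * u_weight \<sigma> \<rho> a w powr q) \<and>
      (LINT (a, w)|(nu2 CARD('n) \<Otimes>\<^sub>M lborel).
          norm (strichartz_normalized f a w) powr q * u_weight \<sigma> \<rho> a w powr q) powr (1 / q)
      \<le> C * (LINT x|lborel. norm (f x) powr p * v_weight \<alpha> x powr p) powr (1 / p)"
proof -
  have n0: "n > 0" using n by simp
  define A where "A = \<alpha> / (2 * (n + 1))"
  define S where "S = \<rho> / (2 * n)"
  have A: "A > 0" and S: "S > 0" using pos n0 by (auto simp: A_def S_def)
  have q: "q > 1" using pq by simp
  have bal: "1 / q = 1 - (1 / p + A) + S"
    using assms(11) conj by (simp add: A_def S_def)
  have "1 / p < 1" using pq by simp
  \<comment> \<open>This also rules out p' = 0, where the quotient would be 0 by convention.\<close>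
  then have p': "1 / p' > 0" using conj by linarith
  then have p'0: "p' > 0" by simp
  \<comment> \<open>The hypothesis on \<alpha> p' in terms of A; it is the upper bound \<theta> <
    1.\<close>
  have "A < 1 / p'"
    using assms(9) p'0 n0 by (simp add: A_def field_simps)
  then have \<theta>1: "1 / p + A < 1" using conj by linarith
  \<comment> \<open>Otherwise \<open>q \<ge> p > 2\<close>, whereas the balance condition would give \<open>1/q > 1/2\<close>.\<close>
  have \<theta>2: "1 / 2 < 1 / p + A"
  proof (rule ccontr)
    assume "\<not> 1 / 2 < 1 / p + A"
    then have le: "1 / p + A \<le> 1 / 2" by simp
    then have "1 / p < 1 / 2" using A by linarith
    moreover have "1 / q \<le> 1 / p" using pq by (simp add: field_simps)
    ultimately show False using bal le S by linarith
  qed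
  let ?X = "nu2 CARD('n) \<Otimes>\<^sub>M (lborel :: (complex^'n) measure)"
  define h where "h p = u_weight \<sigma> \<rho> (fst p) (snd p :: complex^'n) powr (2 * real CARD('n) / \<rho>)" for p
  have hm: "h \<in> borel_measurable ?X" unfolding h_def[abs_def] by measurable
  obtain Ch where Ch: "Ch \<ge> 0" and hweak: "\<And>\<tau>. \<tau> > 0 \<Longrightarrow> emeasure ?X {x \<in> space ?X. h x > \<tau>} \<le> ennreal (Ch / \<tau>)"
    unfolding h_def using u_weight_weak[of \<rho> \<sigma>, where 'n = 'n] pos assms(8) unfolding n by blast
  have hS: "h p powr (S * q) = u_weight \<sigma> \<rho> (fst p) (snd p) powr q" for p
  proof -
    have "2 * real CARD('n) / \<rho> * (S * q) = q" using pos n0 by (simp add: S_def n)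
    then show ?thesis by (simp add: h_def powr_powr)
  qed
  have "\<exists>C\<ge>0. \<forall>f B. integrable lborel f \<longrightarrow> B \<ge> 0 \<longrightarrow>
    (\<integral>\<^sup>+ y. ennreal (norm (f y) powr p * gauge_density (y :: (complex^'n) \<times> real) powr (- (A * p))) \<partial>lborel) \<le> ennreal B \<longrightarrow>
    (\<integral>\<^sup>+ x. ennreal (norm (ray_transform f x) powr q * h x powr (S * q)) \<partial>?X) \<le> ennreal (C * B powr (q / p))"
    by (rule ray.pitt[where Ck = "2 * unit_ball_vol (2 * real CARD('n))" and Ch = Ch])
      (use gauge_density_pos gauge_density_weak hm hweak Ch pq A S \<theta>1 \<theta>2 bal in \<open>auto simp: h_def\<close>)
  then obtain C where C: "C \<ge> 0" and pitt: "\<And>f B. integrable lborel f \<Longrightarrow> B \<ge> 0 \<Longrightarrow>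
    (\<integral>\<^sup>+ y. ennreal (norm (f y) powr p * gauge_density (y :: (complex^'n) \<times> real) powr (- (A * p))) \<partial>lborel) \<le> ennreal B \<Longrightarrow>
    (\<integral>\<^sup>+ x. ennreal (norm (ray_transform f x) powr q * h x powr (S * q)) \<partial>?X) \<le> ennreal (C * B powr (q / p))"
    by blast
  show ?thesis
  \<comment> \<open>The abstract inequality bounds the integral by C B^(q/p); taking the q-th root
    gives C^(1/q) B^(1/p).\<close>
  proof (rule exI[of _ "C powr (1 / q)"], rule ballI)
    fix f :: "(complex^'n) \<times> real \<Rightarrow> complex" assume f: "f \<in> schwartz"
    have fi: "integrable lborel f" by (rule schwartz_integrable[OF f])
    have [measurable]: "ray_transform f \<in> borel_measurable ?X" by (rule ray_transform_measurable[OF fi])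
    define B where "B = (LINT x|lborel. norm (f x) powr p * v_weight \<alpha> x powr p)"
    have B: "B \<ge> 0" by (simp add: B_def)
    have "(\<integral>\<^sup>+ y. ennreal (norm (f y) powr p * gauge_density y powr (- (A * p))) \<partial>lborel) = (\<integral>\<^sup>+ y. ennreal (norm (f y) powr p * v_weight \<alpha> y powr p) \<partial>lborel)"
    \<comment> \<open>The two integrands agree away from the origin, where
      \<open>gauge_density\<close> was given the value 1; a single point is a null set.\<close>
    proof (rule nn_integral_cong_AE)
      have "AE y in lborel. y \<noteq> (0 :: (complex^'n) \<times> real)" by (rule AE_lborel_singleton)
      then show "AE y in lborel. ennreal (norm (f y) powr p * gauge_density y powr (- (A * p))) = ennreal (norm (f y) powr p * v_weight \<alpha> y powr p)"
      proof eventually_elim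
        case (elim y)
        have key: "(n + 1) / 2 * (A * p) = \<alpha> / 4 * p"
        proof -
          have *: "m / 2 * (\<alpha> / (2 * m) * p) = \<alpha> / 4 * p" if "m > 0" for m :: real
            using that by (simp add: field_simps)
          show ?thesis unfolding A_def by (rule *) (use n0 in simp)
        qed
        have "gauge_density y powr (- (A * p)) = v_weight \<alpha> y powr p"
          using elim unfolding gauge_density_def v_weight_def n[symmetric]
          by (simp only: if_False powr_powr minus_mult_minus key)
        then show ?case by simp
      qed
    qed
    also have "\<dots> = ennreal B"
      unfolding B_def by (intro nn_integral_eq_integral schwartz_weighted_integrable f pos pq AE_I2) simp
    finally have P: "(\<integral>\<^sup>+ x. ennreal (norm (ray_transform f x) powr q * h x powr (S * q)) \<partial>?X) \<le> ennreal (C * B powr (q / p))"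
      by (intro pitt fi B) simp
    let ?F = "\<lambda>x. norm (ray_transform f x) powr q * u_weight \<sigma> \<rho> (fst x) (snd x) powr q"
    have F: "(\<lambda>(a, w). norm (strichartz_normalized f a w) powr q * u_weight \<sigma> \<rho> a w powr q) = ?F"
      using q by (auto simp: ray_transform_def u_weight_def fun_eq_iff)
    have FP: "(\<integral>\<^sup>+ x. ennreal (?F x) \<partial>?X) \<le> ennreal (C * B powr (q / p))"
      using P unfolding hS .
    have Fi: "integrable ?X ?F"
      by (rule integrableI_nonneg) (use FP in \<open>auto simp: le_less_trans\<close>)
    have "ennreal (LINT x|?X. ?F x) = (\<integral>\<^sup>+ x. ennreal (?F x) \<partial>?X)"
      by (intro nn_integral_eq_integral[symmetric] Fi AE_I2) simp
    also note FP
    finally have "(LINT x|?X. ?F x) \<le> C * B powr (q / p)"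
      using C by (simp add: ennreal_le_iff)
    then have "(LINT x|?X. ?F x) powr (1 / q) \<le> (C * B powr (q / p)) powr (1 / q)"
      using q by (intro powr_mono2) auto
    also have "\<dots> = C powr (1 / q) * B powr (1 / p)"
      using C q by (simp add: powr_mult powr_powr)
    finally show "integrable ?X (\<lambda>(a, w). norm (strichartz_normalized f a w) powr q * u_weight \<sigma> \<rho> a w powr q) \<and>
      (LINT (a, w)|?X. norm (strichartz_normalized f a w) powr q * u_weight \<sigma> \<rho> a w powr q) powr (1 / q)
      \<le> C powr (1 / q) * (LINT x|lborel. norm (f x) powr p * v_weight \<alpha> x powr p) powr (1 / p)"
      unfolding F B_def[symmetric] using Fi by simp
  qed
qed

end
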